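(* $\#\mathfrak{AN}=\#\mathfrak{AN}_s\cdot\#\mathfrak{AN}(\Pi_l)$, where $\mathfrak{AN}$ is the set of all antichains of $\Delta^+$, $\mathfrak{AN}_s$ the set of short antichains of $\Delta^+$, and $\mathfrak{AN}(\Pi_l)$ the set of all antichains of $\Delta(\Pi_l)^+$.
   Context: $\Delta$ is an irreducible reduced crystallographic root system with roots of two different lengths, $\Delta^+$ a positive system, $\Pi$ its simple roots and $\Pi_l$ the long simple roots. For a positive system with simple roots $S$, $\mu\preccurlyeq\gamma$ iff $\gamma-\mu$ is a nonnegative integer combination of elements of $S$; an antichain is a set (possibly empty) of pairwise incomparable positive roots; it is short if it consists of short roots. $\Delta(\Pi_l)$ denotes the root system with set of simple roots $\Pi_l$ (the roots of $\Delta$ lying in the $\mathbb Z$-span of $\Pi_l$), with positive roots $\Delta(\Pi_l)^+$. *)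

theory Defs
  imports "HOL-Analysis.Analysis"
begin

definition root_reflection :: "'a::euclidean_space \<Rightarrow> 'a \<Rightarrow> 'a" where
  "root_reflection \<alpha> \<beta> = \<beta> - (2 * (\<beta> \<bullet> \<alpha>) / (\<alpha> \<bullet> \<alpha>)) *\<^sub>R \<alpha>"

definition root_system :: "'a::euclidean_space set \<Rightarrow> bool" where
  "root_system \<Delta> \<longleftrightarrow>
     finite \<Delta> \<and> 0 \<notin> \<Delta> \<and> span \<Delta> = UNIV \<and>
     (\<forall>\<alpha>\<in>\<Delta>. \<forall>\<beta>\<in>\<Delta>. root_reflection \<alpha> \<beta> \<in> \<Delta>)"

definition crystallographic :: "'a::euclidean_space set \<Rightarrow> bool" where
  "crystallographic \<Delta> \<longleftrightarrow> (\<forall>\<alpha>\<in>\<Delta>. \<forall>\<beta>\<in>\<Delta>. 2 * (\<beta> \<bullet> \<alpha>) / (\<alpha> \<bullet> \<alpha>) \<in> \<int>)"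

definition reduced_roots :: "'a::euclidean_space set \<Rightarrow> bool" where
  "reduced_roots \<Delta> \<longleftrightarrow> (\<forall>\<alpha>\<in>\<Delta>. \<forall>c. c *\<^sub>R \<alpha> \<in> \<Delta> \<longrightarrow> c = 1 \<or> c = -1)"

definition irreducible_roots :: "'a::euclidean_space set \<Rightarrow> bool" where
  "irreducible_roots \<Delta> \<longleftrightarrow>
     \<Delta> \<noteq> {} \<and>
     \<not> (\<exists>\<Delta>1 \<Delta>2. \<Delta>1 \<noteq> {} \<and> \<Delta>2 \<noteq> {} \<and> \<Delta>1 \<union> \<Delta>2 = \<Delta> \<and> \<Delta>1 \<inter> \<Delta>2 = {} \<and>
                (\<forall>\<alpha>\<in>\<Delta>1. \<forall>\<beta>\<in>\<Delta>2. \<alpha> \<bullet> \<beta> = 0))"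

definition two_lengths :: "'a::euclidean_space set \<Rightarrow> bool" where
  "two_lengths \<Delta> \<longleftrightarrow> (\<exists>\<alpha>\<in>\<Delta>. \<exists>\<beta>\<in>\<Delta>. norm \<alpha> \<noteq> norm \<beta>)"

text \<open>In an irreducible reduced crystallographic root system at most two root lengths occur,
  so when two lengths occur every root is either long or short and never both.\<close>

definition long_roots :: "'a::euclidean_space set \<Rightarrow> 'a set" where
  "long_roots \<Delta> = {\<gamma> \<in> \<Delta>. \<forall>\<beta>\<in>\<Delta>. norm \<beta> \<le> norm \<gamma>}"

definition short_roots :: "'a::euclidean_space set \<Rightarrow> 'a set" where
  "short_roots \<Delta> = {\<gamma> \<in> \<Delta>. \<forall>\<beta>\<in>\<Delta>. norm \<gamma> \<le> norm \<beta>}"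

text \<open>Positive systems are those determined by a vector lying on no root hyperplane,
  that is, by a Weyl chamber.\<close>

definition positive_system :: "'a::euclidean_space set \<Rightarrow> 'a set \<Rightarrow> bool" where
  "positive_system \<Delta> P \<longleftrightarrow>
     (\<exists>v. (\<forall>\<alpha>\<in>\<Delta>. v \<bullet> \<alpha> \<noteq> 0) \<and> P = {\<alpha> \<in> \<Delta>. v \<bullet> \<alpha> > 0})"

definition simple_roots :: "'a::euclidean_space set \<Rightarrow> 'a set" where
  "simple_roots P = {\<alpha> \<in> P. \<not> (\<exists>\<beta>\<in>P. \<exists>\<gamma>\<in>P. \<alpha> = \<beta> + \<gamma>)}"

definition long_simple_roots :: "'a::euclidean_space set \<Rightarrow> 'a set \<Rightarrow> 'a set" where
  "long_simple_roots \<Delta> P = simple_roots P \<inter> long_roots \<Delta>"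

text \<open>The order and the antichains take the set \<open>S\<close> of simple roots as a parameter, because
  the order on the subsystem spanned by \<open>S\<close> uses combinations of elements of \<open>S\<close> only.
  In all uses \<open>S\<close> is finite.\<close>

definition root_le :: "'a::euclidean_space set \<Rightarrow> 'a \<Rightarrow> 'a \<Rightarrow> bool" where
  "root_le S \<mu> \<gamma> \<longleftrightarrow> (\<exists>c :: 'a \<Rightarrow> nat. \<gamma> - \<mu> = (\<Sum>\<alpha>\<in>S. real (c \<alpha>) *\<^sub>R \<alpha>))"

definition antichains :: "'a::euclidean_space set \<Rightarrow> 'a set \<Rightarrow> 'a set set" where
  "antichains S P =
     {A. A \<subseteq> P \<and> (\<forall>\<mu>\<in>A. \<forall>\<gamma>\<in>A. \<mu> \<noteq> \<gamma> \<longrightarrow> \<not> root_le S \<mu> \<gamma> \<and> \<not> root_le S \<gamma> \<mu>)}"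

definition short_antichains :: "'a::euclidean_space set \<Rightarrow> 'a set \<Rightarrow> 'a set set" where
  "short_antichains \<Delta> P = {A \<in> antichains (simple_roots P) P. A \<subseteq> short_roots \<Delta>}"

definition int_span :: "'a::euclidean_space set \<Rightarrow> 'a set" where
  "int_span S = {x. \<exists>c :: 'a \<Rightarrow> int. x = (\<Sum>\<alpha>\<in>S. real_of_int (c \<alpha>) *\<^sub>R \<alpha>)}"

definition subsystem :: "'a::euclidean_space set \<Rightarrow> 'a set \<Rightarrow> 'a set" where
  "subsystem \<Delta> S = \<Delta> \<inter> int_span S"

text \<open>The positive roots of the subsystem are those that are positive in the ambient system;
  for a set \<open>S\<close> of simple roots these are the roots that are nonnegative integer
  combinations of \<open>S\<close>.\<close>

definition subsystem_pos :: "'a::euclidean_space set \<Rightarrow> 'a set \<Rightarrow> 'a set \<Rightarrow> 'a set" where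
  "subsystem_pos \<Delta> P S = subsystem \<Delta> S \<inter> P"

end

theory Submission
  imports Defs
begin

text \<open>Let \<open>c\<close> be the squared length of the short roots; the long ones have squared length \<open>2c\<close> or \<open>3c\<close>.
  Ratio 3 forces \<open>G\<^sub>2\<close>. For ratio 2, call short roots \<open>e, f\<close> linked if \<open>e + f\<close> is a long root. Every long
  root is such a sum, and linked short roots form orthogonal frames. If all frames have two elements,
  the long roots are pairwise orthogonal up to sign and the system is \<open>C\<^sub>n\<close>. Otherwise take a frame with at
  least three elements: either every other short root is orthogonal to it (type \<open>B\<^sub>n\<close>), or some short root
  has inner product \<open>c/2\<close> or \<open>-c/2\<close> with all its elements, Bessel's inequality bounds the size of the frame
  by four, and the system is \<open>F\<^sub>4\<close>.

  The root posets of \<open>B\<^sub>n\<close> and \<open>C\<^sub>n\<close> are both the poset of intervals \<open>[i, j]\<close> with \<open>i + j \<le> 2n - 2\<close>, whose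
  antichains in a quadrant obey Pascal's rule, so that they are counted by ballot paths. This gives
  \<open>binom(2n, n) = (n + 1) Cat\<^sub>n\<close> for \<open>B\<^sub>n\<close>, where the short roots are a chain and the long simple roots span \<open>A\<^sub>n\<^sub>-\<^sub>1\<close>.
  In type \<open>C\<^sub>n\<close> deleting the long roots, that is the intervals with \<open>i + j = 2n - 2\<close>, halves the count.
  For \<open>G\<^sub>2\<close> and \<open>F\<^sub>4\<close> the antichains are enumerated.\<close>

section \<open>Counting antichains\<close>

text \<open>The positive system comes from an arbitrary regular vector \<open>v\<close>, while the
  antichains are counted for positive systems in standard position. No element of the Weyl group is
  used to bridge the two: orthogonal vectors are chosen and numbered according to the values of
  \<open>v\<close>. In types B and C they are taken positive and their differences are roots, so
  numbering them by decreasing value of \<open>v\<close> already produces the standard positive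
  system. In type F4 there are three candidate frames, and only the one through the short root with
  the largest value of \<open>v\<close> has the standard shape; passing from one frame to another
  serves to show that this particular frame has four elements. In type G2 the simple roots are
  recovered from the highest root and the highest short root, again found by maximality. The halving
  in type C is visible at the boundary: both triangles obey the same recursion, and on the last
  antidiagonal the values are 2 and 1.\<close>

definition antichains_of :: "('a \<Rightarrow> 'a \<Rightarrow> bool) \<Rightarrow> 'a set \<Rightarrow> 'a set set" where
  "antichains_of le X = {A. A \<subseteq> X \<and> (\<forall>x\<in>A. \<forall>y\<in>A. x \<noteq> y \<longrightarrow> \<not> le x y \<and> \<not> le y x)}"

lemma finite_antichains_of: "finite X \<Longrightarrow> finite (antichains_of le X)"
  by (rule finite_subset[of _ "Pow X"]) (auto simp: antichains_of_def)

lemma antichains_of_empty [simp]: "antichains_of le {} = {{}}"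
  by (auto simp: antichains_of_def)

lemma card_antichains_of_bij:
  assumes "bij_betw f X Y"
    and "\<And>x y. x \<in> X \<Longrightarrow> y \<in> X \<Longrightarrow> le' (f x) (f y) \<longleftrightarrow> le x y"
  shows "card (antichains_of le' Y) = card (antichains_of le X)"
proof -
  have inj: "inj_on f X" and im: "f ` X = Y"
    using assms(1) by (auto simp: bij_betw_def)
  have "antichains_of le' Y = (`) f ` antichains_of le X"
  proof (intro equalityI subsetI)
    fix B assume B: "B \<in> antichains_of le' Y"
    then obtain A where A: "A \<subseteq> X" "B = f ` A"
      using im by (metis (no_types, lifting) antichains_of_def mem_Collect_eq subset_imageE)
    have "\<not> le x y \<and> \<not> le y x" if "x \<in> A" "y \<in> A" "x \<noteq> y" for x y
    proof -
      have "f x \<noteq> f y" using that A inj by (meson inj_onD subsetD)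
      then have "\<not> le' (f x) (f y) \<and> \<not> le' (f y) (f x)"
        using that A B unfolding antichains_of_def by blast
      then show ?thesis using that A assms(2) by blast
    qed
    with A have "A \<in> antichains_of le X" by (auto simp: antichains_of_def)
    with A show "B \<in> (`) f ` antichains_of le X" by auto
  next
    fix B assume "B \<in> (`) f ` antichains_of le X"
    then obtain A where A: "A \<in> antichains_of le X" "B = f ` A" by blast
    have "\<not> le' (f x) (f y) \<and> \<not> le' (f y) (f x)" if "x \<in> A" "y \<in> A" "f x \<noteq> f y" for x y
    proof -
      have "x \<in> X" "y \<in> X" "x \<noteq> y" using that A(1) by (auto simp: antichains_of_def)
      then show ?thesis using that A(1) assms(2) by (simp add: antichains_of_def)
    qed
    then show "B \<in> antichains_of le' Y"
      using A im by (auto simp: antichains_of_def)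
  qed
  moreover have "inj_on ((`) f) (antichains_of le X)"
    by (rule inj_on_subset[OF inj_on_image_Pow[OF inj]]) (auto simp: antichains_of_def)
  ultimately show ?thesis by (simp add: card_image)
qed

lemma card_antichains_of_insert:
  assumes "finite X" "x \<notin> X"
  shows "card (antichains_of le (insert x X)) =
    card (antichains_of le X) + card (antichains_of le {y \<in> X. \<not> le x y \<and> \<not> le y x})"
proof -
  let ?U = "antichains_of le X" and ?V = "antichains_of le {y \<in> X. \<not> le x y \<and> \<not> le y x}"
  have "antichains_of le (insert x X) = ?U \<union> insert x ` ?V"
  proof (intro equalityI subsetI)
    fix A assume A: "A \<in> antichains_of le (insert x X)"
    show "A \<in> ?U \<union> insert x ` ?V"
    proof (cases "x \<in> A")
      case True
      have "A - {x} \<in> ?V" using A True unfolding antichains_of_def by auto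
      moreover have "A = insert x (A - {x})" using True by auto
      ultimately show ?thesis by blast
    next
      case False
      then show ?thesis using A unfolding antichains_of_def by auto
    qed
  next
    fix A assume "A \<in> ?U \<union> insert x ` ?V"
    then show "A \<in> antichains_of le (insert x X)"
      unfolding antichains_of_def using assms(2) by auto
  qed
  moreover have "?U \<inter> insert x ` ?V = {}"
    using assms(2) by (auto simp: antichains_of_def)
  moreover have "inj_on (insert x) ?V"
    by (rule inj_onI) (use assms(2) in \<open>auto simp: antichains_of_def insert_ident subset_iff\<close>)
  ultimately show ?thesis
    using assms(1) by (simp add: card_Un_disjoint card_image finite_antichains_of)
qed

text \<open>Executable branching on whether \<open>x\<close> belongs to the antichain; if it does,
  everything comparable with \<open>x\<close> is discarded. In this form the exceptional types can
  be settled by evaluation.\<close>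

fun count_antichains :: "('a \<Rightarrow> 'a \<Rightarrow> bool) \<Rightarrow> 'a list \<Rightarrow> nat" where
  "count_antichains le [] = 1"
| "count_antichains le (x # xs) =
     count_antichains le xs + count_antichains le (filter (\<lambda>y. \<not> le x y \<and> \<not> le y x) xs)"

lemma card_antichains_of_set:
  "distinct xs \<Longrightarrow> card (antichains_of le (set xs)) = count_antichains le xs"
  by (induction le xs rule: count_antichains.induct) (simp_all add: card_antichains_of_insert)

section \<open>Intervals ordered by inclusion, and Pascal's rule\<close>

definition interval_le :: "nat \<times> nat \<Rightarrow> nat \<times> nat \<Rightarrow> bool" where
  "interval_le x y \<longleftrightarrow> fst y \<le> fst x \<and> snd x \<le> snd y"

definition quadrant :: "(nat \<times> nat) set \<Rightarrow> nat \<Rightarrow> nat \<Rightarrow> (nat \<times> nat) set" where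
  "quadrant X i l = {x \<in> X. i \<le> fst x \<and> l \<le> snd x}"

definition corner_count :: "(nat \<times> nat) set \<Rightarrow> nat \<Rightarrow> nat \<Rightarrow> nat" where
  "corner_count X i l = card (antichains_of interval_le (quadrant X i l))"

text \<open>An antichain using both column \<open>i\<close> and row \<open>l\<close> of the quadrant must contain the corner
  \<open>(i, l)\<close>, and the rest of it lies in the quadrant at \<open>(i + 1, l + 1)\<close>.\<close>

lemma corner_count_pascal:
  assumes fin: "finite X" and mem: "(i, l) \<in> X"
  shows "corner_count X i l = corner_count X (Suc i) l + corner_count X i (Suc l)"
proof -
  let ?Q = "quadrant X" and ?ac = "antichains_of interval_le"
  have finQ: "finite (?Q a b)" for a b using fin by (simp add: quadrant_def)
  have both: "?ac (?Q (Suc i) l) \<inter> ?ac (?Q i (Suc l)) = ?ac (?Q (Suc i) (Suc l))"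
    unfolding antichains_of_def quadrant_def by auto
  let ?C = "insert (i, l) ` ?ac (?Q (Suc i) (Suc l))"
  have "?ac (?Q i l) = (?ac (?Q (Suc i) l) \<union> ?ac (?Q i (Suc l))) \<union> ?C"
  proof (intro equalityI subsetI)
    fix A assume A: "A \<in> ?ac (?Q i l)"
    show "A \<in> (?ac (?Q (Suc i) l) \<union> ?ac (?Q i (Suc l))) \<union> ?C"
    proof (cases "(i, l) \<in> A")
      case True
      have "Suc i \<le> fst x \<and> Suc l \<le> snd x \<and> x \<in> X" if "x \<in> A" "x \<noteq> (i, l)" for x
      proof -
        have "\<not> interval_le x (i, l) \<and> \<not> interval_le (i, l) x"
          using A True that unfolding antichains_of_def by blast
        moreover have "x \<in> X" "i \<le> fst x" "l \<le> snd x"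
          using A that by (auto simp: antichains_of_def quadrant_def)
        ultimately show ?thesis by (auto simp: interval_le_def)
      qed
      then have "A - {(i, l)} \<subseteq> ?Q (Suc i) (Suc l)"
        unfolding quadrant_def by blast
      then have "A - {(i, l)} \<in> ?ac (?Q (Suc i) (Suc l))"
        using A unfolding antichains_of_def by blast
      moreover have "A = insert (i, l) (A - {(i, l)})" using True by auto
      ultimately show ?thesis by blast
    next
      case False
      have AQ: "x \<in> X \<and> i \<le> fst x \<and> l \<le> snd x" if "x \<in> A" for x
        using A that by (auto simp: antichains_of_def quadrant_def)
      have "\<not> (fst x = i \<and> snd y = l)" if "x \<in> A" "y \<in> A" for x y
      proof
        assume xy: "fst x = i \<and> snd y = l"
        then have "interval_le y x" using AQ that by (auto simp: interval_le_def)
        then have "x = y" using A that unfolding antichains_of_def by blast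
        then show False using xy False that by (metis prod.collapse)
      qed
      then have "(\<forall>x\<in>A. Suc i \<le> fst x) \<or> (\<forall>x\<in>A. Suc l \<le> snd x)"
        using AQ by (metis not_less_eq_eq le_antisym)
      then have "A \<subseteq> ?Q (Suc i) l \<or> A \<subseteq> ?Q i (Suc l)"
        using AQ unfolding quadrant_def by blast
      then show ?thesis using A unfolding antichains_of_def by auto
    qed
  next
    fix A assume "A \<in> (?ac (?Q (Suc i) l) \<union> ?ac (?Q i (Suc l))) \<union> ?C"
    then show "A \<in> ?ac (?Q i l)"
    proof (elim UnE imageE)
      fix B assume B: "B \<in> ?ac (?Q (Suc i) (Suc l))" and A: "A = insert (i, l) B"
      have "\<not> interval_le x (i, l) \<and> \<not> interval_le (i, l) x" if "x \<in> B" for x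
        using B that by (auto simp: antichains_of_def quadrant_def interval_le_def)
      with A B mem show ?thesis
        by (auto simp: antichains_of_def quadrant_def)
    qed (auto simp: antichains_of_def quadrant_def)
  qed
  moreover have "(?ac (?Q (Suc i) l) \<union> ?ac (?Q i (Suc l))) \<inter> ?C = {}"
    by (auto simp: antichains_of_def quadrant_def)
  \<comment> \<open>The antichains through the corner are exactly as many as those counted twice in
    the union of the other two families, so the inclusion-exclusion correction cancels.\<close>
  moreover have "card ?C = card (?ac (?Q (Suc i) (Suc l)))"
  proof (rule card_image, rule inj_onI)
    fix A B assume "A \<in> ?ac (?Q (Suc i) (Suc l))" "B \<in> ?ac (?Q (Suc i) (Suc l))"
      and eq: "insert (i, l) A = insert (i, l) B"
    then have "(i, l) \<notin> A" "(i, l) \<notin> B" by (auto simp: antichains_of_def quadrant_def)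
    with eq show "A = B" by (simp add: insert_ident)
  qed
  moreover have "card (?ac (?Q (Suc i) l) \<union> ?ac (?Q i (Suc l))) + card (?ac (?Q (Suc i) (Suc l)))
      = card (?ac (?Q (Suc i) l)) + card (?ac (?Q i (Suc l)))"
    using card_Un_Int[of "?ac (?Q (Suc i) l)" "?ac (?Q i (Suc l))"] finQ both
    by (simp add: finite_antichains_of)
  ultimately show ?thesis
    unfolding corner_count_def using finQ by (simp add: card_Un_disjoint finite_antichains_of)
qed

section \<open>Boundary values and ballot counts\<close>

lemma corner_count_empty: "quadrant X i l = {} \<Longrightarrow> corner_count X i l = 1"
  by (simp add: corner_count_def)

lemma corner_count_0: "corner_count X 0 0 = card (antichains_of interval_le X)"
  by (simp add: corner_count_def quadrant_def)

text \<open>Nothing lies below the diagonal, so a first coordinate of at least \<open>l + 1\<close>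
  forces the second to be at least \<open>l + 1\<close> too. For the lattice paths behind Pascal's
  rule this is a wall: from \<open>(l + 1, l)\<close> only the step to \<open>(l + 1, l + 1)\<close>
  remains.\<close>

lemma corner_count_below_diagonal:
  assumes "\<And>x. x \<in> X \<Longrightarrow> fst x \<le> snd x"
  shows "corner_count X (Suc l) l = corner_count X (Suc l) (Suc l)"
proof -
  have "quadrant X (Suc l) l = quadrant X (Suc l) (Suc l)"
    unfolding quadrant_def using assms by fastforce
  then show ?thesis by (simp add: corner_count_def)
qed

text \<open>The bound is strict: \<open>s = 2 * m + 1\<close> gives the root poset of B and C in
  rank \<open>m + 1\<close>, and \<open>s = 2 * m\<close> removes the antidiagonal
  \<open>i + j = 2 * m\<close>, which carries the long roots of type C.\<close>

definition triangle :: "nat \<Rightarrow> (nat \<times> nat) set" where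
  "triangle s = {(i, j). i \<le> j \<and> i + j < s}"

text \<open>The root poset of type A in rank \<open>m\<close>: the interval \<open>[i, j]\<close>
  stands for the sum of the consecutive simple roots with indices from \<open>i\<close> to
  \<open>j\<close>.\<close>

definition segments :: "nat \<Rightarrow> (nat \<times> nat) set" where
  "segments m = {(i, j). i \<le> j \<and> j < m}"

lemma finite_triangle: "finite (triangle s)"
  by (rule finite_subset[of _ "{..s} \<times> {..s}"]) (auto simp: triangle_def)

lemma finite_segments: "finite (segments s)"
  by (rule finite_subset[of _ "{..s} \<times> {..s}"]) (auto simp: segments_def)

lemma triangle_pascal:
  "i \<le> l \<Longrightarrow> i + l < s \<Longrightarrow> corner_count (triangle s) i l =
     corner_count (triangle s) (Suc i) l + corner_count (triangle s) i (Suc l)"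
  by (rule corner_count_pascal[OF finite_triangle]) (simp add: triangle_def)

lemma triangle_below_diagonal:
  "corner_count (triangle s) (Suc l) l = corner_count (triangle s) (Suc l) (Suc l)"
  by (rule corner_count_below_diagonal) (auto simp: triangle_def)

lemma triangle_boundary: "s \<le> i + l \<Longrightarrow> corner_count (triangle s) i l = 1"
  by (rule corner_count_empty) (auto simp: triangle_def quadrant_def)

text \<open>Both counts satisfy the same recursion inside the triangle and the same rule at the
  diagonal, so the factor 2 propagates from the antidiagonal \<open>i + l = 2 * m\<close>. Here
  \<open>k\<close> is the distance to it. The range includes \<open>i = l + 1\<close> because the
  Pascal step from the diagonal leads there.\<close>

lemma triangle_double_aux:
  "i \<le> Suc l \<Longrightarrow> i + l + k = 2 * m \<Longrightarrow>
    corner_count (triangle (Suc (2 * m))) i l = 2 * corner_count (triangle (2 * m)) i l"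
proof (induction k arbitrary: i l)
  case 0
  \<comment> \<open>Parity: \<open>i + l = 2 * m\<close> is incompatible with
    \<open>i = l + 1\<close>.\<close>
  then have "i \<le> l" by presburger
  then show ?case using 0 by (simp add: triangle_pascal[of i l] triangle_boundary)
next
  case (Suc k)
  show ?case
  proof (cases "i = Suc l")
    case True
    then show ?thesis using Suc.IH[of i "Suc l"] Suc.prems by (simp add: triangle_below_diagonal)
  next
    case False
    then show ?thesis
      using Suc.IH[of i "Suc l"] Suc.IH[of "Suc i" l] Suc.prems by (simp add: triangle_pascal[of i l])
  qed
qed

lemma card_antichains_triangle_double:
  "card (antichains_of interval_le (triangle (Suc (2 * m)))) =
   2 * card (antichains_of interval_le (triangle (2 * m)))"
  using triangle_double_aux[of 0 0 "2 * m" m] by (simp add: corner_count_0)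

lemma sum_choose_Suc:
  "(\<Sum>d<Suc m. Suc k choose d) = (\<Sum>d<Suc m. k choose d) + (\<Sum>d<m. k choose d)"
  by (induction m) auto

text \<open>The reflection principle. The count is the number of paths of \<open>k\<close> unit
  steps from \<open>(i, l)\<close> that keep \<open>i \<le> l + 1\<close>. If \<open>d\<close> steps
  raise the first coordinate, the end point is admissible for \<open>d \<le> m + 1 - i\<close>; the
  sum on the left counts the paths from the start reflected in the line \<open>i = l + 2\<close>. It
  is added on the left to avoid subtraction of natural numbers.\<close>

lemma triangle_ballot:
  "i \<le> Suc l \<Longrightarrow> i + l + k = Suc (2 * m) \<Longrightarrow>
    corner_count (triangle (Suc (2 * m))) i l + (\<Sum>d<m - l. k choose d) =
    (\<Sum>d<Suc (Suc m - i). k choose d)"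
proof (induction k arbitrary: i l)
  case 0
  then have "m - l = 0" by presburger
  moreover have "(\<Sum>d<Suc n. 0 choose d) = (1::nat)" for n by (induction n) auto
  ultimately show ?case using 0 by (simp only: triangle_boundary) simp
next
  case (Suc k)
  show ?case
  proof (cases "i = Suc l")
    case True
    have il: "i \<le> m" using Suc.prems True by presburger
    define r where "r = m - i"
    have r: "Suc m - i = Suc r" "m - l = Suc r" using il True
      by (auto simp: r_def)
    have IH: "corner_count (triangle (Suc (2 * m))) i i + (\<Sum>d<r. k choose d) =
        (\<Sum>d<Suc (Suc r). k choose d)"
      using Suc.IH[of i "Suc l"] Suc.prems True r by (simp add: r_def)
    have "(\<Sum>d<Suc (Suc r). Suc k choose d) =
       (\<Sum>d<Suc (Suc r). k choose d) + (\<Sum>d<Suc r. k choose d)"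
      by (rule sum_choose_Suc)
    moreover have "(\<Sum>d<Suc r. Suc k choose d) = (\<Sum>d<Suc r. k choose d) + (\<Sum>d<r. k choose d)"
      by (rule sum_choose_Suc)
    ultimately show ?thesis using IH True r by (simp add: triangle_below_diagonal)
  next
    case False
    have il: "i \<le> m" using Suc.prems False by presburger
    then obtain r where r: "m = i + r" using le_Suc_ex by blast
    have up: "(\<Sum>d<Suc (Suc r). Suc k choose d) =
       (\<Sum>d<Suc (Suc r). k choose d) + (\<Sum>d<Suc r. k choose d)"
      by (rule sum_choose_Suc)
    have low: "(\<Sum>d<m - l. Suc k choose d) = (\<Sum>d<m - l. k choose d) + (\<Sum>d<m - Suc l. k choose d)"
    proof (cases "l < m")
      case True
      then show ?thesis using sum_choose_Suc[of k "m - Suc l"] by (simp add: Suc_diff_Suc)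
    qed simp
    have IH1: "corner_count (triangle (Suc (2 * m))) i (Suc l) + (\<Sum>d<m - Suc l. k choose d) =
        (\<Sum>d<Suc (Suc r). k choose d)"
      using Suc.IH[of i "Suc l"] Suc.prems r by (simp add: Suc_diff_le)
    have IH2: "corner_count (triangle (Suc (2 * m))) (Suc i) l + (\<Sum>d<m - l. k choose d) =
        (\<Sum>d<Suc r. k choose d)"
      using Suc.IH[of "Suc i" l] Suc.prems False r by simp
    show ?thesis using IH1 IH2 up low r False Suc.prems
      by (simp add: triangle_pascal[of i l] Suc_diff_le del: sum.lessThan_Suc)
  qed
qed

text \<open>At the origin all terms of the two sums cancel except those with \<open>d = m\<close>
  and \<open>d = m + 1\<close>, and Pascal's rule joins these.\<close>

lemma card_antichains_triangle:
  "card (antichains_of interval_le (triangle (Suc (2 * m)))) = (2 * m + 2) choose (m + 1)"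
proof -
  have "corner_count (triangle (Suc (2 * m))) 0 0 + (\<Sum>d<m. Suc (2 * m) choose d) =
      (\<Sum>d<Suc (Suc m). Suc (2 * m) choose d)"
    using triangle_ballot[of 0 0 "Suc (2 * m)" m] by simp
  then show ?thesis by (simp add: corner_count_0)
qed

text \<open>Again the reflection principle, now with the fixed end point \<open>(m, m)\<close>:
  \<open>q\<close> and \<open>p\<close> are the numbers of steps still to be made in the first and
  in the second coordinate. Reflecting the start in \<open>i = l + 2\<close> replaces
  \<open>q\<close> by \<open>p - 2\<close> and \<open>p\<close> by \<open>q + 2\<close>.\<close>

lemma segments_ballot:
  "i \<le> Suc l \<Longrightarrow> l + p = m \<Longrightarrow> i + q = m \<Longrightarrow>
    corner_count (segments m) i l + ((p + q) choose (q + 2)) = (p + q) choose q"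
proof (induction "p + q" arbitrary: p q i l rule: less_induct)
  case less
  have bnd: "corner_count (segments m) i l = 1" if "p = 0"
    by (rule corner_count_empty) (use less.prems that in \<open>auto simp: segments_def quadrant_def\<close>)
  show ?case
  proof (cases p)
    case 0
    then show ?thesis using bnd by (simp add: binomial_eq_0)
  next
    case (Suc p')
    show ?thesis
    proof (cases "i = Suc l")
      case True
      then have q: "q = p'" using less.prems Suc by simp
      have "corner_count (segments m) i l = corner_count (segments m) i i"
        unfolding True by (rule corner_count_below_diagonal) (auto simp: segments_def)
      moreover have "corner_count (segments m) i i + ((p' + q) choose (q + 2)) = (p' + q) choose q"
        using less.hyps[of p' q i i] less.prems Suc True by simp
      \<comment> \<open>After Pascal's rule on both sides this is the symmetry of the binomials of
        \<open>2 * q\<close> at \<open>q - 1\<close> and \<open>q + 1\<close>.\<close>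
      moreover have "(Suc (2 * q) choose (q + 2)) + ((2 * q) choose q) =
          (Suc (2 * q) choose q) + ((2 * q) choose (q + 2))"
      proof (cases q)
        case (Suc r)
        then show ?thesis using binomial_symmetric[of "Suc q" "2 * q"] by simp
      qed simp
      ultimately show ?thesis using q Suc by (simp add: mult_2)
    next
      case False
      then obtain q' where q': "q = Suc q'" using less.prems Suc by (cases q) auto
      have "corner_count (segments m) i l =
          corner_count (segments m) (Suc i) l + corner_count (segments m) i (Suc l)"
        by (rule corner_count_pascal[OF finite_segments])
          (use less.prems Suc False in \<open>auto simp: segments_def\<close>)
      moreover have "corner_count (segments m) (Suc i) l + ((p + q') choose (q' + 2)) = (p + q') choose q'"
        using less.hyps[of p q' "Suc i" l] less.prems q' False by simp
      moreover have "corner_count (segments m) i (Suc l) + ((p' + q) choose (q + 2)) = (p' + q) choose q"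
        using less.hyps[of p' q i "Suc l"] less.prems Suc False by simp
      ultimately show ?thesis using Suc q' by simp
    qed
  qed
qed

text \<open>The count is the Catalan number with index \<open>m + 1\<close>. It is stated as a
  product because \<open>m + 2\<close> will be the number of short antichains in type B, so that
  this equation is the product formula there.\<close>

lemma card_antichains_segments:
  "card (antichains_of interval_le (segments m)) * (m + 2) = (2 * m + 2) choose (m + 1)"
proof -
  let ?N = "card (antichains_of interval_le (segments m))"
  have N: "?N + ((2 * m) choose (m + 2)) = (2 * m) choose m"
    using segments_ballot[of 0 0 m m m] by (simp add: corner_count_0 mult_2)
  \<comment> \<open>Absorption, written without subtraction. Its instances at \<open>m\<close> and
    \<open>m + 1\<close> relate the binomials of \<open>2 * m\<close> at \<open>m\<close>,
    \<open>m + 1\<close> and \<open>m + 2\<close>, and the claim becomes linear in these.\<close>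
  have step: "((2 * m) choose Suc k) * Suc k + ((2 * m) choose k) * k = ((2 * m) choose k) * (2 * m)" for k
    using Suc_times_binomial_eq[of "2 * m" k] by (simp add: algebra_simps)
  have a: "((2 * m) choose (m + 1)) * (m + 1) = ((2 * m) choose m) * m"
    using step[of m] by (simp add: algebra_simps)
  have b: "((2 * m) choose (m + 2)) * (m + 2) + ((2 * m) choose (m + 1)) = ((2 * m) choose (m + 1)) * m"
    using step[of "m + 1"] by (simp add: algebra_simps)
  have "(Suc (2 * m) choose m) = (Suc (2 * m) choose Suc m)"
    using binomial_symmetric[of m "Suc (2 * m)"] by (simp add: mult_2 Suc_diff_le)
  then have c: "(2 * m + 2) choose (m + 1) = 2 * ((2 * m) choose m) + 2 * ((2 * m) choose (m + 1))"
    by simp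
  have "?N * (m + 2) + ((2 * m) choose (m + 2)) * (m + 2) = ((2 * m) choose m) * (m + 2)"
    using N by (metis add_mult_distrib)
  then show ?thesis using a b c by (simp add: algebra_simps)
qed

section \<open>Systems of simple roots\<close>

text \<open>A certificate that the \<open>\<alpha> i\<close> are the simple roots of
  \<open>P\<close>. The dual vectors \<open>w i\<close> read off coefficients, so the root order
  becomes a comparison of finitely many inner products.\<close>

locale simple_system =
  fixes P :: "'a::euclidean_space set" and \<alpha> w :: "nat \<Rightarrow> 'a" and n :: nat
  assumes dual: "\<And>i j. i < n \<Longrightarrow> j < n \<Longrightarrow> w i \<bullet> \<alpha> j = (if i = j then 1 else 0)"
    and simple_mem: "\<And>i. i < n \<Longrightarrow> \<alpha> i \<in> P"
    and zero_notin: "0 \<notin> P"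
    and in_span: "\<And>\<beta>. \<beta> \<in> P \<Longrightarrow> \<beta> \<in> span (\<alpha> ` {..<n})"
    and coeff_Nats: "\<And>\<beta> i. \<beta> \<in> P \<Longrightarrow> i < n \<Longrightarrow> w i \<bullet> \<beta> \<in> \<nat>"
    and decomp: "\<And>\<beta>. \<beta> \<in> P \<Longrightarrow> \<beta> \<notin> \<alpha> ` {..<n} \<Longrightarrow> \<exists>x\<in>P. \<exists>y\<in>P. \<beta> = x + y"
begin

lemma inj_simple: "inj_on \<alpha> {..<n}"
proof (rule inj_onI)
  fix i j assume "i \<in> {..<n}" "j \<in> {..<n}" "\<alpha> i = \<alpha> j"
  then show "i = j" using dual[of i i] dual[of i j] by (auto split: if_splits)
qed

lemma coeff_sum:
  assumes "J \<subseteq> {..<n}" "i < n"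
  shows "w i \<bullet> (\<Sum>\<beta>\<in>\<alpha> ` J. c \<beta> *\<^sub>R \<beta>) = (if i \<in> J then c (\<alpha> i) else 0)"
proof -
  have fin: "finite J" using assms(1) finite_subset by blast
  have inj: "inj_on \<alpha> J" using inj_simple assms(1) by (rule inj_on_subset)
  have "w i \<bullet> (\<Sum>\<beta>\<in>\<alpha> ` J. c \<beta> *\<^sub>R \<beta>) = (\<Sum>j\<in>J. c (\<alpha> j) * (w i \<bullet> \<alpha> j))"
    by (simp add: sum.reindex[OF inj] inner_sum_right)
  also have "\<dots> = (\<Sum>j\<in>J. if j = i then c (\<alpha> j) else 0)"
    by (rule sum.cong) (use dual assms in auto)
  also have "\<dots> = (if i \<in> J then c (\<alpha> i) else 0)"
    using fin by (simp add: sum.delta)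
  finally show ?thesis .
qed

lemma expansion:
  assumes "\<beta> \<in> span (\<alpha> ` {..<n})"
  shows "\<beta> = (\<Sum>i<n. (w i \<bullet> \<beta>) *\<^sub>R \<alpha> i)"
  using assms
proof (induction rule: span_induct_alt)
  case base
  then show ?case by simp
next
  case (step c x y)
  then obtain j where j: "j < n" "x = \<alpha> j" by blast
  have "(\<Sum>i<n. (w i \<bullet> (c *\<^sub>R x + y)) *\<^sub>R \<alpha> i) =
      (\<Sum>i<n. (c * (w i \<bullet> \<alpha> j)) *\<^sub>R \<alpha> i) + (\<Sum>i<n. (w i \<bullet> y) *\<^sub>R \<alpha> i)"
    by (simp add: j inner_add_right scaleR_add_left sum.distrib)
  also have "(\<Sum>i<n. (c * (w i \<bullet> \<alpha> j)) *\<^sub>R \<alpha> i) = (\<Sum>i<n. if i = j then c *\<^sub>R \<alpha> i else 0)"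
    by (rule sum.cong) (use dual j in auto)
  also have "\<dots> = c *\<^sub>R x"
    using j by (simp add: sum.delta)
  finally show ?case using step by simp
qed

lemma height_ge_1:
  assumes "\<beta> \<in> P"
  shows "(\<Sum>i<n. w i \<bullet> \<beta>) \<ge> 1"
proof -
  have nat: "w i \<bullet> \<beta> \<in> \<nat>" if "i < n" for i using coeff_Nats assms that by blast
  have "\<exists>i<n. w i \<bullet> \<beta> \<noteq> 0"
  proof (rule ccontr)
    assume "\<not> (\<exists>i<n. w i \<bullet> \<beta> \<noteq> 0)"
    then have "\<beta> = 0" using expansion[OF in_span[OF assms]] by simp
    then show False using assms zero_notin by simp
  qed
  then obtain i where i: "i < n" "w i \<bullet> \<beta> \<noteq> 0" by blast
  then have "1 \<le> w i \<bullet> \<beta>" using nat[of i] by (auto elim!: Nats_cases)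
  also have "\<dots> \<le> (\<Sum>i<n. w i \<bullet> \<beta>)"
    using i nat by (intro member_le_sum) (auto simp: Nats_altdef2)
  finally show ?thesis .
qed

text \<open>The height, that is the sum of the coefficients, is 1 on each \<open>\<alpha> j\<close>
  and at least 2 on a sum of two elements of \<open>P\<close>. All other elements of
  \<open>P\<close> are sums by \<open>decomp\<close>.\<close>

lemma simple_roots_eq: "simple_roots P = \<alpha> ` {..<n}"
proof (intro equalityI subsetI)
  fix \<beta> assume "\<beta> \<in> simple_roots P"
  then show "\<beta> \<in> \<alpha> ` {..<n}" using decomp by (auto simp: simple_roots_def)
next
  fix \<beta> assume "\<beta> \<in> \<alpha> ` {..<n}"
  then obtain j where j: "j < n" "\<beta> = \<alpha> j" by blast
  have "(\<Sum>i<n. w i \<bullet> \<beta>) = (\<Sum>i<n. if i = j then 1 else 0)"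
    by (rule sum.cong) (use dual j in auto)
  then have h: "(\<Sum>i<n. w i \<bullet> \<beta>) = 1" using j by simp
  have "\<beta> \<noteq> x + y" if "x \<in> P" "y \<in> P" for x y
    using height_ge_1[OF that(1)] height_ge_1[OF that(2)] h
    by (auto simp: inner_add_right sum.distrib)
  then show "\<beta> \<in> simple_roots P"
    using j simple_mem by (auto simp: simple_roots_def)
qed

text \<open>The index set \<open>J\<close> is kept general so that the order on \<open>P\<close> and
  the order on the subsystem of the long simple roots are covered at once: if the coefficients
  outside \<open>J\<close> vanish, both are the coefficientwise order.\<close>

lemma root_le_iff:
  assumes J: "J \<subseteq> {..<n}" and "\<mu> \<in> P" "\<gamma> \<in> P"
    and zero: "\<And>i. i < n \<Longrightarrow> i \<notin> J \<Longrightarrow> w i \<bullet> \<mu> = 0 \<and> w i \<bullet> \<gamma> = 0"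
  shows "root_le (\<alpha> ` J) \<mu> \<gamma> \<longleftrightarrow> (\<forall>i<n. w i \<bullet> \<mu> \<le> w i \<bullet> \<gamma>)"
proof
  assume "root_le (\<alpha> ` J) \<mu> \<gamma>"
  then obtain c :: "'a \<Rightarrow> nat" where c: "\<gamma> - \<mu> = (\<Sum>\<beta>\<in>\<alpha> ` J. real (c \<beta>) *\<^sub>R \<beta>)"
    by (auto simp: root_le_def)
  show "\<forall>i<n. w i \<bullet> \<mu> \<le> w i \<bullet> \<gamma>"
  proof (intro allI impI)
    fix i assume "i < n"
    then have "w i \<bullet> (\<gamma> - \<mu>) \<ge> 0" using coeff_sum[OF J, of i "\<lambda>\<beta>. real (c \<beta>)"] c by auto
    then show "w i \<bullet> \<mu> \<le> w i \<bullet> \<gamma>" by (simp add: inner_diff_right)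
  qed
next
  assume le: "\<forall>i<n. w i \<bullet> \<mu> \<le> w i \<bullet> \<gamma>"
  have "\<exists>k. w i \<bullet> (\<gamma> - \<mu>) = real k" if i: "i < n" for i
  proof -
    obtain a b where "w i \<bullet> \<gamma> = real a" "w i \<bullet> \<mu> = real b"
      using coeff_Nats[OF assms(2) i] coeff_Nats[OF assms(3) i] by (auto elim!: Nats_cases)
    then have "w i \<bullet> (\<gamma> - \<mu>) = real (a - b)"
      using le i by (auto simp: inner_diff_right of_nat_diff)
    then show ?thesis ..
  qed
  then obtain k where k: "\<And>i. i < n \<Longrightarrow> w i \<bullet> (\<gamma> - \<mu>) = real (k i)" by metis
  define c where "c \<beta> = k (the_inv_into {..<n} \<alpha> \<beta>)" for \<beta>
  have c: "c (\<alpha> i) = k i" if "i < n" for i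
    using that inj_simple by (simp add: c_def the_inv_into_f_f)
  have "\<gamma> - \<mu> \<in> span (\<alpha> ` {..<n})" using in_span assms(2,3) by (blast intro: span_diff)
  then have "\<gamma> - \<mu> = (\<Sum>i<n. (w i \<bullet> (\<gamma> - \<mu>)) *\<^sub>R \<alpha> i)" by (rule expansion)
  also have "\<dots> = (\<Sum>i\<in>J. (w i \<bullet> (\<gamma> - \<mu>)) *\<^sub>R \<alpha> i)"
    by (rule sum.mono_neutral_right) (use J zero in \<open>auto simp: inner_diff_right\<close>)
  also have "\<dots> = (\<Sum>i\<in>J. real (c (\<alpha> i)) *\<^sub>R \<alpha> i)"
    by (rule sum.cong) (use J k c in auto)
  also have "\<dots> = (\<Sum>\<beta>\<in>\<alpha> ` J. real (c \<beta>) *\<^sub>R \<beta>)"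
    by (simp add: sum.reindex[OF inj_on_subset[OF inj_simple J]])
  finally show "root_le (\<alpha> ` J) \<mu> \<gamma>" unfolding root_le_def by blast
qed

lemma subsystem_pos_eq:
  assumes J: "J \<subseteq> {..<n}" and "P \<subseteq> \<Delta>"
  shows "subsystem_pos \<Delta> P (\<alpha> ` J) = {\<beta> \<in> P. \<forall>i<n. i \<notin> J \<longrightarrow> w i \<bullet> \<beta> = 0}"
proof (intro equalityI subsetI)
  fix \<beta> assume "\<beta> \<in> subsystem_pos \<Delta> P (\<alpha> ` J)"
  then obtain c :: "'a \<Rightarrow> int" where "\<beta> \<in> P" "\<beta> = (\<Sum>\<beta>\<in>\<alpha> ` J. real_of_int (c \<beta>) *\<^sub>R \<beta>)"
    by (auto simp: subsystem_pos_def subsystem_def int_span_def)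
  then show "\<beta> \<in> {\<beta> \<in> P. \<forall>i<n. i \<notin> J \<longrightarrow> w i \<bullet> \<beta> = 0}"
    using coeff_sum[OF J, of _ "\<lambda>\<beta>. real_of_int (c \<beta>)"] by auto
next
  fix \<beta> assume \<beta>: "\<beta> \<in> {\<beta> \<in> P. \<forall>i<n. i \<notin> J \<longrightarrow> w i \<bullet> \<beta> = 0}"
  have "\<exists>k::nat. w i \<bullet> \<beta> = real k" if "i < n" for i
    using coeff_Nats[of \<beta> i] \<beta> that by (auto elim: Nats_cases)
  then obtain k :: "nat \<Rightarrow> nat" where k: "\<And>i. i < n \<Longrightarrow> w i \<bullet> \<beta> = real (k i)" by metis
  define c where "c x = int (k (the_inv_into {..<n} \<alpha> x))" for x
  have c: "c (\<alpha> i) = int (k i)" if "i < n" for i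
    using that inj_simple by (simp add: c_def the_inv_into_f_f)
  have "\<beta> = (\<Sum>i<n. (w i \<bullet> \<beta>) *\<^sub>R \<alpha> i)" using expansion in_span \<beta> by blast
  also have "\<dots> = (\<Sum>i\<in>J. (w i \<bullet> \<beta>) *\<^sub>R \<alpha> i)"
    by (rule sum.mono_neutral_right) (use J \<beta> in auto)
  also have "\<dots> = (\<Sum>i\<in>J. real_of_int (c (\<alpha> i)) *\<^sub>R \<alpha> i)"
    by (rule sum.cong) (use J k c in auto)
  also have "\<dots> = (\<Sum>x\<in>\<alpha> ` J. real_of_int (c x) *\<^sub>R x)"
    by (simp add: sum.reindex[OF inj_on_subset[OF inj_simple J]])
  finally show "\<beta> \<in> subsystem_pos \<Delta> P (\<alpha> ` J)"
    unfolding subsystem_pos_def subsystem_def int_span_def using \<beta> assms(2) by blast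
qed

text \<open>The passage from roots to a combinatorial model \<open>K\<close>. It is applied to all
  positive roots, to the short ones and to the subsystem of the long simple roots.\<close>

lemma card_antichains_eq:
  assumes "J \<subseteq> {..<n}" and "Q \<subseteq> P"
    and "\<And>\<beta> i. \<beta> \<in> Q \<Longrightarrow> i < n \<Longrightarrow> i \<notin> J \<Longrightarrow> w i \<bullet> \<beta> = 0"
    and "bij_betw f K Q"
    and "\<And>x y. x \<in> K \<Longrightarrow> y \<in> K \<Longrightarrow> (\<forall>i<n. w i \<bullet> f x \<le> w i \<bullet> f y) \<longleftrightarrow> le x y"
  shows "card (antichains (\<alpha> ` J) Q) = card (antichains_of le K)"
proof -
  have "antichains (\<alpha> ` J) Q = antichains_of (root_le (\<alpha> ` J)) Q"
    by (auto simp: antichains_def antichains_of_def)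
  moreover have "card (antichains_of (root_le (\<alpha> ` J)) Q) = card (antichains_of le K)"
  proof (rule card_antichains_of_bij[OF assms(4)])
    fix x y assume "x \<in> K" "y \<in> K"
    then have "f x \<in> Q" "f y \<in> Q" using assms(4) by (auto simp: bij_betw_def)
    then have "root_le (\<alpha> ` J) (f x) (f y) \<longleftrightarrow> (\<forall>i<n. w i \<bullet> f x \<le> w i \<bullet> f y)"
      using assms(1-3) by (intro root_le_iff) auto
    then show "root_le (\<alpha> ` J) (f x) (f y) \<longleftrightarrow> le x y"
      using assms(5) \<open>x \<in> K\<close> \<open>y \<in> K\<close> by simp
  qed
  ultimately show ?thesis by simp
qed

end

lemma short_antichains_eq:
  "short_antichains \<Delta> P = antichains (simple_roots P) (P \<inter> short_roots \<Delta>)"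
  by (auto simp: short_antichains_def antichains_def)

section \<open>Types B and C\<close>

lemma long_roots_eq:
  assumes "\<And>\<beta>. \<beta> \<in> \<Delta> \<Longrightarrow> \<beta> \<bullet> \<beta> = a \<or> \<beta> \<bullet> \<beta> = b" "a < b" "\<gamma> \<in> \<Delta>" "\<gamma> \<bullet> \<gamma> = b"
  shows "long_roots \<Delta> = {\<beta> \<in> \<Delta>. \<beta> \<bullet> \<beta> = b}"
proof -
  have "(\<forall>\<delta>\<in>\<Delta>. norm \<delta> \<le> norm \<beta>) \<longleftrightarrow> \<beta> \<bullet> \<beta> = b" if "\<beta> \<in> \<Delta>" for \<beta>
    using assms(1)[OF that] assms by (fastforce simp: norm_le)
  then show ?thesis by (auto simp: long_roots_def)
qed

lemma short_roots_eq:
  assumes "\<And>\<beta>. \<beta> \<in> \<Delta> \<Longrightarrow> \<beta> \<bullet> \<beta> = a \<or> \<beta> \<bullet> \<beta> = b" "a < b" "\<gamma> \<in> \<Delta>" "\<gamma> \<bullet> \<gamma> = a"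
  shows "short_roots \<Delta> = {\<beta> \<in> \<Delta>. \<beta> \<bullet> \<beta> = a}"
proof -
  have "(\<forall>\<delta>\<in>\<Delta>. norm \<beta> \<le> norm \<delta>) \<longleftrightarrow> \<beta> \<bullet> \<beta> = a" if "\<beta> \<in> \<Delta>" for \<beta>
    using assms(1)[OF that] assms by (fastforce simp: norm_le)
  then show ?thesis by (auto simp: short_roots_def)
qed

lemma card_antichains_chain:
  assumes "finite X" "\<And>x y. x \<in> X \<Longrightarrow> y \<in> X \<Longrightarrow> le x y \<or> le y x"
  shows "card (antichains_of le X) = Suc (card X)"
proof -
  have "A = {} \<or> (\<exists>x\<in>X. A = {x})" if "A \<in> antichains_of le X" for A
  proof (rule disjCI)
    assume nx: "\<not> (\<exists>x\<in>X. A = {x})"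
    show "A = {}"
    proof (rule ccontr)
      assume "A \<noteq> {}"
      then obtain x where x: "x \<in> A" by blast
      then have "x \<in> X" using that by (auto simp: antichains_of_def)
      with nx x obtain y where y: "y \<in> A" "y \<noteq> x" by blast
      with x that have "\<not> le x y \<and> \<not> le y x" "y \<in> X" by (auto simp: antichains_of_def)
      with assms(2) \<open>x \<in> X\<close> show False by blast
    qed
  qed
  then have "antichains_of le X = insert {} ((\<lambda>x. {x}) ` X)"
    by (auto simp: antichains_of_def)
  then show ?thesis using assms(1) by (simp add: card_image image_iff)
qed

lemma interval_le_antisym: "interval_le x y \<Longrightarrow> interval_le y x \<Longrightarrow> x = y"
  by (simp add: interval_le_def prod_eq_iff)

text \<open>Injectivity comes for free: equal images are comparable in both directions, and
  inclusion of intervals is antisymmetric.\<close>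

lemma bij_betw_of_order:
  assumes "f ` K = Q"
    and "\<And>x y. x \<in> K \<Longrightarrow> y \<in> K \<Longrightarrow> (\<forall>i<n. w i \<bullet> f x \<le> w i \<bullet> f y) \<longleftrightarrow> interval_le x y"
  shows "bij_betw f K Q"
  unfolding bij_betw_def
proof
  show "inj_on f K"
  proof (rule inj_onI)
    fix x y assume "x \<in> K" "y \<in> K" "f x = f y"
    then have "interval_le x y" "interval_le y x" using assms(2)[of x y] assms(2)[of y x] by auto
    then show "x = y" by (rule interval_le_antisym)
  qed
qed (rule assms(1))

text \<open>There are \<open>m + 1\<close> vectors, so \<open>m\<close> is the rank minus one. In
  type B the \<open>e i\<close> are the short roots; in type C they are half the long roots, so the
  short roots there have squared length \<open>2 * c\<close> and the long ones
  \<open>4 * c\<close>.\<close>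

locale orthogonal_family =
  fixes e :: "nat \<Rightarrow> 'a::euclidean_space" and m :: nat and c :: real
  assumes c_pos: "c > 0"
    and ortho: "\<And>i j. i \<le> m \<Longrightarrow> j \<le> m \<Longrightarrow> e i \<bullet> e j = (if i = j then c else 0)"
begin

text \<open>The value \<open>d = 1\<close> gives type B and \<open>d = 2\<close> type C; only the
  last simple root differs.\<close>

definition simp_root :: "real \<Rightarrow> nat \<Rightarrow> 'a" where
  "simp_root d i = (if i < m then e i - e (Suc i) else d *\<^sub>R e i)"

text \<open>The basis dual to \<open>simp_root d\<close>. Partial sums of the \<open>e r\<close> are
  orthogonal to all differences of neighbours but one; the last of them is also divided by
  \<open>d\<close>.\<close>

definition coweight :: "real \<Rightarrow> nat \<Rightarrow> 'a" where
  "coweight d s = (1 / (if s < m then c else d * c)) *\<^sub>R (\<Sum>r\<le>s. e r)"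

lemma coweight_e:
  assumes "s \<le> m" "t \<le> m"
  shows "coweight d s \<bullet> e t = (if t \<le> s then if s < m then 1 else 1 / d else 0)"
proof -
  have "(\<Sum>r\<le>s. e r) \<bullet> e t = (\<Sum>r\<le>s. if r = t then c else 0)"
    unfolding inner_sum_left by (rule sum.cong) (use ortho assms in auto)
  also have "\<dots> = (if t \<le> s then c else 0)" by (simp add: sum.delta)
  finally show ?thesis using c_pos by (simp add: coweight_def)
qed

lemma coweight_simp_root:
  assumes "d \<noteq> 0" "i < Suc m" "j < Suc m"
  shows "coweight d i \<bullet> simp_root d j = (if i = j then 1 else 0)"
  using assms coweight_e[of i j d] coweight_e[of i "Suc j" d]
  by (auto simp: simp_root_def inner_diff_right)

lemma e_in_span:
  assumes "d \<noteq> 0" "t \<le> m"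
  shows "e t \<in> span (simp_root d ` {..<Suc m})"
  using assms(2)
proof (induction t rule: inc_induct)
  case base
  have "(1 / d) *\<^sub>R simp_root d m \<in> span (simp_root d ` {..<Suc m})"
    by (intro span_scale span_base) auto
  then show ?case using assms(1) by (simp add: simp_root_def)
next
  case (step t)
  have "simp_root d t + e (Suc t) \<in> span (simp_root d ` {..<Suc m})"
    by (intro span_add step.IH span_base) (use step in auto)
  then show ?case using step by (simp add: simp_root_def)
qed

lemma norms:
  assumes "i \<le> m" "j \<le> m" "i \<noteq> j"
  shows "(e i - e j) \<bullet> (e i - e j) = 2 * c" "(e i + e j) \<bullet> (e i + e j) = 2 * c"
    "(2 *\<^sub>R e i) \<bullet> (2 *\<^sub>R e i) = 4 * c" "e i \<bullet> e i = c"
  using assms ortho by (auto simp: inner_diff_left inner_diff_right inner_add_left inner_add_right)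

definition pos_B :: "'a set" where
  "pos_B = {e i |i. i \<le> m} \<union> {e i - e j |i j. i < j \<and> j \<le> m} \<union> {e i + e j |i j. i < j \<and> j \<le> m}"

definition pos_C :: "'a set" where
  "pos_C = {2 *\<^sub>R e i |i. i \<le> m} \<union> {e i - e j |i j. i < j \<and> j \<le> m} \<union> {e i + e j |i j. i < j \<and> j \<le> m}"

lemma pos_B_I:
  "i \<le> m \<Longrightarrow> e i \<in> pos_B"
  "i < j \<Longrightarrow> j \<le> m \<Longrightarrow> e i - e j \<in> pos_B"
  "i < j \<Longrightarrow> j \<le> m \<Longrightarrow> e i + e j \<in> pos_B"
  by (auto simp: pos_B_def)

lemma pos_C_I:
  "i \<le> m \<Longrightarrow> 2 *\<^sub>R e i \<in> pos_C"
  "i < j \<Longrightarrow> j \<le> m \<Longrightarrow> e i - e j \<in> pos_C"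
  "i < j \<Longrightarrow> j \<le> m \<Longrightarrow> e i + e j \<in> pos_C"
  by (auto simp: pos_C_def)

lemma simple_system_B: "simple_system pos_B (simp_root 1) (coweight 1) (Suc m)"
proof
  fix i j assume "i < Suc m" "j < Suc m"
  then show "coweight 1 i \<bullet> simp_root 1 j = (if i = j then 1 else 0)"
    by (simp add: coweight_simp_root)
next
  fix i assume "i < Suc m"
  then show "simp_root 1 i \<in> pos_B" by (auto simp: simp_root_def intro!: pos_B_I)
next
  show "0 \<notin> pos_B"
  proof
    assume "0 \<in> pos_B"
    then show False using norms c_pos unfolding pos_B_def
      by (auto; metis inner_zero_left mult_eq_0_iff less_irrefl zero_neq_numeral ortho order.strict_trans1 order.strict_iff_order)
  qed
next
  fix \<beta> assume "\<beta> \<in> pos_B"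
  then show "\<beta> \<in> span (simp_root 1 ` {..<Suc m})"
    unfolding pos_B_def by (auto intro!: span_add span_diff e_in_span)
next
  fix \<beta> i assume "\<beta> \<in> pos_B" "i < Suc m"
  then show "coweight 1 i \<bullet> \<beta> \<in> \<nat>"
    unfolding pos_B_def by (auto simp: coweight_e inner_diff_right inner_add_right)
next
  fix \<beta> assume \<beta>: "\<beta> \<in> pos_B" and ns: "\<beta> \<notin> simp_root 1 ` {..<Suc m}"
  have s: "e i - e (Suc i) \<in> pos_B" if "i < m" for i using that by (intro pos_B_I(2)) auto
  have t: "e i \<in> pos_B" if "i \<le> m" for i using that by (rule pos_B_I(1))
  from \<beta> consider i where "i \<le> m" "\<beta> = e i" | i j where "i < j" "j \<le> m" "\<beta> = e i - e j"
    | i j where "i < j" "j \<le> m" "\<beta> = e i + e j"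
    by (auto simp: pos_B_def)
  then show "\<exists>x\<in>pos_B. \<exists>y\<in>pos_B. \<beta> = x + y"
  proof cases
    case 1
    then have "i < m" using ns by (cases "i = m") (auto simp: simp_root_def)
    then show ?thesis using 1 s[of i] t[of "Suc i"] by (intro bexI[of _ "e i - e (Suc i)"] bexI[of _ "e (Suc i)"]) auto
  next
    case 2
    have "j \<noteq> Suc i"
    proof
      assume "j = Suc i"
      then have "\<beta> = simp_root 1 i" using 2 by (simp add: simp_root_def)
      then show False using ns 2 by auto
    qed
    then have "e (Suc i) - e j \<in> pos_B" using 2 by (intro pos_B_I(2)) auto
    then show ?thesis using 2 s[of i] by (intro bexI[of _ "e i - e (Suc i)"] bexI[of _ "e (Suc i) - e j"]) auto
  next
    case 3
    then show ?thesis using t[of i] t[of j] by (intro bexI[of _ "e i"] bexI[of _ "e j"]) auto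
  qed
qed

lemma simple_system_C: "simple_system pos_C (simp_root 2) (coweight 2) (Suc m)"
proof
  fix i j assume "i < Suc m" "j < Suc m"
  then show "coweight 2 i \<bullet> simp_root 2 j = (if i = j then 1 else 0)"
    by (simp add: coweight_simp_root)
next
  fix i assume "i < Suc m"
  then show "simp_root 2 i \<in> pos_C" by (auto simp: simp_root_def intro!: pos_C_I)
next
  show "0 \<notin> pos_C"
  proof
    assume "0 \<in> pos_C"
    then show False using norms c_pos unfolding pos_C_def
      by (auto; metis inner_zero_left mult_eq_0_iff less_irrefl zero_neq_numeral ortho order.strict_trans1 order.strict_iff_order)
  qed
next
  fix \<beta> assume "\<beta> \<in> pos_C"
  then show "\<beta> \<in> span (simp_root 2 ` {..<Suc m})"
    unfolding pos_C_def by (auto intro!: span_add span_diff span_scale e_in_span)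
next
  fix \<beta> i assume "\<beta> \<in> pos_C" "i < Suc m"
  then show "coweight 2 i \<bullet> \<beta> \<in> \<nat>"
    unfolding pos_C_def by (auto simp: coweight_e inner_diff_right inner_add_right)
next
  fix \<beta> assume \<beta>: "\<beta> \<in> pos_C" and ns: "\<beta> \<notin> simp_root 2 ` {..<Suc m}"
  have s: "e i - e (Suc i) \<in> pos_C" if "i < m" for i using that by (intro pos_C_I(2)) auto
  have t: "2 *\<^sub>R e i \<in> pos_C" if "i \<le> m" for i using that by (rule pos_C_I(1))
  from \<beta> consider i where "i \<le> m" "\<beta> = 2 *\<^sub>R e i" | i j where "i < j" "j \<le> m" "\<beta> = e i - e j"
    | i j where "i < j" "j \<le> m" "\<beta> = e i + e j"
    by (auto simp: pos_C_def)
  then show "\<exists>x\<in>pos_C. \<exists>y\<in>pos_C. \<beta> = x + y"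
  proof cases
    case 1
    then have im: "i < m" using ns by (cases "i = m") (auto simp: simp_root_def)
    then have "e i + e (Suc i) \<in> pos_C" by (intro pos_C_I(3)) auto
    then show ?thesis using 1 s[OF im]
      by (intro bexI[of _ "e i - e (Suc i)"] bexI[of _ "e i + e (Suc i)"]) (auto simp: scaleR_2)
  next
    case 2
    have "j \<noteq> Suc i"
    proof
      assume "j = Suc i"
      then have "\<beta> = simp_root 2 i" using 2 by (simp add: simp_root_def)
      then show False using ns 2 by auto
    qed
    then have "e (Suc i) - e j \<in> pos_C" using 2 by (intro pos_C_I(2)) auto
    then show ?thesis using 2 s[of i] by (intro bexI[of _ "e i - e (Suc i)"] bexI[of _ "e (Suc i) - e j"]) auto
  next
    case 3
    then have "e i - e j \<in> pos_C" by (intro pos_C_I(2))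
    then show ?thesis using 3 t[of j]
      by (intro bexI[of _ "e i - e j"] bexI[of _ "2 *\<^sub>R e j"]) (auto simp: scaleR_2)
  qed
qed

text \<open>The interval \<open>[i, j]\<close> stands for a sum of simple roots along the sequence that runs from \<open>0\<close> up to
  \<open>m\<close> and back down, where \<open>m\<close> is repeated in type B but not in type C.\<close>

definition root_B :: "nat \<times> nat \<Rightarrow> 'a" where
  "root_B = (\<lambda>(i, j). if j < m then e i - e (Suc j) else if j = m then e i else e i + e (2 * m + 1 - j))"

definition root_C :: "nat \<times> nat \<Rightarrow> 'a" where
  "root_C = (\<lambda>(i, j). if j < m then e i - e (Suc j) else e i + e (2 * m - j))"

lemma coweight_root_B:
  assumes "(i, j) \<in> triangle (Suc (2 * m))" "s < Suc m"
  shows "coweight 1 s \<bullet> root_B (i, j) =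
    (if i \<le> s \<and> s \<le> j then 1 else 0) + (if 2 * m + 1 - s \<le> j then 1 else 0)"
proof -
  have "i \<le> j" "i + j \<le> 2 * m" "i \<le> m" using assms(1) by (auto simp: triangle_def)
  then show ?thesis using assms(2)
    by (auto simp: root_B_def coweight_e inner_diff_right inner_add_right)
qed

text \<open>In the sequence \<open>0, ..., m, ..., 0\<close> the second occurrence of
  \<open>s\<close> is at position \<open>2 * m - s\<close>. The index \<open>m\<close> occurs only
  once, whence the condition \<open>s < m\<close>.\<close>

lemma coweight_root_C:
  assumes "(i, j) \<in> triangle (Suc (2 * m))" "s < Suc m"
  shows "coweight 2 s \<bullet> root_C (i, j) =
    (if i \<le> s \<and> s \<le> j then 1 else 0) + (if s < m \<and> 2 * m - s \<le> j then 1 else 0)"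
proof -
  have "i \<le> j" "i + j \<le> 2 * m" "i \<le> m" using assms(1) by (auto simp: triangle_def)
  then show ?thesis using assms(2)
    by (auto simp: root_C_def coweight_e inner_diff_right inner_add_right)
qed

lemma root_B_le_iff:
  assumes "x \<in> triangle (Suc (2 * m))" "y \<in> triangle (Suc (2 * m))"
  shows "(\<forall>s<Suc m. coweight 1 s \<bullet> root_B x \<le> coweight 1 s \<bullet> root_B y) \<longleftrightarrow> interval_le x y"
proof -
  obtain i j i' j' where xy: "x = (i, j)" "y = (i', j')" by fastforce
  have b: "i \<le> j" "i + j \<le> 2 * m" "i \<le> m" "i' \<le> j'" "i' + j' \<le> 2 * m" "i' \<le> m"
    using assms xy by (auto simp: triangle_def)
  note cw = coweight_root_B[OF assms(1)[unfolded xy]] coweight_root_B[OF assms(2)[unfolded xy]]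
  show ?thesis unfolding xy
  proof
    assume le: "\<forall>s<Suc m. coweight 1 s \<bullet> root_B (i, j) \<le> coweight 1 s \<bullet> root_B (i', j')"
    have "i' \<le> i"
      using le[rule_format, of i] b cw[of i] by (auto split: if_splits)
    moreover have "j \<le> j'"
    proof (cases "j \<le> m")
      case True
      then show ?thesis using le[rule_format, of j] b cw[of j] by (auto split: if_splits)
    next
      case False
      \<comment> \<open>The simple root at position \<open>j\<close> has index
        \<open>2 * m + 1 - j\<close>, and both of its occurrences lie in \<open>[i, j]\<close>. The
        coefficient 2 forces both into \<open>[i', j']\<close>, which gives
        \<open>j \<le> j'\<close>.\<close>
      then have d: "2 * m + 1 - j < Suc m" "i \<le> 2 * m + 1 - j" "2 * m + 1 - j \<le> j"
        "2 * m + 1 - (2 * m + 1 - j) = j" using b by auto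
      show ?thesis
        using le[rule_format, OF d(1)] unfolding cw[OF d(1)] d(4) using d(2,3) by (auto split: if_splits)
    qed
    ultimately show "interval_le (i, j) (i', j')" by (simp add: interval_le_def)
  next
    assume "interval_le (i, j) (i', j')"
    then show "\<forall>s<Suc m. coweight 1 s \<bullet> root_B (i, j) \<le> coweight 1 s \<bullet> root_B (i', j')"
      using cw b by (auto simp: interval_le_def)
  qed
qed

lemma root_C_le_iff:
  assumes "x \<in> triangle (Suc (2 * m))" "y \<in> triangle (Suc (2 * m))"
  shows "(\<forall>s<Suc m. coweight 2 s \<bullet> root_C x \<le> coweight 2 s \<bullet> root_C y) \<longleftrightarrow> interval_le x y"
proof -
  obtain i j i' j' where xy: "x = (i, j)" "y = (i', j')" by fastforce
  have b: "i \<le> j" "i + j \<le> 2 * m" "i \<le> m" "i' \<le> j'" "i' + j' \<le> 2 * m" "i' \<le> m"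
    using assms xy by (auto simp: triangle_def)
  note cw = coweight_root_C[OF assms(1)[unfolded xy]] coweight_root_C[OF assms(2)[unfolded xy]]
  show ?thesis unfolding xy
  proof
    assume le: "\<forall>s<Suc m. coweight 2 s \<bullet> root_C (i, j) \<le> coweight 2 s \<bullet> root_C (i', j')"
    have "i' \<le> i"
      using le[rule_format, of i] b cw[of i] by (auto split: if_splits)
    moreover have "j \<le> j'"
    proof (cases "j \<le> m")
      case True
      then show ?thesis using le[rule_format, of j] b cw[of j] by (auto split: if_splits)
    next
      case False
      then have d: "2 * m - j < Suc m" "i \<le> 2 * m - j" "2 * m - j \<le> j" "2 * m - j < m"
        "2 * m - (2 * m - j) = j" using b by auto
      show ?thesis
        using le[rule_format, OF d(1)] unfolding cw[OF d(1)] d(5) using d(2-4) by (auto split: if_splits)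
    qed
    ultimately show "interval_le (i, j) (i', j')" by (simp add: interval_le_def)
  next
    assume "interval_le (i, j) (i', j')"
    then show "\<forall>s<Suc m. coweight 2 s \<bullet> root_C (i, j) \<le> coweight 2 s \<bullet> root_C (i', j')"
      using cw b by (auto simp: interval_le_def)
  qed
qed

lemma root_B_long: "root_B ` segments m = {e i - e j |i j. i < j \<and> j \<le> m}"
proof (intro equalityI subsetI)
  fix \<beta> assume "\<beta> \<in> {e i - e j |i j. i < j \<and> j \<le> m}"
  then obtain i j where ij: "i < j" "j \<le> m" "\<beta> = e i - e j" by blast
  then have "(i, j - 1) \<in> segments m" "\<beta> = root_B (i, j - 1)"
    by (auto simp: segments_def root_B_def)
  then show "\<beta> \<in> root_B ` segments m" by blast
next
  fix \<beta> assume "\<beta> \<in> root_B ` segments m"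
  then obtain i j where "i \<le> j" "j < m" "\<beta> = root_B (i, j)" by (auto simp: segments_def)
  then show "\<beta> \<in> {e i - e j |i j. i < j \<and> j \<le> m}"
    by (intro CollectI exI[of _ i] exI[of _ "Suc j"]) (simp add: root_B_def)
qed

lemma root_B_image: "root_B ` triangle (Suc (2 * m)) = pos_B"
proof (intro equalityI subsetI)
  fix \<beta> assume "\<beta> \<in> pos_B"
  then consider i where "i \<le> m" "\<beta> = e i" | i j where "i < j" "j \<le> m" "\<beta> = e i - e j"
    | i j where "i < j" "j \<le> m" "\<beta> = e i + e j"
    by (auto simp: pos_B_def)
  then show "\<beta> \<in> root_B ` triangle (Suc (2 * m))"
  proof cases
    case 1
    then show ?thesis by (intro image_eqI[of _ _ "(i, m)"]) (auto simp: root_B_def triangle_def)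
  next
    case 2
    then show ?thesis by (intro image_eqI[of _ _ "(i, j - 1)"]) (auto simp: root_B_def triangle_def)
  next
    case 3
    then show ?thesis by (intro image_eqI[of _ _ "(i, 2 * m + 1 - j)"]) (auto simp: root_B_def triangle_def)
  qed
next
  fix \<beta> assume "\<beta> \<in> root_B ` triangle (Suc (2 * m))"
  then obtain i j where "(i, j) \<in> triangle (Suc (2 * m))" "\<beta> = root_B (i, j)" by auto
  then show "\<beta> \<in> pos_B"
    by (auto simp: root_B_def triangle_def intro!: pos_B_I)
qed

lemma root_C_short:
  "root_C ` triangle (2 * m) = {e i - e j |i j. i < j \<and> j \<le> m} \<union> {e i + e j |i j. i < j \<and> j \<le> m}"
proof (intro equalityI subsetI)
  fix \<beta> assume "\<beta> \<in> {e i - e j |i j. i < j \<and> j \<le> m} \<union> {e i + e j |i j. i < j \<and> j \<le> m}"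
  then consider i j where "i < j" "j \<le> m" "\<beta> = e i - e j" | i j where "i < j" "j \<le> m" "\<beta> = e i + e j"
    by auto
  then show "\<beta> \<in> root_C ` triangle (2 * m)"
  proof cases
    case 1
    then show ?thesis by (intro image_eqI[of _ _ "(i, j - 1)"]) (auto simp: root_C_def triangle_def)
  next
    case 2
    then show ?thesis by (intro image_eqI[of _ _ "(i, 2 * m - j)"]) (auto simp: root_C_def triangle_def)
  qed
next
  fix \<beta> assume "\<beta> \<in> root_C ` triangle (2 * m)"
  then obtain i j where "(i, j) \<in> triangle (2 * m)" "\<beta> = root_C (i, j)" by auto
  moreover have "\<exists>a b. e i - e (Suc j) = e a - e b \<and> a < b \<and> b \<le> m" if "i \<le> j" "j < m"
    using that by (intro exI[of _ i] exI[of _ "Suc j"]) auto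
  moreover have "\<exists>a b. e i + e (2 * m - j) = e a + e b \<and> a < b \<and> b \<le> m" if "\<not> j < m" "i + j < 2 * m"
    using that by (intro exI[of _ i] exI[of _ "2 * m - j"]) auto
  ultimately show "\<beta> \<in> {e i - e j |i j. i < j \<and> j \<le> m} \<union> {e i + e j |i j. i < j \<and> j \<le> m}"
    by (auto simp: root_C_def triangle_def split: if_splits)
qed

lemma root_C_image: "root_C ` triangle (Suc (2 * m)) = pos_C"
proof -
  have "triangle (Suc (2 * m)) = triangle (2 * m) \<union> (\<lambda>i. (i, 2 * m - i)) ` {..m}"
    by (auto simp: triangle_def image_iff)
  moreover have "root_C (i, 2 * m - i) = 2 *\<^sub>R e i" if "i \<le> m" for i
    using that by (auto simp: root_C_def scaleR_2)
  ultimately have "root_C ` triangle (Suc (2 * m)) =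
      root_C ` triangle (2 * m) \<union> (\<lambda>i. 2 *\<^sub>R e i) ` {..m}"
    by (auto simp: image_Un image_image)
  then show ?thesis unfolding root_C_short pos_C_def by auto
qed

section \<open>The product formula in types B and C\<close>

theorem antichain_product_B:
  assumes "pos_B \<subseteq> \<Delta>" "m \<ge> 1" and lengths: "\<And>\<beta>. \<beta> \<in> \<Delta> \<Longrightarrow> \<beta> \<bullet> \<beta> = c \<or> \<beta> \<bullet> \<beta> = 2 * c"
  shows "card (antichains (simple_roots pos_B) pos_B) =
         card (short_antichains \<Delta> pos_B) *
         card (antichains (long_simple_roots \<Delta> pos_B)
                 (subsystem_pos \<Delta> pos_B (long_simple_roots \<Delta> pos_B)))"
proof -
  interpret simple_system pos_B "simp_root 1" "coweight 1" "Suc m" by (rule simple_system_B)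
  have e0: "e 0 \<in> \<Delta>" "e 0 \<bullet> e 0 = c" and l0: "e 0 - e 1 \<in> \<Delta>" "(e 0 - e 1) \<bullet> (e 0 - e 1) = 2 * c"
    using assms(2) norms[of 0 1] subsetD[OF assms(1) pos_B_I(1)[of 0]] subsetD[OF assms(1) pos_B_I(2)[of 0 1]] by simp_all
  have long: "long_roots \<Delta> = {\<beta> \<in> \<Delta>. \<beta> \<bullet> \<beta> = 2 * c}"
    by (rule long_roots_eq[OF lengths _ l0]) (use c_pos in auto)
  have short: "short_roots \<Delta> = {\<beta> \<in> \<Delta>. \<beta> \<bullet> \<beta> = c}"
    by (rule short_roots_eq[OF lengths _ e0]) (use c_pos in auto)
  have bij: "bij_betw root_B (triangle (Suc (2 * m))) pos_B"
    by (rule bij_betw_of_order[OF root_B_image root_B_le_iff])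
  have full: "card (antichains (simple_roots pos_B) pos_B) = (2 * m + 2) choose (m + 1)"
    unfolding simple_roots_eq
    by (subst card_antichains_eq[OF _ _ _ bij root_B_le_iff])
      (simp_all only: card_antichains_triangle, auto)
  \<comment> \<open>The short root \<open>e i\<close> is the interval \<open>[i, m]\<close>, so the
    short roots are nested.\<close>
  define K where "K = (\<lambda>i. (i, m)) ` {..m}"
  have K: "K \<subseteq> triangle (Suc (2 * m))" by (auto simp: K_def triangle_def)
  have shortP: "pos_B \<inter> short_roots \<Delta> = e ` {..m}"
  proof (intro equalityI subsetI)
    fix \<beta> assume \<beta>: "\<beta> \<in> pos_B \<inter> short_roots \<Delta>"
    then consider i where "i \<le> m" "\<beta> = e i" | i j where "i < j" "j \<le> m" "\<beta> = e i - e j"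
      | i j where "i < j" "j \<le> m" "\<beta> = e i + e j"
      by (auto simp: pos_B_def)
    then show "\<beta> \<in> e ` {..m}"
    proof cases
      case 2
      then show ?thesis using \<beta> norms(1)[of i j] c_pos by (auto simp: short)
    next
      case 3
      then show ?thesis using \<beta> norms(2)[of i j] c_pos by (auto simp: short)
    qed auto
  next
    fix \<beta> assume "\<beta> \<in> e ` {..m}"
    then obtain i where "i \<le> m" "\<beta> = e i" by blast
    then show "\<beta> \<in> pos_B \<inter> short_roots \<Delta>"
      using pos_B_I(1)[of i] assms(1) ortho[of i i] by (auto simp: short)
  qed
  have bijs: "bij_betw root_B K (pos_B \<inter> short_roots \<Delta>)"
    using bij K unfolding shortP by (rule bij_betw_subset) (auto simp: K_def root_B_def image_image)
  have "card (short_antichains \<Delta> pos_B) = card (antichains_of interval_le K)"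
    unfolding short_antichains_eq simple_roots_eq
    by (rule card_antichains_eq[OF _ _ _ bijs root_B_le_iff]) (use K in auto)
  also have "\<dots> = Suc (card K)"
    by (rule card_antichains_chain) (auto simp: K_def interval_le_def)
  also have "card K = Suc m" by (simp add: K_def card_image inj_on_def)
  finally have shortc: "card (short_antichains \<Delta> pos_B) = m + 2" by simp
  have longS: "long_simple_roots \<Delta> pos_B = simp_root 1 ` {..<m}"
  proof -
    have "simp_root 1 i \<in> long_roots \<Delta> \<longleftrightarrow> i < m" if "i < Suc m" for i
    proof -
      have "simp_root 1 i \<in> \<Delta>" using simple_mem[OF that] assms(1) by blast
      then show ?thesis using that norms[of i "Suc i"] ortho[of i i] c_pos
        by (auto simp: long simp_root_def)
    qed
    then show ?thesis unfolding long_simple_roots_def simple_roots_eq by auto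
  qed
  have sub: "subsystem_pos \<Delta> pos_B (simp_root 1 ` {..<m}) = {e i - e j |i j. i < j \<and> j \<le> m}"
  proof -
    have "subsystem_pos \<Delta> pos_B (simp_root 1 ` {..<m}) = {\<beta> \<in> pos_B. coweight 1 m \<bullet> \<beta> = 0}"
      by (subst subsystem_pos_eq) (use assms(1) in \<open>auto simp: less_Suc_eq\<close>)
    also have "\<dots> = {e i - e j |i j. i < j \<and> j \<le> m}"
      unfolding pos_B_def by (auto simp: coweight_e inner_diff_right inner_add_right)
    finally show ?thesis .
  qed
  have seg: "segments m \<subseteq> triangle (Suc (2 * m))" by (auto simp: segments_def triangle_def)
  have bijl: "bij_betw root_B (segments m) {e i - e j |i j. i < j \<and> j \<le> m}"
    using bij seg root_B_long by (rule bij_betw_subset)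
  have "card (antichains (simp_root 1 ` {..<m}) {e i - e j |i j. i < j \<and> j \<le> m})
      = card (antichains_of interval_le (segments m))"
  proof (rule card_antichains_eq[OF _ _ _ bijl root_B_le_iff])
    show "coweight 1 i \<bullet> \<beta> = 0"
      if "\<beta> \<in> {e i - e j |i j. i < j \<and> j \<le> m}" "i < Suc m" "i \<notin> {..<m}" for \<beta> i
      using that by (auto simp: less_Suc_eq coweight_e inner_diff_right)
  qed (use seg in \<open>auto simp: pos_B_def\<close>)
  then show ?thesis
    using full shortc card_antichains_segments[of m] unfolding longS sub by (simp add: mult.commute)
qed

theorem antichain_product_C:
  assumes "pos_C \<subseteq> \<Delta>" "m \<ge> 1" and lengths: "\<And>\<beta>. \<beta> \<in> \<Delta> \<Longrightarrow> \<beta> \<bullet> \<beta> = 2 * c \<or> \<beta> \<bullet> \<beta> = 4 * c"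
  shows "card (antichains (simple_roots pos_C) pos_C) =
         card (short_antichains \<Delta> pos_C) *
         card (antichains (long_simple_roots \<Delta> pos_C)
                 (subsystem_pos \<Delta> pos_C (long_simple_roots \<Delta> pos_C)))"
proof -
  interpret simple_system pos_C "simp_root 2" "coweight 2" "Suc m" by (rule simple_system_C)
  have e0: "2 *\<^sub>R e 0 \<in> \<Delta>" "(2 *\<^sub>R e 0) \<bullet> (2 *\<^sub>R e 0) = 4 * c"
    and l0: "e 0 - e 1 \<in> \<Delta>" "(e 0 - e 1) \<bullet> (e 0 - e 1) = 2 * c"
    using assms(2) norms[of 0 1] subsetD[OF assms(1) pos_C_I(1)[of 0]] subsetD[OF assms(1) pos_C_I(2)[of 0 1]] by simp_all
  have long: "long_roots \<Delta> = {\<beta> \<in> \<Delta>. \<beta> \<bullet> \<beta> = 4 * c}"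
    by (rule long_roots_eq[OF lengths _ e0]) (use c_pos in auto)
  have short: "short_roots \<Delta> = {\<beta> \<in> \<Delta>. \<beta> \<bullet> \<beta> = 2 * c}"
    by (rule short_roots_eq[OF lengths _ l0]) (use c_pos in auto)
  have bij: "bij_betw root_C (triangle (Suc (2 * m))) pos_C"
    by (rule bij_betw_of_order[OF root_C_image root_C_le_iff])
  have full: "card (antichains (simple_roots pos_C) pos_C) =
      2 * card (antichains_of interval_le (triangle (2 * m)))"
    unfolding simple_roots_eq
    by (subst card_antichains_eq[OF _ _ _ bij root_C_le_iff])
      (simp_all only: card_antichains_triangle_double, auto)
  have tri: "triangle (2 * m) \<subseteq> triangle (Suc (2 * m))" by (auto simp: triangle_def)
  have shortP: "pos_C \<inter> short_roots \<Delta> = root_C ` triangle (2 * m)"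
  proof (intro equalityI subsetI)
    fix \<beta> assume \<beta>: "\<beta> \<in> pos_C \<inter> short_roots \<Delta>"
    then consider i where "i \<le> m" "\<beta> = 2 *\<^sub>R e i" | "\<beta> \<in> root_C ` triangle (2 * m)"
      unfolding root_C_short pos_C_def by blast
    then show "\<beta> \<in> root_C ` triangle (2 * m)"
    proof cases
      case 1
      then show ?thesis using \<beta> ortho[of i i] c_pos by (auto simp: short)
    qed
  next
    fix \<beta> assume "\<beta> \<in> root_C ` triangle (2 * m)"
    then consider i j where "i < j" "j \<le> m" "\<beta> = e i - e j" | i j where "i < j" "j \<le> m" "\<beta> = e i + e j"
      unfolding root_C_short by blast
    then show "\<beta> \<in> pos_C \<inter> short_roots \<Delta>"
    proof cases
      case 1
      then show ?thesis using pos_C_I(2)[of i j] assms(1) norms(1)[of i j] by (auto simp: short)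
    next
      case 2
      then show ?thesis using pos_C_I(3)[of i j] assms(1) norms(2)[of i j] by (auto simp: short)
    qed
  qed
  have bijs: "bij_betw root_C (triangle (2 * m)) (pos_C \<inter> short_roots \<Delta>)"
    using bij tri unfolding shortP by (rule bij_betw_subset) auto
  have shortc: "card (short_antichains \<Delta> pos_C) = card (antichains_of interval_le (triangle (2 * m)))"
    unfolding short_antichains_eq simple_roots_eq
    by (rule card_antichains_eq[OF _ _ _ bijs root_C_le_iff]) (use tri in auto)
  \<comment> \<open>Only the last simple root is long. Its subsystem has type A1 with two
    antichains, which is the factor 2 of \<open>full\<close>.\<close>
  have longS: "long_simple_roots \<Delta> pos_C = simp_root 2 ` {m}"
  proof -
    have "simp_root 2 i \<in> long_roots \<Delta> \<longleftrightarrow> i = m" if "i < Suc m" for i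
    proof -
      have "simp_root 2 i \<in> \<Delta>" using simple_mem[OF that] assms(1) by blast
      then show ?thesis using that norms[of i "Suc i"] ortho[of i i] c_pos
        by (auto simp: long simp_root_def)
    qed
    then show ?thesis unfolding long_simple_roots_def simple_roots_eq by auto
  qed
  have sub: "subsystem_pos \<Delta> pos_C (simp_root 2 ` {m}) = {2 *\<^sub>R e m}"
  proof -
    have "subsystem_pos \<Delta> pos_C (simp_root 2 ` {m}) = {\<beta> \<in> pos_C. \<forall>i<m. coweight 2 i \<bullet> \<beta> = 0}"
      by (subst subsystem_pos_eq) (use assms(1) in \<open>auto simp: less_Suc_eq\<close>)
    also have "\<dots> = {2 *\<^sub>R e m}"
    proof (intro equalityI subsetI)
      fix \<beta> assume "\<beta> \<in> {\<beta> \<in> pos_C. \<forall>i<m. coweight 2 i \<bullet> \<beta> = 0}"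
      then have \<beta>: "\<beta> \<in> pos_C" "\<And>i. i < m \<Longrightarrow> coweight 2 i \<bullet> \<beta> = 0" by auto
      from \<beta>(1) consider i where "i \<le> m" "\<beta> = 2 *\<^sub>R e i" | i j where "i < j" "j \<le> m" "\<beta> = e i - e j"
        | i j where "i < j" "j \<le> m" "\<beta> = e i + e j"
        by (auto simp: pos_C_def)
      then show "\<beta> \<in> {2 *\<^sub>R e m}"
      proof cases
        case 1
        then show ?thesis using \<beta>(2)[of i] by (cases "i = m") (auto simp: coweight_e)
      next
        case 2
        then show ?thesis using \<beta>(2)[of i] by (auto simp: coweight_e inner_diff_right)
      next
        case 3
        then show ?thesis using \<beta>(2)[of i] by (auto simp: coweight_e inner_add_right)
      qed
    next
      fix \<beta> assume "\<beta> \<in> {2 *\<^sub>R e m}"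
      then show "\<beta> \<in> {\<beta> \<in> pos_C. \<forall>i<m. coweight 2 i \<bullet> \<beta> = 0}"
        by (auto simp: pos_C_def coweight_e)
    qed
    finally show ?thesis .
  qed
  have "antichains S {x} = {{}, {x}}" for S and x :: 'a by (auto simp: antichains_def)
  then have "card (antichains (simp_root 2 ` {m}) {2 *\<^sub>R e m}) = 2" by simp
  then show ?thesis using full shortc unfolding longS sub by simp
qed

end

section \<open>Types G2 and F4\<close>

definition unit_list :: "nat \<Rightarrow> nat \<Rightarrow> nat list" where
  "unit_list n i = map (\<lambda>j. if j = i then 1 else 0) [0..<n]"

text \<open>The squared length of the root with coefficient list \<open>k\<close>, in units of half
  the short squared length. This keeps all entries integral and gives short roots the value
  2.\<close>

definition gram_form :: "nat \<Rightarrow> int list list \<Rightarrow> nat list \<Rightarrow> int" where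
  "gram_form n G k = (\<Sum>i\<leftarrow>[0..<n]. \<Sum>j\<leftarrow>[0..<n]. int (k ! i) * int (k ! j) * (G ! i ! j))"

text \<open>The assumptions of \<open>simple_system\<close> on coefficient lists, phrased with
  executable quantifiers: roots are nonzero, unit lists occur, and every other list is a sum of
  two.\<close>

definition valid_root_list :: "nat \<Rightarrow> nat list list \<Rightarrow> bool" where
  "valid_root_list n K \<longleftrightarrow> distinct K \<and>
     list_all (\<lambda>k. length k = n \<and> list_ex (\<lambda>x. x \<noteq> 0) k) K \<and>
     list_all (\<lambda>i. List.member K (unit_list n i)) [0..<n] \<and>
     list_all (\<lambda>k. list_ex (\<lambda>i. k = unit_list n i) [0..<n] \<or>
       list_ex (\<lambda>k1. list_ex (\<lambda>k2. k = map2 (+) k1 k2) K) K) K"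

text \<open>Vanishing at the short simple roots means lying in the span of the long simple
  roots.\<close>

definition supported_list :: "nat \<Rightarrow> int list list \<Rightarrow> nat list \<Rightarrow> bool" where
  "supported_list n G k \<longleftrightarrow> list_all (\<lambda>i. G ! i ! i = 2 \<longrightarrow> k ! i = 0) [0..<n]"

text \<open>Here \<open>c\<close> is the squared length of the short roots, so the short simple roots are those with a
  diagonal entry 2 in \<open>G\<close>. Roots are lists of coefficients with respect to the simple roots.\<close>

locale list_model =
  fixes \<alpha> w :: "nat \<Rightarrow> 'a::euclidean_space" and n :: nat and c :: real
    and G :: "int list list" and K :: "nat list list"
  assumes c_pos: "c > 0"
    and dual: "\<And>i j. i < n \<Longrightarrow> j < n \<Longrightarrow> w i \<bullet> \<alpha> j = (if i = j then 1 else 0)"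
    and gram: "\<And>i j. i < n \<Longrightarrow> j < n \<Longrightarrow> \<alpha> i \<bullet> \<alpha> j = c / 2 * of_int (G ! i ! j)"
    and valid: "valid_root_list n K"
begin

definition list_root :: "nat list \<Rightarrow> 'a" where
  "list_root k = (\<Sum>i<n. real (k ! i) *\<^sub>R \<alpha> i)"

lemma length_K: "k \<in> set K \<Longrightarrow> length k = n"
  using valid by (auto simp: valid_root_list_def list_all_iff)

lemma coeff_list_root: "i < n \<Longrightarrow> w i \<bullet> list_root k = real (k ! i)"
proof -
  assume i: "i < n"
  have "w i \<bullet> list_root k = (\<Sum>j<n. if j = i then real (k ! j) else 0)"
    unfolding list_root_def inner_sum_right by (rule sum.cong) (use dual i in auto)
  then show ?thesis using i by (simp add: sum.delta)
qed

lemma norm_list_root: "list_root k \<bullet> list_root k = c / 2 * of_int (gram_form n G k)"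
proof -
  have "list_root k \<bullet> list_root k = (\<Sum>i<n. \<Sum>j<n. real (k ! i) * real (k ! j) * (\<alpha> i \<bullet> \<alpha> j))"
    unfolding list_root_def inner_sum_left inner_sum_right
    by (simp add: mult_ac sum_distrib_left inner_commute)
  also have "\<dots> = (\<Sum>i<n. \<Sum>j<n. c / 2 * of_int (int (k ! i) * int (k ! j) * (G ! i ! j)))"
    by (intro sum.cong refl) (simp add: gram)
  also have "\<dots> = c / 2 * of_int (\<Sum>i<n. \<Sum>j<n. int (k ! i) * int (k ! j) * (G ! i ! j))"
    by (simp add: sum_distrib_left)
  also have "(\<Sum>i<n. \<Sum>j<n. int (k ! i) * int (k ! j) * (G ! i ! j)) = gram_form n G k"
    by (simp add: gram_form_def interv_sum_list_conv_sum_set_nat atLeast0LessThan)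
  finally show ?thesis .
qed

lemma list_root_unit: "i < n \<Longrightarrow> list_root (unit_list n i) = \<alpha> i"
proof -
  assume i: "i < n"
  have "list_root (unit_list n i) = (\<Sum>j<n. if j = i then \<alpha> j else 0)"
    unfolding list_root_def by (rule sum.cong) (auto simp: unit_list_def)
  then show ?thesis using i by (simp add: sum.delta)
qed

lemma nonzero_coeff:
  assumes "k \<in> set K"
  shows "\<exists>i<n. k ! i \<noteq> 0"
proof -
  have "\<exists>x\<in>set k. x \<noteq> 0"
    using valid assms unfolding valid_root_list_def list_all_iff list_ex_iff by blast
  then show ?thesis using length_K[OF assms] by (metis in_set_conv_nth)
qed

lemma unit_in_K: "i < n \<Longrightarrow> unit_list n i \<in> set K"
  using valid by (auto simp: valid_root_list_def list_all_iff)

lemma list_root_add: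
  assumes "length k1 = n" "length k2 = n"
  shows "list_root (map2 (+) k1 k2) = list_root k1 + list_root k2"
  unfolding list_root_def sum.distrib[symmetric]
  by (rule sum.cong) (use assms in \<open>auto simp: scaleR_add_left\<close>)

lemma simple_system_list: "simple_system (list_root ` set K) \<alpha> w n"
proof
  fix i j assume "i < n" "j < n"
  then show "w i \<bullet> \<alpha> j = (if i = j then 1 else 0)" by (rule dual)
next
  fix i assume "i < n"
  then show "\<alpha> i \<in> list_root ` set K" using unit_in_K list_root_unit by (metis imageI)
next
  show "0 \<notin> list_root ` set K"
  proof
    assume "0 \<in> list_root ` set K"
    then obtain k where k: "k \<in> set K" "list_root k = 0" by auto
    then obtain i where "i < n" "k ! i \<noteq> 0" using nonzero_coeff by blast
    then show False using coeff_list_root[of i k] k by simp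
  qed
next
  fix \<beta> assume "\<beta> \<in> list_root ` set K"
  then obtain k where k: "\<beta> = list_root k" by blast
  show "\<beta> \<in> span (\<alpha> ` {..<n})"
    unfolding k list_root_def by (intro span_sum span_scale span_base) auto
next
  fix \<beta> i assume "\<beta> \<in> list_root ` set K" "i < n"
  then show "w i \<bullet> \<beta> \<in> \<nat>" by (auto simp: coeff_list_root)
next
  fix \<beta> assume "\<beta> \<in> list_root ` set K" and ns: "\<beta> \<notin> \<alpha> ` {..<n}"
  then obtain k where k: "k \<in> set K" "\<beta> = list_root k" by auto
  then have "k \<noteq> unit_list n i" if "i < n" for i using ns list_root_unit that by auto
  moreover have "(\<exists>i\<in>{0..<n}. k = unit_list n i) \<or> (\<exists>k1\<in>set K. \<exists>k2\<in>set K. k = map2 (+) k1 k2)"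
    using valid k(1) unfolding valid_root_list_def list_all_iff list_ex_iff set_upt by blast
  ultimately obtain k1 k2 where "k1 \<in> set K" "k2 \<in> set K" "k = map2 (+) k1 k2"
    by (metis atLeastLessThan_iff)
  then show "\<exists>x\<in>list_root ` set K. \<exists>y\<in>list_root ` set K. \<beta> = x + y"
    using k(2) list_root_add length_K by blast
qed

lemma list_root_le_iff:
  assumes "k \<in> set K" "l \<in> set K"
  shows "(\<forall>i<n. w i \<bullet> list_root k \<le> w i \<bullet> list_root l) \<longleftrightarrow> list_all2 (\<le>) k l"
  using length_K assms by (auto simp: coeff_list_root list_all2_conv_all_nth)

lemma inj_list_root: "inj_on list_root (set K)"
proof (rule inj_onI)
  fix k l assume "k \<in> set K" "l \<in> set K" "list_root k = list_root l"
  then show "k = l" using length_K coeff_list_root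
    by (metis nth_equalityI of_nat_eq_iff)
qed

text \<open>The geometry is used up here: the three cardinalities become values of
  \<open>count_antichains\<close>, and for a concrete list \<open>count\<close> is decided by
  evaluation.\<close>

theorem antichain_product_list:
  assumes "list_root ` set K \<subseteq> \<Delta>" and c': "c < c'"
    and lengths: "\<And>\<beta>. \<beta> \<in> \<Delta> \<Longrightarrow> \<beta> \<bullet> \<beta> = c \<or> \<beta> \<bullet> \<beta> = c'"
    and diag: "list_ex (\<lambda>i. G ! i ! i = 2) [0..<n]" "list_ex (\<lambda>i. G ! i ! i \<noteq> 2) [0..<n]"
    and count: "count_antichains (list_all2 (\<le>)) K =
      count_antichains (list_all2 (\<le>)) (filter (\<lambda>k. gram_form n G k = 2) K) *
      count_antichains (list_all2 (\<le>)) (filter (supported_list n G) K)"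
  shows "card (antichains (simple_roots (list_root ` set K)) (list_root ` set K)) =
         card (short_antichains \<Delta> (list_root ` set K)) *
         card (antichains (long_simple_roots \<Delta> (list_root ` set K))
                 (subsystem_pos \<Delta> (list_root ` set K) (long_simple_roots \<Delta> (list_root ` set K))))"
proof -
  define P where "P = list_root ` set K"
  interpret simple_system P \<alpha> w n unfolding P_def by (rule simple_system_list)
  have P\<Delta>: "P \<subseteq> \<Delta>" using assms(1) by (simp add: P_def)
  have al: "\<alpha> i \<in> \<Delta>" if "i < n" for i using simple_mem[OF that] P\<Delta> by blast
  have nrm: "\<alpha> i \<bullet> \<alpha> i = c \<longleftrightarrow> G ! i ! i = 2" if "i < n" for i
    using gram[OF that that] c_pos by auto
  obtain i j where ij: "i < n" "G ! i ! i = 2" "j < n" "G ! j ! j \<noteq> 2"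
    using diag by (auto simp: list_ex_iff)
  have short: "short_roots \<Delta> = {\<beta> \<in> \<Delta>. \<beta> \<bullet> \<beta> = c}"
    by (rule short_roots_eq[OF lengths c' al[OF ij(1)]]) (use nrm ij in auto)
  have "\<alpha> j \<bullet> \<alpha> j = c'" using lengths[OF al[OF ij(3)]] nrm ij by auto
  from long_roots_eq[OF lengths c' al[OF ij(3)] this]
  have long: "long_roots \<Delta> = {\<beta> \<in> \<Delta>. \<beta> \<bullet> \<beta> = c'}" .
  have bij: "bij_betw list_root (set K) P"
    using inj_list_root by (simp add: bij_betw_def P_def)
  have dist: "distinct K" using valid by (simp add: valid_root_list_def)
  have full: "card (antichains (simple_roots P) P) = count_antichains (list_all2 (\<le>)) K"
    unfolding simple_roots_eq card_antichains_of_set[OF dist, symmetric]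
    by (rule card_antichains_eq[OF _ _ _ bij list_root_le_iff]) auto
  let ?Ks = "filter (\<lambda>k. gram_form n G k = 2) K"
  have ks: "list_root k \<bullet> list_root k = c \<longleftrightarrow> gram_form n G k = 2" for k
  proof -
    have "c / 2 * real_of_int g = c \<longleftrightarrow> g = 2" for g
      using c_pos by (simp add: field_simps of_int_eq_numeral_iff)
    then show ?thesis by (simp only: norm_list_root)
  qed
  have "P \<inter> short_roots \<Delta> = {\<beta> \<in> P. \<beta> \<bullet> \<beta> = c}"
    using P\<Delta> by (auto simp: short)
  also have "\<dots> = list_root ` set ?Ks"
    unfolding P_def using ks by auto
  finally have bijs: "bij_betw list_root (set ?Ks) (P \<inter> short_roots \<Delta>)"
    by (intro bij_betw_subset[OF bij]) auto
  have shortc: "card (short_antichains \<Delta> P) = count_antichains (list_all2 (\<le>)) ?Ks"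
    unfolding short_antichains_eq simple_roots_eq card_antichains_of_set[OF distinct_filter[OF dist], symmetric]
    by (rule card_antichains_eq[OF _ _ _ bijs list_root_le_iff]) auto
  define J where "J = {i. i < n \<and> G ! i ! i \<noteq> 2}"
  have J: "J \<subseteq> {..<n}" by (auto simp: J_def)
  have "\<alpha> i \<in> long_roots \<Delta> \<longleftrightarrow> i \<in> J" if "i < n" for i
    using lengths[OF al[OF that]] nrm[OF that] al[OF that] that c' by (auto simp: long J_def)
  then have longS: "long_simple_roots \<Delta> P = \<alpha> ` J"
    unfolding long_simple_roots_def simple_roots_eq using J by auto
  let ?Kl = "filter (supported_list n G) K"
  have sub: "subsystem_pos \<Delta> P (\<alpha> ` J) = list_root ` set ?Kl"
    unfolding subsystem_pos_eq[OF J P\<Delta>]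
    by (auto simp: P_def coeff_list_root J_def supported_list_def list_all_iff)
  have bijl: "bij_betw list_root (set ?Kl) (list_root ` set ?Kl)"
    by (rule bij_betw_subset[OF bij]) auto
  have longc: "card (antichains (\<alpha> ` J) (list_root ` set ?Kl)) = count_antichains (list_all2 (\<le>)) ?Kl"
    unfolding card_antichains_of_set[OF distinct_filter[OF dist], symmetric]
  proof (rule card_antichains_eq[OF J _ _ bijl list_root_le_iff])
    show "w i \<bullet> \<beta> = 0" if "\<beta> \<in> list_root ` set ?Kl" "i < n" "i \<notin> J" for \<beta> i
      using that by (auto simp: coeff_list_root J_def supported_list_def list_all_iff)
  qed (auto simp: P_def)
  show ?thesis
    unfolding P_def[symmetric] using full shortc longc count unfolding longS sub by simp
qed

end

section \<open>The data of the two exceptional systems\<close>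

definition "G2_gram = [[2, - 3], [- 3, 6 :: int]]"
definition "G2_list = [[1, 0], [0, 1], [1, 1], [2, 1], [3, 1], [3, 2 :: nat]]"

text \<open>The first two simple roots are long, the last two short.\<close>

definition "F4_gram = [[4, - 2, 0, 0], [- 2, 4, - 2, 0], [0, - 2, 2, - 1], [0, 0, - 1, 2 :: int]]"
definition "F4_list = [[0, 0, 0, 1], [0, 0, 1, 0], [0, 1, 0, 0], [1, 0, 0, 0], [0, 0, 1, 1],
  [0, 1, 1, 0], [1, 1, 0, 0], [0, 1, 1, 1], [0, 1, 2, 0], [1, 1, 1, 0], [0, 1, 2, 1], [1, 1, 1, 1],
  [1, 1, 2, 0], [0, 1, 2, 2], [1, 1, 2, 1], [1, 2, 2, 0], [1, 1, 2, 2], [1, 2, 2, 1], [1, 2, 2, 2],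
  [1, 2, 3, 1], [1, 2, 3, 2], [1, 2, 4, 2], [1, 3, 4, 2], [2, 3, 4, 2 :: nat]]"

lemma G2_valid: "valid_root_list 2 G2_list" by code_simp

lemma F4_valid: "valid_root_list 4 F4_list" by code_simp

lemma G2_diag:
  "list_ex (\<lambda>i. G2_gram ! i ! i = 2) [0..<2]" "list_ex (\<lambda>i. G2_gram ! i ! i \<noteq> 2) [0..<2]"
  by code_simp+

text \<open>The numbers are \<open>8 = 4 * 2\<close>.\<close>

lemma G2_count: "count_antichains (list_all2 (\<le>)) G2_list =
      count_antichains (list_all2 (\<le>)) (filter (\<lambda>k. gram_form 2 G2_gram k = 2) G2_list) *
      count_antichains (list_all2 (\<le>)) (filter (supported_list 2 G2_gram) G2_list)"
  by code_simp

lemma F4_diag: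
  "list_ex (\<lambda>i. F4_gram ! i ! i = 2) [0..<4]" "list_ex (\<lambda>i. F4_gram ! i ! i \<noteq> 2) [0..<4]"
  by code_simp+

text \<open>The numbers are \<open>105 = 21 * 5\<close>; the factor 5 belongs to the subsystem of
  type A2.\<close>

lemma F4_count: "count_antichains (list_all2 (\<le>)) F4_list =
      count_antichains (list_all2 (\<le>)) (filter (\<lambda>k. gram_form 4 F4_gram k = 2) F4_list) *
      count_antichains (list_all2 (\<le>)) (filter (supported_list 4 F4_gram) F4_list)"
  by code_simp

text \<open>Vectors of the \<open>F\<^sub>4\<close> root system are given by twice their coordinates in an orthogonal frame of
  short roots.\<close>

definition half_coords :: "nat list \<Rightarrow> int list" where
  "half_coords k = (case map int k of [a, b, c, d] \<Rightarrow>
     [d, 2 * a - d, 2 * b - 2 * a - d, 2 * c - 2 * b - d])"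

definition F4_coords :: "int list list" where
  "F4_coords = map half_coords F4_list @ map (map uminus \<circ> half_coords) F4_list"

text \<open>In doubled coordinates the squared length is \<open>c / 4\<close> times the sum of
  squares, so short roots have the sum 4 and long roots the sum 8. No coordinate exceeds 2 in
  absolute value, which leaves a finite box to search.\<close>

lemma F4_coords_complete_aux:
  "list_all (\<lambda>a. list_all (\<lambda>b. list_all (\<lambda>c. list_all (\<lambda>d.
     a * a + b * b + c * c + d * d = 4 \<or>
     (even a \<and> even b \<and> even c \<and> even d \<and> a * a + b * b + c * c + d * d = 8) \<longrightarrow>
     List.member F4_coords [a, b, c, d])
   [-2, -1, 0, 1, 2]) [-2, -1, 0, 1, 2]) [-2, -1, 0, 1, 2]) [-2, -1, 0, 1, 2 :: int]"
  by code_simp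

text \<open>The converse direction needs a reason why each listed vector is a root. The three shapes
  are the signed half sums of the whole frame, the signed frame elements, and the signed sums of two
  of them, each of which can be produced from the frame by reflections.\<close>

lemma F4_coords_sound_aux:
  "list_all (\<lambda>x. (length x = 4 \<and> list_all (\<lambda>a. a = 1 \<or> a = -1) x) \<or>
     list_ex (\<lambda>i. list_ex (\<lambda>s. x = map (\<lambda>j. if j = i then 2 * s else 0) [0..<4]) [1, -1]) [0..<4] \<or>
     list_ex (\<lambda>i. list_ex (\<lambda>j. i \<noteq> j \<and> list_ex (\<lambda>s. list_ex (\<lambda>t.
       x = map (\<lambda>l. if l = i then 2 * s else if l = j then 2 * t else 0) [0..<4]) [1, -1]) [1, -1])
       [0..<4]) [0..<4]) F4_coords"
  by code_simp

lemma F4_coords_complete: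
  assumes "a * a + b * b + c * c + d * d = 4 \<or>
     (even a \<and> even b \<and> even c \<and> even d \<and> a * a + b * b + c * c + d * d = 8)"
  shows "[a, b, c, d] \<in> set F4_coords"
proof -
  have bound: "x \<in> {-2, -1, 0, 1, 2}" if "x * x \<le> 8" for x :: int
  proof -
    have "\<bar>x\<bar> < 3"
    proof (rule ccontr)
      assume "\<not> \<bar>x\<bar> < 3"
      then have "3 * 3 \<le> \<bar>x\<bar> * \<bar>x\<bar>" by (intro mult_mono) auto
      then show False using that by (simp add: abs_mult_self_eq)
    qed
    then show ?thesis by auto
  qed
  have "a * a \<ge> 0" "b * b \<ge> 0" "c * c \<ge> 0" "d * d \<ge> 0" by simp_all
  then have le8: "a * a \<le> 8" "b * b \<le> 8" "c * c \<le> 8" "d * d \<le> 8" using assms by linarith+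
  have "a \<in> {-2, -1, 0, 1, 2}" "b \<in> {-2, -1, 0, 1, 2}" "c \<in> {-2, -1, 0, 1, 2}" "d \<in> {-2, -1, 0, 1, 2}"
    using le8 bound by blast+
  then have "List.member F4_coords [a, b, c, d]"
    by (intro F4_coords_complete_aux[unfolded list_all_iff, rule_format] assms) simp_all
  then show ?thesis by simp
qed

lemma F4_coords_cases:
  assumes "x \<in> set F4_coords"
  shows "(length x = 4 \<and> (\<forall>a\<in>set x. a = 1 \<or> a = -1)) \<or>
    (\<exists>i\<in>{0..<4}. \<exists>s\<in>{1, -1}. x = map (\<lambda>j. if j = i then 2 * s else 0) [0..<4]) \<or>
    (\<exists>i\<in>{0..<4}. \<exists>j\<in>{0..<4}. i \<noteq> j \<and> (\<exists>s\<in>{1, -1}. \<exists>t\<in>{1, -1}.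
        x = map (\<lambda>l. if l = i then 2 * s else if l = j then 2 * t else 0) [0..<4]))"
  using bspec[OF F4_coords_sound_aux[unfolded list_all_iff] assms]
  unfolding list_ex_iff set_upt list.set .

lemma less_4_cases: "(i::nat) < 4 \<Longrightarrow> i = 0 \<or> i = 1 \<or> i = 2 \<or> i = 3"
  by auto

section \<open>The product formula in types G2 and F4\<close>

theorem antichain_product_G2:
  fixes \<alpha> \<beta> :: "'a::euclidean_space"
  assumes "c > 0" "\<alpha> \<bullet> \<alpha> = c" "\<beta> \<bullet> \<beta> = 3 * c" "\<alpha> \<bullet> \<beta> = - 3 * c / 2"
    and P: "P = {\<alpha>, \<beta>, \<alpha> + \<beta>, 2 *\<^sub>R \<alpha> + \<beta>, 3 *\<^sub>R \<alpha> + \<beta>, 3 *\<^sub>R \<alpha> + 2 *\<^sub>R \<beta>}" and "P \<subseteq> \<Delta>"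
    and lengths: "\<And>\<gamma>. \<gamma> \<in> \<Delta> \<Longrightarrow> \<gamma> \<bullet> \<gamma> = c \<or> \<gamma> \<bullet> \<gamma> = 3 * c"
  shows "card (antichains (simple_roots P) P) =
         card (short_antichains \<Delta> P) *
         card (antichains (long_simple_roots \<Delta> P)
                 (subsystem_pos \<Delta> P (long_simple_roots \<Delta> P)))"
proof -
  define a where "a i = [\<alpha>, \<beta>] ! i" for i
  \<comment> \<open>The dual basis; its coefficients are the entries of the inverse of the Gram
    matrix of \<open>\<alpha>\<close> and \<open>\<beta>\<close>.\<close>
  define w where "w i = (1 / c) *\<^sub>R [4 *\<^sub>R \<alpha> + 2 *\<^sub>R \<beta>, 2 *\<^sub>R \<alpha> + (4 / 3) *\<^sub>R \<beta>] ! i" for i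
  note ip = assms(1-4) assms(4)[unfolded inner_commute[of \<alpha>]]
  interpret list_model a w 2 c G2_gram G2_list
  proof
    show "w i \<bullet> a j = (if i = j then 1 else 0)" if "i < 2" "j < 2" for i j
      using that ip unfolding less_2_cases_iff
      by (auto simp: w_def a_def inner_add_left field_simps)
    show "a i \<bullet> a j = c / 2 * of_int (G2_gram ! i ! j)" if "i < 2" "j < 2" for i j
      using that ip unfolding less_2_cases_iff by (auto simp: a_def G2_gram_def)
  qed (use assms(1) G2_valid in auto)
  have lr: "list_root [x, y] = real x *\<^sub>R \<alpha> + real y *\<^sub>R \<beta>" for x y
    by (simp add: list_root_def a_def lessThan_nat_numeral lessThan_Suc add.commute)
  have P': "P = list_root ` set G2_list"
    unfolding P G2_list_def list.set image_insert image_empty lr by simp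
  show ?thesis
    unfolding P'
  proof (rule antichain_product_list[of \<Delta> "3 * c"])
    show "list_root ` set G2_list \<subseteq> \<Delta>" using assms(6) unfolding P' .
    show "c < 3 * c" using assms(1) by simp
    show "\<gamma> \<bullet> \<gamma> = c \<or> \<gamma> \<bullet> \<gamma> = 3 * c" if "\<gamma> \<in> \<Delta>" for \<gamma> using that by (rule lengths)
  qed (rule G2_diag G2_count)+
qed

definition half_vector :: "(nat \<Rightarrow> 'a::euclidean_space) \<Rightarrow> int list \<Rightarrow> 'a" where
  "half_vector e x = (\<Sum>i<4. (of_int (x ! i) / 2) *\<^sub>R e i)"

lemma half_vector_uminus: "length x = 4 \<Longrightarrow> half_vector e (map uminus x) = - half_vector e x"
  by (simp add: half_vector_def sum_negf)

theorem antichain_product_F4: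
  fixes e :: "nat \<Rightarrow> 'a::euclidean_space"
  assumes "orthogonal_family e 3 c"
    and \<Delta>: "\<Delta> = half_vector e ` set F4_coords"
    and P: "P = {\<beta> \<in> \<Delta>. v \<bullet> \<beta> > 0}"
    and v: "v \<bullet> e 1 > v \<bullet> e 2" "v \<bullet> e 2 > v \<bullet> e 3" "v \<bullet> e 3 > 0" "v \<bullet> e 0 > v \<bullet> e 1 + v \<bullet> e 2 + v \<bullet> e 3"
    and lengths: "\<And>\<gamma>. \<gamma> \<in> \<Delta> \<Longrightarrow> \<gamma> \<bullet> \<gamma> = c \<or> \<gamma> \<bullet> \<gamma> = 2 * c"
  shows "card (antichains (simple_roots P) P) =
         card (short_antichains \<Delta> P) *
         card (antichains (long_simple_roots \<Delta> P)
                 (subsystem_pos \<Delta> P (long_simple_roots \<Delta> P)))"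
proof -
  interpret orthogonal_family e 3 c by (rule assms(1))
  \<comment> \<open>The usual simple roots of F4. The inequalities assumed for \<open>v\<close> say
    exactly that \<open>v\<close> is positive on these four vectors.\<close>
  define a where "a i = [e 1 - e 2, e 2 - e 3, e 3, (1 / 2) *\<^sub>R (e 0 - e 1 - e 2 - e 3)] ! i" for i
  define w where "w i = (1 / c) *\<^sub>R [e 0 + e 1, 2 *\<^sub>R e 0 + e 1 + e 2, 3 *\<^sub>R e 0 + e 1 + e 2 + e 3, 2 *\<^sub>R e 0] ! i" for i
  note iprod = inner_add_left inner_add_right inner_diff_left inner_diff_right ortho
  interpret list_model a w 4 c F4_gram F4_list
  proof
    show "w i \<bullet> a j = (if i = j then 1 else 0)" if "i < 4" "j < 4" for i j
      using less_4_cases[OF that(1)] less_4_cases[OF that(2)] c_pos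
      by (elim disjE) (simp_all add: w_def a_def iprod)
    show "a i \<bullet> a j = c / 2 * of_int (F4_gram ! i ! j)" if "i < 4" "j < 4" for i j
      using less_4_cases[OF that(1)] less_4_cases[OF that(2)] c_pos
      by (elim disjE) (simp_all add: a_def F4_gram_def iprod)
  qed (use c_pos F4_valid in auto)
  have coords: "list_root k = half_vector e (half_coords k) \<and> length (half_coords k) = 4" if "k \<in> set F4_list" for k
  proof -
    have "length k = Suc (Suc (Suc (Suc 0)))" using length_K[OF that] by simp
    then obtain p q r s where k: "k = [p, q, r, s]" by (auto simp: length_Suc_conv)
    show ?thesis unfolding k list_root_def half_vector_def half_coords_def
      by (simp add: lessThan_nat_numeral lessThan_Suc a_def algebra_simps add_divide_distrib diff_divide_distrib scaleR_add_left scaleR_diff_left)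
  qed
  have "half_vector e ` set F4_coords =
      (\<lambda>k. half_vector e (half_coords k)) ` set F4_list \<union>
      (\<lambda>k. half_vector e (map uminus (half_coords k))) ` set F4_list"
    by (simp add: F4_coords_def image_Un image_image)
  also have "\<dots> = list_root ` set F4_list \<union> (\<lambda>k. - list_root k) ` set F4_list"
    using coords by (intro arg_cong2[of _ _ _ _ "(\<union>)"] image_cong refl) (simp_all add: half_vector_uminus)
  finally have \<Delta>': "\<Delta> = list_root ` set F4_list \<union> (\<lambda>k. - list_root k) ` set F4_list"
    using \<Delta> by simp
  have va: "v \<bullet> a i > 0" if "i < 4" for i
    using less_4_cases[OF that] v by (auto simp: a_def inner_diff_right)
  have pos: "v \<bullet> list_root k > 0" if "k \<in> set F4_list" for k
  proof -
    obtain i where i: "i < 4" "k ! i \<noteq> 0" using nonzero_coeff \<open>k \<in> set F4_list\<close> by blast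
    have "v \<bullet> list_root k = (\<Sum>i<4. real (k ! i) * (v \<bullet> a i))"
      by (simp add: list_root_def inner_sum_right)
    also have "\<dots> > 0"
      using i va by (intro sum_pos2[of _ i]) (auto simp: less_imp_le)
    finally show ?thesis .
  qed
  have "\<not> v \<bullet> (- list_root k) > 0" if "k \<in> set F4_list" for k
    using pos[OF that] by simp
  with pos have "list_root ` set F4_list = P"
    unfolding P \<Delta>' by auto
  then have P': "P = list_root ` set F4_list" ..
  show ?thesis
    unfolding P'
  proof (rule antichain_product_list[of \<Delta> "2 * c"])
    show "list_root ` set F4_list \<subseteq> \<Delta>" unfolding \<Delta>' by blast
    show "c < 2 * c" using c_pos by simp
    show "\<gamma> \<bullet> \<gamma> = c \<or> \<gamma> \<bullet> \<gamma> = 2 * c" if "\<gamma> \<in> \<Delta>" for \<gamma> using that by (rule lengths)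
  qed (rule F4_diag F4_count)+
qed

section \<open>Root lengths in irreducible systems\<close>

lemma Ints_square_less_4:
  fixes x :: real
  assumes "x \<in> \<int>" "x * x < 4"
  shows "x = 0 \<or> x = 1 \<or> x = -1"
proof -
  obtain k :: int where k: "x = of_int k" using assms(1) by (rule Ints_cases)
  have "\<bar>x\<bar> < 2"
  proof (rule ccontr)
    assume "\<not> \<bar>x\<bar> < 2"
    then have "2 * 2 \<le> \<bar>x\<bar> * \<bar>x\<bar>" by (intro mult_mono) auto
    then show False using assms(2) by (simp add: abs_mult_self_eq)
  qed
  then have "\<bar>k\<bar> < 2" using k by linarith
  then have "k = 0 \<or> k = 1 \<or> k = -1" by linarith
  then show ?thesis using k by auto
qed

lemma Ints_square_le_4:
  fixes x :: real
  assumes "x \<in> \<int>" "x * x \<le> 4"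
  shows "x = 0 \<or> x = 1 \<or> x = -1 \<or> x = 2 \<or> x = -2"
proof (cases "x * x = 4")
  case True
  then have "(x - 2) * (x + 2) = 0" by (simp add: algebra_simps)
  then show ?thesis by auto
next
  case False
  then show ?thesis using Ints_square_less_4[of x] assms by auto
qed

lemma eq_of_inner_eq:
  fixes x y :: "'a::real_inner"
  assumes "x \<bullet> x = c" "y \<bullet> y = c" "x \<bullet> y = c"
  shows "x = y"
proof -
  have "(x - y) \<bullet> (x - y) = 0" using assms by (simp add: inner_diff_left inner_diff_right inner_commute)
  then show ?thesis by simp
qed

lemma eq_minus_of_inner_eq:
  fixes x y :: "'a::real_inner"
  assumes "x \<bullet> x = c" "y \<bullet> y = c" "x \<bullet> y = - c"
  shows "x = - y"
  using eq_of_inner_eq[of x c "- y"] assms by simp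

text \<open>Pythagoras for the projection onto the span of \<open>E\<close>. That the left side is
  nonnegative is Bessel's inequality, and if the right side vanishes then \<open>x\<close> equals
  its projection; both consequences are used for frames.\<close>

lemma orthogonal_residue_norm:
  fixes x :: "'a::real_inner"
  assumes "finite E" "c > 0" "\<And>f. f \<in> E \<Longrightarrow> f \<bullet> f = c" "\<And>f g. f \<in> E \<Longrightarrow> g \<in> E \<Longrightarrow> f \<noteq> g \<Longrightarrow> f \<bullet> g = 0"
  defines "y \<equiv> x - (\<Sum>f\<in>E. (x \<bullet> f / c) *\<^sub>R f)"
  shows "y \<bullet> y = x \<bullet> x - (\<Sum>f\<in>E. (x \<bullet> f)\<^sup>2) / c"
proof -
  define p where "p = (\<Sum>f\<in>E. (x \<bullet> f / c) *\<^sub>R f)"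
  have yf: "y \<bullet> f = 0" if "f \<in> E" for f
  proof -
    have "p \<bullet> f = (\<Sum>g\<in>E. if g = f then x \<bullet> f else 0)"
      unfolding p_def inner_sum_left
      by (rule sum.cong) (use assms that in auto)
    then have "p \<bullet> f = x \<bullet> f" using assms(1) that by simp
    then show ?thesis by (simp add: y_def p_def inner_diff_left)
  qed
  have "y \<bullet> p = 0" unfolding p_def inner_sum_right using yf by simp
  then have "y \<bullet> y = y \<bullet> x" by (simp add: y_def p_def inner_diff_right)
  also have "\<dots> = x \<bullet> x - p \<bullet> x" by (simp add: y_def p_def inner_diff_left)
  also have "p \<bullet> x = (\<Sum>f\<in>E. (x \<bullet> f)\<^sup>2) / c"
    unfolding p_def inner_sum_left by (simp add: inner_commute power2_eq_square sum_divide_distrib)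
  finally show ?thesis .
qed

lemma decreasing_enumeration:
  fixes \<phi> :: "'a \<Rightarrow> real"
  assumes "finite E" "inj_on \<phi> E"
  shows "\<exists>e. e ` {..<card E} = E \<and> (\<forall>i j. i < j \<longrightarrow> j < card E \<longrightarrow> \<phi> (e j) < \<phi> (e i))"
  using assms
proof (induction E rule: finite_ranking_induct[where f = "\<lambda>x. - \<phi> x"])
  case empty
  then show ?case by auto
next
  case (insert x S)
  show ?case
  proof (cases "x \<in> S")
    case True
    then show ?thesis using insert by (simp add: insert_absorb)
  next
    case False
    obtain e where e: "e ` {..<card S} = S" "\<forall>i j. i < j \<longrightarrow> j < card S \<longrightarrow> \<phi> (e j) < \<phi> (e i)"
      using insert by (meson inj_on_subset subset_insertI)
    let ?e = "e(card S := x)"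
    have "\<phi> x < \<phi> y" if "y \<in> S" for y
    proof -
      have "\<phi> x \<noteq> \<phi> y" using insert.prems False that by (metis inj_onD insertI1 insertI2)
      then show ?thesis using insert.hyps(2)[OF that] by simp
    qed
    then have "\<forall>i j. i < j \<longrightarrow> j < card (insert x S) \<longrightarrow> \<phi> (?e j) < \<phi> (?e i)"
      using e False insert.hyps(1) by (auto simp: less_Suc_eq)
    moreover have "?e ` {..<card (insert x S)} = insert x S"
      using e(1) False insert.hyps(1) by (auto simp: lessThan_Suc)
    ultimately show ?thesis by blast
  qed
qed

locale irreducible_system =
  fixes \<Delta> :: "'a::euclidean_space set" and v :: 'a
  assumes rs: "root_system \<Delta>" and cryst: "crystallographic \<Delta>" and red: "reduced_roots \<Delta>"
    and irred: "irreducible_roots \<Delta>" and regular: "\<And>\<alpha>. \<alpha> \<in> \<Delta> \<Longrightarrow> v \<bullet> \<alpha> \<noteq> 0"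
begin

lemma fin: "finite \<Delta>" and zero_notin: "0 \<notin> \<Delta>"
  using rs by (auto simp: root_system_def)

lemma norm_pos: "\<alpha> \<in> \<Delta> \<Longrightarrow> \<alpha> \<bullet> \<alpha> > 0"
  using zero_notin by (metis inner_gt_zero_iff)

lemma reflect:
  assumes "\<alpha> \<in> \<Delta>" "\<beta> \<in> \<Delta>" "2 * (\<beta> \<bullet> \<alpha>) = k * (\<alpha> \<bullet> \<alpha>)"
  shows "\<beta> - k *\<^sub>R \<alpha> \<in> \<Delta>"
proof -
  have "2 * (\<beta> \<bullet> \<alpha>) / (\<alpha> \<bullet> \<alpha>) = k" using norm_pos[OF assms(1)] assms(3) by simp
  then show ?thesis using rs assms(1,2) by (auto simp: root_system_def root_reflection_def)
qed

lemma neg: "\<alpha> \<in> \<Delta> \<Longrightarrow> - \<alpha> \<in> \<Delta>"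
  using reflect[of \<alpha> \<alpha> 2] by (simp add: scaleR_2)

lemma neg_iff: "- \<alpha> \<in> \<Delta> \<longleftrightarrow> \<alpha> \<in> \<Delta>"
  using neg[of \<alpha>] neg[of "- \<alpha>"] by auto

lemma diff_swap: "\<alpha> - \<beta> \<in> \<Delta> \<Longrightarrow> \<beta> - \<alpha> \<in> \<Delta>"
  using neg[of "\<alpha> - \<beta>"] by simp

lemma cartan_Ints: "\<alpha> \<in> \<Delta> \<Longrightarrow> \<beta> \<in> \<Delta> \<Longrightarrow> 2 * (\<beta> \<bullet> \<alpha>) / (\<alpha> \<bullet> \<alpha>) \<in> \<int>"
  using cryst by (auto simp: crystallographic_def)

text \<open>The only form in which irreducibility is used. A set \<open>D\<close> of roots already
  understood is shown to be orthogonal to all the rest and is therefore everything.\<close>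

lemma irreducible_eq:
  assumes "D \<subseteq> \<Delta>" "D \<noteq> {}" "\<And>\<beta> \<delta>. \<beta> \<in> D \<Longrightarrow> \<delta> \<in> \<Delta> \<Longrightarrow> \<delta> \<notin> D \<Longrightarrow> \<beta> \<bullet> \<delta> = 0"
  shows "D = \<Delta>"
proof (rule ccontr)
  assume "D \<noteq> \<Delta>"
  then have "\<Delta> - D \<noteq> {}" "D \<union> (\<Delta> - D) = \<Delta>" "D \<inter> (\<Delta> - D) = {}" using assms(1) by auto
  moreover have "\<forall>\<alpha>\<in>D. \<forall>\<beta>\<in>\<Delta> - D. \<alpha> \<bullet> \<beta> = 0" using assms(3) by blast
  ultimately show False using irred assms(2) unfolding irreducible_roots_def by blast
qed

text \<open>If \<open>\<gamma>\<close> has the length of \<open>\<alpha>\<close> and meets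
  \<open>\<beta>\<close>, its reflection in \<open>\<beta>\<close> has the same length. A root
  \<open>\<delta>\<close> orthogonal to all roots of that length is then orthogonal to the
  difference of the two, a nonzero multiple of \<open>\<beta>\<close>. So the roots meeting some
  root of that length are orthogonal to the others.\<close>

lemma ex_nonorthogonal_of_length:
  assumes "\<alpha> \<in> \<Delta>" "\<beta> \<in> \<Delta>"
  shows "\<exists>\<gamma>\<in>\<Delta>. \<gamma> \<bullet> \<gamma> = \<alpha> \<bullet> \<alpha> \<and> \<gamma> \<bullet> \<beta> \<noteq> 0"
proof -
  define D where "D = {\<beta> \<in> \<Delta>. \<exists>\<gamma>\<in>\<Delta>. \<gamma> \<bullet> \<gamma> = \<alpha> \<bullet> \<alpha> \<and> \<gamma> \<bullet> \<beta> \<noteq> 0}"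
  have "D = \<Delta>"
  proof (rule irreducible_eq)
    show "D \<subseteq> \<Delta>" by (auto simp: D_def)
    have "\<alpha> \<in> D" using assms(1) norm_pos[OF assms(1)] by (auto simp: D_def intro!: bexI[of _ \<alpha>])
    then show "D \<noteq> {}" by blast
    fix \<beta> \<delta> assume \<beta>: "\<beta> \<in> D" and \<delta>: "\<delta> \<in> \<Delta>" "\<delta> \<notin> D"
    obtain \<gamma> where \<gamma>: "\<beta> \<in> \<Delta>" "\<gamma> \<in> \<Delta>" "\<gamma> \<bullet> \<gamma> = \<alpha> \<bullet> \<alpha>" "\<gamma> \<bullet> \<beta> \<noteq> 0"
      using \<beta> by (auto simp: D_def)
    define k where "k = 2 * (\<gamma> \<bullet> \<beta>) / (\<beta> \<bullet> \<beta>)"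
    have k: "2 * (\<gamma> \<bullet> \<beta>) = k * (\<beta> \<bullet> \<beta>)" using norm_pos[OF \<gamma>(1)] by (simp add: k_def)
    have mem: "\<gamma> - k *\<^sub>R \<beta> \<in> \<Delta>" by (rule reflect[OF \<gamma>(1,2) k])
    have "(\<gamma> - k *\<^sub>R \<beta>) \<bullet> (\<gamma> - k *\<^sub>R \<beta>) = \<gamma> \<bullet> \<gamma> - k * (2 * (\<gamma> \<bullet> \<beta>)) + k * (k * (\<beta> \<bullet> \<beta>))"
      by (simp add: inner_diff_left inner_diff_right inner_commute algebra_simps)
    also have "\<dots> = \<alpha> \<bullet> \<alpha>" unfolding k \<gamma>(3) by simp
    finally have "(\<gamma> - k *\<^sub>R \<beta>) \<bullet> \<delta> = 0" "\<gamma> \<bullet> \<delta> = 0" using \<delta> mem \<gamma> by (auto simp: D_def)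
    then have "k * (\<beta> \<bullet> \<delta>) = 0" by (simp add: inner_diff_left)
    moreover have "k \<noteq> 0" using k \<gamma>(4) by auto
    ultimately show "\<beta> \<bullet> \<delta> = 0" by simp
  qed
  then show ?thesis using assms(2) by (auto simp: D_def)
qed

text \<open>The Cartan integers \<open>p\<close> and \<open>q\<close> satisfy
  \<open>p * q \<le> 4\<close> by Cauchy-Schwarz, and the ratio of the squared lengths is the
  quotient of their absolute values. If the lengths differ then the absolute value of
  \<open>q\<close> is 1, and the ratio 4 contradicts reducedness.\<close>

lemma length_ratio:
  assumes "\<alpha> \<in> \<Delta>" "\<beta> \<in> \<Delta>" "\<alpha> \<bullet> \<beta> \<noteq> 0" "\<alpha> \<bullet> \<alpha> \<le> \<beta> \<bullet> \<beta>"
  shows "\<beta> \<bullet> \<beta> = \<alpha> \<bullet> \<alpha> \<or> \<beta> \<bullet> \<beta> = 2 * (\<alpha> \<bullet> \<alpha>) \<or> \<beta> \<bullet> \<beta> = 3 * (\<alpha> \<bullet> \<alpha>)"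
proof (rule ccontr)
  assume no: "\<not> ?thesis"
  define a b where "a = \<alpha> \<bullet> \<alpha>" and "b = \<beta> \<bullet> \<beta>"
  have a: "a > 0" and b: "b > 0" using norm_pos assms by (auto simp: a_def b_def)
  obtain p :: int where p: "2 * (\<beta> \<bullet> \<alpha>) / a = of_int p"
    using cartan_Ints[OF assms(1,2)] by (auto elim: Ints_cases simp: a_def)
  obtain q :: int where q: "2 * (\<alpha> \<bullet> \<beta>) / b = of_int q"
    using cartan_Ints[OF assms(2,1)] by (auto elim: Ints_cases simp: b_def)
  have p': "2 * (\<alpha> \<bullet> \<beta>) = of_int p * a" using p a by (simp add: field_simps inner_commute)
  have q': "2 * (\<alpha> \<bullet> \<beta>) = of_int q * b" using q b by (simp add: field_simps)
  have ab: "of_int p * a = of_int q * b" using p' q' by simp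
  have nz: "p \<noteq> 0" "q \<noteq> 0" using p' q' assms(3) by auto
  have sgn: "of_int \<bar>p\<bar> * a = of_int \<bar>q\<bar> * b" using ab a b by (metis abs_mult abs_of_pos of_int_abs)
  have cs: "(\<alpha> \<bullet> \<beta>)\<^sup>2 \<le> a * b" using Cauchy_Schwarz_ineq[of \<alpha> \<beta>] by (simp add: a_def b_def)
  have four: "4 * (\<alpha> \<bullet> \<beta>)\<^sup>2 = (of_int p * of_int q) * (a * b)"
  proof -
    have "4 * (\<alpha> \<bullet> \<beta>)\<^sup>2 = (2 * (\<alpha> \<bullet> \<beta>)) * (2 * (\<alpha> \<bullet> \<beta>))" by (simp add: power2_eq_square)
    also have "\<dots> = (of_int p * a) * (of_int q * b)" using p' q' by metis
    finally show ?thesis by simp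
  qed
  then have "real_of_int (p * q) * (a * b) \<le> 4 * (a * b)" using cs by simp
  then have "real_of_int (p * q) \<le> 4" using a b by (simp add: mult_le_cancel_right)
  then have "p * q \<le> 4" by linarith
  have pq_abs: "p * q = \<bar>p\<bar> * \<bar>q\<bar>"
  proof -
    have "real_of_int (p * q) * (a * b) \<ge> 0" using four by (metis of_int_mult zero_le_mult_iff zero_le_numeral zero_le_power2)
    then have "real_of_int (p * q) \<ge> 0" using mult_pos_pos[OF a b] by (meson not_le mult_neg_pos)
    then have "p * q \<ge> 0" by (simp del: of_int_mult)
    then show ?thesis by (simp add: abs_mult[symmetric])
  qed
  \<comment> \<open>As \<open>\<beta>\<close> is not the shorter root, \<open>p\<close> is at least
    as large as \<open>q\<close> in absolute value. A product of at most 4 with \<open>q\<close> at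
    least 2 makes both equal to 2, which is the excluded case of equal lengths.\<close>
  have "\<bar>q\<bar> = 1"
  proof (rule ccontr)
    assume "\<bar>q\<bar> \<noteq> 1"
    then have q2: "\<bar>q\<bar> \<ge> 2" using nz by linarith
    have "\<bar>q\<bar> \<le> \<bar>p\<bar>"
    proof -
      have "of_int \<bar>q\<bar> * a \<le> of_int \<bar>q\<bar> * b" using assms(4) by (simp add: a_def b_def mult_left_mono)
      then have "real_of_int \<bar>q\<bar> * a \<le> of_int \<bar>p\<bar> * a" using sgn by simp
      then show ?thesis using a by simp
    qed
    moreover have "\<bar>p\<bar> * 2 \<le> \<bar>p\<bar> * \<bar>q\<bar>" using q2 by (intro mult_left_mono) auto
    ultimately have "\<bar>p\<bar> = 2" "\<bar>q\<bar> = 2" using \<open>p * q \<le> 4\<close> pq_abs q2 by linarith+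
    then show False using sgn no by (simp add: a_def b_def)
  qed
  then have pb: "b = of_int \<bar>p\<bar> * a" using sgn by simp
  moreover have "\<bar>p\<bar> \<le> 4" using \<open>p * q \<le> 4\<close> pq_abs \<open>\<bar>q\<bar> = 1\<close> by simp
  moreover have "\<bar>p\<bar> \<noteq> 1" "\<bar>p\<bar> \<noteq> 2" "\<bar>p\<bar> \<noteq> 3" using no pb by (auto simp: a_def b_def)
  ultimately have p4: "\<bar>p\<bar> = 4" using nz by linarith
  \<comment> \<open>With \<open>p\<close> equal to 4 or -4 equality holds in Cauchy-Schwarz, so
    \<open>\<beta>\<close> would be twice \<open>\<alpha>\<close> up to sign.\<close>
  have "(\<beta> - (of_int p / 2) *\<^sub>R \<alpha>) \<bullet> (\<beta> - (of_int p / 2) *\<^sub>R \<alpha>) =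
      b - of_int p / 2 * (2 * (\<alpha> \<bullet> \<beta>)) + of_int p / 2 * (of_int p / 2) * a"
    by (simp add: inner_diff_left inner_diff_right inner_commute a_def b_def algebra_simps)
  also have "\<dots> = b - (of_int p * of_int p) / 4 * a" unfolding p' by (simp add: field_simps)
  also have "real_of_int p * of_int p = 16"
  proof -
    have "p = 4 \<or> p = -4" using p4 by linarith
    then show ?thesis by auto
  qed
  also have "b - 16 / 4 * a = 0" using pb p4 by simp
  finally have "\<beta> = (of_int p / 2) *\<^sub>R \<alpha>" by simp
  then have "of_int p / 2 = (1::real) \<or> of_int p / 2 = (-1::real)"
    using red assms(1,2) unfolding reduced_roots_def by blast
  then show False using p4 by auto
qed

text \<open>Each root meets a root of minimal length, so its squared length is \<open>c\<close>,
  \<open>2 * c\<close> or \<open>3 * c\<close>. The last two cannot both occur, since two roots of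
  these lengths that meet would have the ratio 3/2.\<close>

lemma two_length_classes:
  assumes "two_lengths \<Delta>"
  obtains c r where "c > 0" "r = 2 \<or> r = 3" "\<And>\<beta>. \<beta> \<in> \<Delta> \<Longrightarrow> \<beta> \<bullet> \<beta> = c \<or> \<beta> \<bullet> \<beta> = r * c"
    "\<exists>\<beta>\<in>\<Delta>. \<beta> \<bullet> \<beta> = c" "\<exists>\<beta>\<in>\<Delta>. \<beta> \<bullet> \<beta> = r * c"
proof -
  obtain \<beta>0 \<beta>1 where b: "\<beta>0 \<in> \<Delta>" "\<beta>1 \<in> \<Delta>" "\<beta>0 \<bullet> \<beta>0 \<noteq> \<beta>1 \<bullet> \<beta>1"
    using assms by (auto simp: two_lengths_def norm_eq)
  define c where "c = Min ((\<lambda>\<beta>. \<beta> \<bullet> \<beta>) ` \<Delta>)"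
  have "c \<in> (\<lambda>\<beta>. \<beta> \<bullet> \<beta>) ` \<Delta>" unfolding c_def using fin b(1) by (intro Min_in) auto
  then obtain \<alpha> where \<alpha>: "\<alpha> \<in> \<Delta>" "\<alpha> \<bullet> \<alpha> = c" by auto
  have min: "c \<le> \<beta> \<bullet> \<beta>" if "\<beta> \<in> \<Delta>" for \<beta> unfolding c_def using fin that by (intro Min_le) auto
  have c0: "c > 0" using norm_pos[OF \<alpha>(1)] \<alpha>(2) by simp
  have three: "\<beta> \<bullet> \<beta> = c \<or> \<beta> \<bullet> \<beta> = 2 * c \<or> \<beta> \<bullet> \<beta> = 3 * c" if "\<beta> \<in> \<Delta>" for \<beta>
    using ex_nonorthogonal_of_length[OF \<alpha>(1) that] length_ratio[OF _ that] min[OF that] \<alpha>(2) by metis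
  have excl: False if bg: "\<beta> \<in> \<Delta>" "\<gamma> \<in> \<Delta>" "\<beta> \<bullet> \<beta> = 2 * c" "\<gamma> \<bullet> \<gamma> = 3 * c" for \<beta> \<gamma>
  proof -
    obtain \<delta> where "\<delta> \<in> \<Delta>" "\<delta> \<bullet> \<delta> = 2 * c" "\<delta> \<bullet> \<gamma> \<noteq> 0"
      using ex_nonorthogonal_of_length[OF bg(1,2)] bg by auto
    then show False using length_ratio[of \<delta> \<gamma>] bg c0 by auto
  qed
  obtain \<beta> where \<beta>: "\<beta> \<in> \<Delta>" "\<beta> \<bullet> \<beta> \<noteq> c" using b by metis
  define r where "r = (if \<beta> \<bullet> \<beta> = 2 * c then 2 else 3 :: real)"
  show ?thesis
  proof (rule that[of c r])
    show "\<gamma> \<bullet> \<gamma> = c \<or> \<gamma> \<bullet> \<gamma> = r * c" if "\<gamma> \<in> \<Delta>" for \<gamma>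
      using three[OF that] three[OF \<beta>(1)] excl[OF \<beta>(1) that] excl[OF that \<beta>(1)] \<beta>(2)
      by (auto simp: r_def)
    show "\<exists>\<beta>\<in>\<Delta>. \<beta> \<bullet> \<beta> = c" using \<alpha> by blast
    show "\<exists>\<beta>\<in>\<Delta>. \<beta> \<bullet> \<beta> = r * c" using three[OF \<beta>(1)] \<beta> by (auto simp: r_def)
  qed (use c0 in \<open>auto simp: r_def\<close>)
qed

end

section \<open>Length ratio three\<close>

lemma ex_maximizer:
  fixes \<phi> :: "'a \<Rightarrow> real"
  assumes "finite A" "A \<noteq> {}"
  shows "\<exists>x\<in>A. \<forall>y\<in>A. \<phi> y \<le> \<phi> x"
proof -
  have "Max (\<phi> ` A) \<in> \<phi> ` A" using assms by (intro Max_in) auto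
  then obtain x where "x \<in> A" "\<phi> x = Max (\<phi> ` A)" by auto
  then show ?thesis using assms(1) by (metis Max_ge finite_imageI imageI)
qed

context irreducible_system begin

definition pos :: "'a set" where "pos = {\<alpha> \<in> \<Delta>. v \<bullet> \<alpha> > 0}"

definition product_formula :: bool where
  "product_formula \<longleftrightarrow> card (antichains (simple_roots pos) pos) =
     card (short_antichains \<Delta> pos) *
     card (antichains (long_simple_roots \<Delta> pos) (subsystem_pos \<Delta> pos (long_simple_roots \<Delta> pos)))"

text \<open>The roots \<open>\<gamma>\<close> and \<open>e\<close> play the parts of the highest
  root \<open>3\<alpha> + 2\<beta>\<close> and the highest short root
  \<open>2\<alpha> + \<beta>\<close> of G2; solving for the simple roots gives
  \<open>\<alpha> = 2e - \<gamma>\<close> and \<open>\<beta> = 2\<gamma> - 3e\<close>. Reflections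
  produce the other roots of G2, and every further root is shown to be orthogonal to these.\<close>

lemma product_formula_triple:
  assumes c: "c > 0" and lengths: "\<And>\<beta>. \<beta> \<in> \<Delta> \<Longrightarrow> \<beta> \<bullet> \<beta> = c \<or> \<beta> \<bullet> \<beta> = 3 * c"
    and exs: "\<exists>\<beta>\<in>\<Delta>. \<beta> \<bullet> \<beta> = c" and exl: "\<exists>\<beta>\<in>\<Delta>. \<beta> \<bullet> \<beta> = 3 * c"
  shows product_formula
proof -
  have ls: "e \<bullet> \<gamma> = 0 \<or> e \<bullet> \<gamma> = 3 * c / 2 \<or> e \<bullet> \<gamma> = - (3 * c / 2)"
    if "\<gamma> \<in> \<Delta>" "\<gamma> \<bullet> \<gamma> = 3 * c" "e \<in> \<Delta>" "e \<bullet> e = c" for \<gamma> e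
  proof -
    define x where "x = 2 * (e \<bullet> \<gamma>) / (3 * c)"
    have x: "x \<in> \<int>" using cartan_Ints[of \<gamma> e] that by (simp add: x_def)
    have e: "e \<bullet> \<gamma> = x * (3 * c / 2)" using c by (simp add: x_def)
    have "(e \<bullet> \<gamma>)\<^sup>2 \<le> c * (3 * c)" using Cauchy_Schwarz_ineq[of e \<gamma>] that by simp
    then have "(x * x) * (9 * (c * c)) \<le> 12 * (c * c)"
      unfolding e by (simp add: power2_eq_square algebra_simps)
    then have "x * x * 9 \<le> 12" using c mult_le_cancel_right_pos[of "c * c" "x * x * 9" 12] by (simp add: mult.assoc)
    then have "x = 0 \<or> x = 1 \<or> x = -1" using Ints_square_less_4[OF x] by simp
    then show ?thesis using e by auto
  qed
  \<comment> \<open>Maximality against the long root \<open>3e - \<gamma>\<close> will make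
    \<open>v\<close> positive on \<open>\<beta> = 2\<gamma> - 3e\<close>.\<close>
  obtain \<gamma> where \<gamma>: "\<gamma> \<in> \<Delta>" "\<gamma> \<bullet> \<gamma> = 3 * c"
    and max: "\<And>\<delta>. \<delta> \<in> \<Delta> \<Longrightarrow> \<delta> \<bullet> \<delta> = 3 * c \<Longrightarrow> v \<bullet> \<delta> \<le> v \<bullet> \<gamma>"
  proof -
    let ?L = "{\<delta> \<in> \<Delta>. \<delta> \<bullet> \<delta> = 3 * c}"
    have "finite ?L" "?L \<noteq> {}" using fin exl by auto
    then obtain \<gamma> where "\<gamma> \<in> ?L" "\<forall>\<delta>\<in>?L. v \<bullet> \<delta> \<le> v \<bullet> \<gamma>"
      using ex_maximizer[of ?L "\<lambda>\<delta>. v \<bullet> \<delta>"] by blast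
    then show ?thesis using that by blast
  qed
  obtain e0 where e0: "e0 \<in> \<Delta>" "e0 \<bullet> e0 = c" "e0 \<bullet> \<gamma> = 3 * c / 2"
  proof -
    obtain \<alpha> where "\<alpha> \<in> \<Delta>" "\<alpha> \<bullet> \<alpha> = c" using exs by blast
    then obtain f where f: "f \<in> \<Delta>" "f \<bullet> f = c" "f \<bullet> \<gamma> \<noteq> 0"
      using ex_nonorthogonal_of_length[OF _ \<gamma>(1)] by metis
    then show ?thesis using that[of f] that[of "- f"] ls[OF \<gamma> f(1,2)] neg[of f] by auto
  qed
  have e1: "\<gamma> - e0 \<in> \<Delta>" using reflect[OF \<gamma>(1) e0(1), of 1] e0 \<gamma> by (auto intro: diff_swap)
  have e1': "(\<gamma> - e0) \<bullet> (\<gamma> - e0) = c" "(\<gamma> - e0) \<bullet> \<gamma> = 3 * c / 2"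
    using e0 \<gamma> by (auto simp: inner_diff_left inner_diff_right inner_commute)
  \<comment> \<open>Of the two short roots that add up to \<open>\<gamma>\<close> the one with the
    larger value of \<open>v\<close> is kept, which makes \<open>v\<close> positive on
    \<open>\<alpha> = 2e - \<gamma>\<close>.\<close>
  obtain e where e: "e \<in> \<Delta>" "e \<bullet> e = c" "e \<bullet> \<gamma> = 3 * c / 2" and le: "v \<bullet> (\<gamma> - e) \<le> v \<bullet> e"
  proof (cases "v \<bullet> (\<gamma> - e0) \<le> v \<bullet> e0")
    case True
    then show ?thesis using that e0 by blast
  next
    case False
    then show ?thesis using that[OF e1 e1'] by (simp add: inner_diff_right)
  qed
  have ge: "\<gamma> \<bullet> e = 3 * c / 2" using e(3) by (simp add: inner_commute)
  note ip = inner_diff_left inner_diff_right inner_add_left inner_add_right e(2,3) ge \<gamma>(2)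
  have d1: "\<gamma> - e \<in> \<Delta>" using reflect[OF \<gamma>(1) e(1), of 1] ip by (auto intro: diff_swap)
  have d2: "\<gamma> - 3 *\<^sub>R e \<in> \<Delta>" using reflect[OF e(1) \<gamma>(1), of 3] ip by simp
  have "(\<gamma> - e) - 1 *\<^sub>R e \<in> \<Delta>" by (rule reflect[OF e(1) d1]) (simp add: ip)
  then have d3: "\<gamma> - 2 *\<^sub>R e \<in> \<Delta>" by (simp add: scaleR_2 algebra_simps)
  have d4: "3 *\<^sub>R e - \<gamma> \<in> \<Delta>" using diff_swap d2 by blast
  have "(3 *\<^sub>R e - \<gamma>) - 1 *\<^sub>R \<gamma> \<in> \<Delta>" by (rule reflect[OF \<gamma>(1) d4]) (simp add: ip)
  then have "3 *\<^sub>R e - 2 *\<^sub>R \<gamma> \<in> \<Delta>" by (simp add: scaleR_2 algebra_simps)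
  then have d5: "2 *\<^sub>R \<gamma> - 3 *\<^sub>R e \<in> \<Delta>" by (rule diff_swap)
  have d6: "2 *\<^sub>R e - \<gamma> \<in> \<Delta>" using diff_swap d3 by blast
  have n: "(\<gamma> - 3 *\<^sub>R e) \<bullet> (\<gamma> - 3 *\<^sub>R e) = 3 * c" "(2 *\<^sub>R \<gamma> - 3 *\<^sub>R e) \<bullet> (2 *\<^sub>R \<gamma> - 3 *\<^sub>R e) = 3 * c"
    "(3 *\<^sub>R e - \<gamma>) \<bullet> (3 *\<^sub>R e - \<gamma>) = 3 * c"
    "(\<gamma> - e) \<bullet> (\<gamma> - e) = c" "(\<gamma> - 2 *\<^sub>R e) \<bullet> (\<gamma> - 2 *\<^sub>R e) = c" by (simp_all add: ip)
  define \<alpha> \<beta> where "\<alpha> = 2 *\<^sub>R e - \<gamma>" and "\<beta> = 2 *\<^sub>R \<gamma> - 3 *\<^sub>R e"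
  define P where "P = {\<alpha>, \<beta>, \<alpha> + \<beta>, 2 *\<^sub>R \<alpha> + \<beta>, 3 *\<^sub>R \<alpha> + \<beta>, 3 *\<^sub>R \<alpha> + 2 *\<^sub>R \<beta>}"
  have scaleR_3: "3 *\<^sub>R x = x + x + x" for x :: 'a
    using scaleR_add_left[of 2 1 x] by (simp add: scaleR_2)
  have P: "P = {2 *\<^sub>R e - \<gamma>, 2 *\<^sub>R \<gamma> - 3 *\<^sub>R e, \<gamma> - e, e, 3 *\<^sub>R e - \<gamma>, \<gamma>}"
  proof -
    have "\<alpha> + \<beta> = \<gamma> - e" "2 *\<^sub>R \<alpha> + \<beta> = e" "3 *\<^sub>R \<alpha> + \<beta> = 3 *\<^sub>R e - \<gamma>" "3 *\<^sub>R \<alpha> + 2 *\<^sub>R \<beta> = \<gamma>"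
      by (simp_all add: \<alpha>_def \<beta>_def scaleR_2 scaleR_3 algebra_simps)
    then show ?thesis unfolding P_def by (simp only: \<alpha>_def \<beta>_def)
  qed
  have P\<Delta>: "P \<subseteq> \<Delta>" unfolding P using d1 d4 d5 d6 e(1) \<gamma>(1) by blast
  have va: "v \<bullet> \<alpha> > 0" using le regular[OF d6] by (simp add: \<alpha>_def inner_diff_right)
  have vb: "v \<bullet> \<beta> > 0" using max[OF d4 n(3)] regular[OF d5] by (simp add: \<beta>_def inner_diff_right)
  have vP: "v \<bullet> \<delta> > 0" if "\<delta> \<in> P" for \<delta>
    using that va vb by (auto simp: P_def inner_add_right)
  define D where "D = P \<union> uminus ` P"
  have D\<Delta>: "D \<subseteq> \<Delta>" using P\<Delta> neg by (auto simp: D_def)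
  have Dm: "\<delta> \<in> P \<Longrightarrow> \<delta> \<in> D" "\<delta> \<in> P \<Longrightarrow> - \<delta> \<in> D" for \<delta> by (auto simp: D_def)
  have PI: "2 *\<^sub>R e - \<gamma> \<in> P" "2 *\<^sub>R \<gamma> - 3 *\<^sub>R e \<in> P" "\<gamma> - e \<in> P" "e \<in> P" "3 *\<^sub>R e - \<gamma> \<in> P" "\<gamma> \<in> P"
    unfolding P by simp_all
  have short: "f \<in> D \<or> (f \<bullet> \<gamma> = 0 \<and> f \<bullet> e = 0)" if f: "f \<in> \<Delta>" "f \<bullet> f = c" for f
  proof -
    \<comment> \<open>The long roots \<open>\<gamma>\<close>, \<open>\<gamma> - 3e\<close> and their
      sum \<open>2\<gamma> - 3e\<close> admit only three inner products with \<open>f\<close> each.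
      Every pair \<open>(x, y)\<close> left over, apart from \<open>(0, 0)\<close>, makes the inner
      product of \<open>f\<close> with one of \<open>e\<close>, \<open>\<gamma> - e\<close>,
      \<open>\<gamma> - 2e\<close> equal to \<open>c\<close> or \<open>-c\<close>, and then
      \<open>f\<close> is that root up to sign.\<close>
    define x y where "x = f \<bullet> \<gamma>" and "y = f \<bullet> (\<gamma> - 3 *\<^sub>R e)"
    have x: "x = 0 \<or> x = 3 * c / 2 \<or> x = - (3 * c / 2)" using ls[OF \<gamma> f] by (simp add: x_def)
    have y: "y = 0 \<or> y = 3 * c / 2 \<or> y = - (3 * c / 2)" using ls[OF d2 n(1) f] by (simp add: y_def)
    have "f \<bullet> (2 *\<^sub>R \<gamma> - 3 *\<^sub>R e) = x + y" by (simp add: x_def y_def inner_diff_right)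
    then have z: "x + y = 0 \<or> x + y = 3 * c / 2 \<or> x + y = - (3 * c / 2)" using ls[OF d5 n(2) f] by simp
    have fe: "f \<bullet> e = (x - y) / 3" by (simp add: x_def y_def inner_diff_right)
    have f1: "f \<bullet> (\<gamma> - e) = x - (x - y) / 3" by (simp add: x_def[symmetric] fe inner_diff_right)
    have f2: "f \<bullet> (\<gamma> - 2 *\<^sub>R e) = x - 2 * ((x - y) / 3)" by (simp add: x_def[symmetric] fe inner_diff_right)
    have "(f \<bullet> \<gamma> = 0 \<and> f \<bullet> e = 0) \<or> f \<bullet> e = c \<or> f \<bullet> e = - c \<or> f \<bullet> (\<gamma> - e) = c \<or> f \<bullet> (\<gamma> - e) = - c
        \<or> f \<bullet> (\<gamma> - 2 *\<^sub>R e) = c \<or> f \<bullet> (\<gamma> - 2 *\<^sub>R e) = - c"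
      using x y z c unfolding fe f1 f2 x_def[symmetric] by (elim disjE) (auto simp: field_simps)
    then have "(f \<bullet> \<gamma> = 0 \<and> f \<bullet> e = 0) \<or> f = e \<or> f = - e \<or> f = \<gamma> - e \<or> f = - (\<gamma> - e)
        \<or> f = \<gamma> - 2 *\<^sub>R e \<or> f = - (\<gamma> - 2 *\<^sub>R e)"
      using eq_of_inner_eq[OF f(2)] eq_minus_of_inner_eq[OF f(2)] e(2) n(4,5) by blast
    moreover have "\<gamma> - 2 *\<^sub>R e = - (2 *\<^sub>R e - \<gamma>)" "- (\<gamma> - 2 *\<^sub>R e) = 2 *\<^sub>R e - \<gamma>" by simp_all
    ultimately show ?thesis using Dm PI by metis
  qed
  \<comment> \<open>The difference \<open>\<delta> - f\<close> is a short root with inner product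
    \<open>c / 2\<close> with \<open>f\<close>, hence not orthogonal to the plane of
    \<open>e\<close> and \<open>\<gamma>\<close>, and so belongs to \<open>D\<close>. Checking the
    candidates for it leaves two possibilities for \<open>\<delta>\<close>.\<close>
  have key: "\<delta> \<in> D" if \<delta>: "\<delta> \<in> \<Delta>" "\<delta> \<bullet> \<delta> = 3 * c" "f \<bullet> \<delta> = 3 * c / 2" "f = e \<or> f = \<gamma> - e" for \<delta> f
  proof -
    have f: "f \<in> \<Delta>" "f \<bullet> f = c" using \<delta>(4) e d1 n by auto
    have "f - 1 *\<^sub>R \<delta> \<in> \<Delta>" by (rule reflect[OF \<delta>(1) f(1)]) (simp add: \<delta>)
    then have g: "\<delta> - f \<in> \<Delta>" using diff_swap by simp
    have "(\<delta> - f) \<bullet> (\<delta> - f) = c" "(\<delta> - f) \<bullet> f = c / 2"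
      using \<delta>(2,3) f(2) by (auto simp: inner_diff_left inner_diff_right inner_commute)
    note g' = this
    have "\<delta> - f \<in> D" using short[OF g g'(1)] g'(2) \<delta>(4) c by (auto simp: inner_diff_right)
    then have "\<delta> - f \<in> {2 *\<^sub>R e - \<gamma>, 2 *\<^sub>R \<gamma> - 3 *\<^sub>R e, \<gamma> - e, e, 3 *\<^sub>R e - \<gamma>, \<gamma>,
        - (2 *\<^sub>R e - \<gamma>), - (2 *\<^sub>R \<gamma> - 3 *\<^sub>R e), - (\<gamma> - e), - e, - (3 *\<^sub>R e - \<gamma>), - \<gamma>}"
      unfolding D_def P by (simp only: image_insert image_empty Un_insert_left Un_empty_left)
    then obtain h where h: "\<delta> = f + h" "h \<bullet> f = c / 2" "h \<in> {2 *\<^sub>R e - \<gamma>, 2 *\<^sub>R \<gamma> - 3 *\<^sub>R e, \<gamma> - e, e, 3 *\<^sub>R e - \<gamma>, \<gamma>,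
        - (2 *\<^sub>R e - \<gamma>), - (2 *\<^sub>R \<gamma> - 3 *\<^sub>R e), - (\<gamma> - e), - e, - (3 *\<^sub>R e - \<gamma>), - \<gamma>}"
      using g'(2) by (intro that[of "\<delta> - f"]) (simp_all only: add_diff_cancel_left' add_diff_eq)
    from \<delta>(4) show ?thesis
    proof
      assume fe: "f = e"
      have "h = \<gamma> - e \<or> h = 2 *\<^sub>R e - \<gamma>"
        using h(2,3) c unfolding fe by (elim insertE emptyE) (simp_all add: ip)
      then have "\<delta> = \<gamma> \<or> \<delta> = 3 *\<^sub>R e - \<gamma>"
        using h(1) fe by (auto simp: scaleR_2 scaleR_3)
      then show ?thesis using Dm PI by metis
    next
      assume fe: "f = \<gamma> - e"
      have "h = e \<or> h = - (2 *\<^sub>R e - \<gamma>)"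
        using h(2,3) c unfolding fe by (elim insertE emptyE) (simp_all add: ip)
      moreover have "(\<gamma> - e) + - (2 *\<^sub>R e - \<gamma>) = 2 *\<^sub>R \<gamma> - 3 *\<^sub>R e"
        by (simp add: scaleR_2 scaleR_3)
      ultimately have "\<delta> = \<gamma> \<or> \<delta> = 2 *\<^sub>R \<gamma> - 3 *\<^sub>R e"
        using h(1) fe by auto
      then show ?thesis using Dm PI by metis
    qed
  qed
  have Dneg: "- \<delta> \<in> D \<longleftrightarrow> \<delta> \<in> D" for \<delta> by (force simp: D_def)
  have key': "\<delta> \<in> D" if \<delta>: "\<delta> \<in> \<Delta>" "\<delta> \<bullet> \<delta> = 3 * c" "f \<bullet> \<delta> \<noteq> 0" "f = e \<or> f = \<gamma> - e" for \<delta> f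
  proof -
    have "f \<in> \<Delta>" "f \<bullet> f = c" using \<delta>(4) e d1 n by auto
    then consider "f \<bullet> \<delta> = 3 * c / 2" | "f \<bullet> (- \<delta>) = 3 * c / 2"
      using ls[OF \<delta>(1,2), of f] \<delta>(3) by auto
    then show ?thesis
    proof cases
      case 1
      then show ?thesis by (rule key[OF \<delta>(1,2) _ \<delta>(4)])
    next
      case 2
      then have "- \<delta> \<in> D" using \<delta>(2) by (intro key[OF neg[OF \<delta>(1)] _ _ \<delta>(4)]) simp_all
      then show ?thesis by (simp only: Dneg)
    qed
  qed
  have "D = \<Delta>"
  proof (rule irreducible_eq[OF D\<Delta>])
    show "D \<noteq> {}" using Dm PI by blast
    fix \<beta>' \<delta> assume b: "\<beta>' \<in> D" and \<delta>: "\<delta> \<in> \<Delta>" "\<delta> \<notin> D"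
    have "\<delta> \<bullet> \<gamma> = 0 \<and> \<delta> \<bullet> e = 0"
    proof (cases "\<delta> \<bullet> \<delta> = c")
      case True
      then show ?thesis using short \<delta> by blast
    next
      case False
      then have l: "\<delta> \<bullet> \<delta> = 3 * c" using lengths \<delta> by blast
      have "e \<bullet> \<delta> = 0" "(\<gamma> - e) \<bullet> \<delta> = 0" using key'[OF \<delta>(1) l] \<delta>(2) by blast+
      then show ?thesis by (simp add: inner_diff_right inner_commute[of _ \<delta>])
    qed
    then have "\<gamma> \<bullet> \<delta> = 0" "e \<bullet> \<delta> = 0" by (simp_all add: inner_commute)
    then have "\<zeta> \<bullet> \<delta> = 0" if "\<zeta> \<in> P" for \<zeta>
      using that unfolding P by (elim insertE emptyE) (simp_all add: inner_diff_left)
    then show "\<beta>' \<bullet> \<delta> = 0" using b unfolding D_def by auto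
  qed
  have "pos = P"
  proof (intro equalityI subsetI)
    fix \<delta> assume \<delta>: "\<delta> \<in> pos"
    then have "\<delta> \<in> D" "v \<bullet> \<delta> > 0" using \<open>D = \<Delta>\<close> by (auto simp: pos_def)
    then show "\<delta> \<in> P" using vP by (force simp: D_def)
  next
    fix \<delta> assume "\<delta> \<in> P"
    then show "\<delta> \<in> pos" using vP P\<Delta> by (auto simp: pos_def)
  qed
  moreover have "\<alpha> \<bullet> \<alpha> = c" "\<beta> \<bullet> \<beta> = 3 * c" "\<alpha> \<bullet> \<beta> = - 3 * c / 2"
    by (simp_all add: \<alpha>_def \<beta>_def ip)
  ultimately show ?thesis
    unfolding product_formula_def using antichain_product_G2[OF c _ _ _ P_def P\<Delta> lengths] by simp
qed

end

section \<open>Length ratio two: orthogonal frames of short roots\<close>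

locale double_system = irreducible_system \<Delta> v for \<Delta> :: "'a::euclidean_space set" and v +
  fixes c :: real
  assumes c_pos: "c > 0" and lengths: "\<And>\<beta>. \<beta> \<in> \<Delta> \<Longrightarrow> \<beta> \<bullet> \<beta> = c \<or> \<beta> \<bullet> \<beta> = 2 * c"
    and ex_short: "\<exists>\<beta>\<in>\<Delta>. \<beta> \<bullet> \<beta> = c" and ex_long: "\<exists>\<beta>\<in>\<Delta>. \<beta> \<bullet> \<beta> = 2 * c"
begin

definition short :: "'a set" where "short = {\<beta> \<in> \<Delta>. \<beta> \<bullet> \<beta> = c}"
definition long :: "'a set" where "long = {\<beta> \<in> \<Delta>. \<beta> \<bullet> \<beta> = 2 * c}"

lemma shortD: "e \<in> short \<Longrightarrow> e \<in> \<Delta>" "e \<in> short \<Longrightarrow> e \<bullet> e = c"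
  and longD: "e \<in> long \<Longrightarrow> e \<in> \<Delta>" "e \<in> long \<Longrightarrow> e \<bullet> e = 2 * c"
  by (auto simp: short_def long_def)

lemma neg_short [simp]: "- e \<in> short \<longleftrightarrow> e \<in> short"
  and neg_long [simp]: "- e \<in> long \<longleftrightarrow> e \<in> long"
  by (auto simp: short_def long_def neg_iff)

lemma short_or_long: "\<beta> \<in> \<Delta> \<Longrightarrow> \<beta> \<in> short \<or> \<beta> \<in> long"
  using lengths by (auto simp: short_def long_def)

lemma inner_short_long:
  assumes "e \<in> short" "\<gamma> \<in> long"
  shows "e \<bullet> \<gamma> = 0 \<or> e \<bullet> \<gamma> = c \<or> e \<bullet> \<gamma> = - c"
proof -
  define x where "x = 2 * (e \<bullet> \<gamma>) / (2 * c)"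
  have x: "x \<in> \<int>" using cartan_Ints[of \<gamma> e] assms by (simp add: x_def short_def long_def)
  have e: "e \<bullet> \<gamma> = x * c" using c_pos by (simp add: x_def)
  have "(e \<bullet> \<gamma>)\<^sup>2 \<le> c * (2 * c)"
    using Cauchy_Schwarz_ineq[of e \<gamma>] assms by (simp add: short_def long_def)
  then have "(x * x) * (c * c) \<le> 2 * (c * c)"
    unfolding e by (simp add: power2_eq_square algebra_simps)
  then have "x * x \<le> 2" using c_pos mult_le_cancel_right_pos[of "c * c" "x * x" 2] by simp
  then have "x = 0 \<or> x = 1 \<or> x = -1" using Ints_square_less_4[OF x] by simp
  then show ?thesis using e by auto
qed

lemma inner_same_length:
  assumes "\<alpha> \<in> \<Delta>" "\<beta> \<in> \<Delta>" "\<alpha> \<bullet> \<alpha> = d" "\<beta> \<bullet> \<beta> = d"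
  shows "\<alpha> \<bullet> \<beta> = 0 \<or> \<alpha> \<bullet> \<beta> = d / 2 \<or> \<alpha> \<bullet> \<beta> = - d / 2 \<or> \<alpha> = \<beta> \<or> \<alpha> = - \<beta>"
proof -
  have d: "d > 0" using norm_pos assms by auto
  define x where "x = 2 * (\<alpha> \<bullet> \<beta>) / d"
  have x: "x \<in> \<int>" using cartan_Ints[of \<beta> \<alpha>] assms by (simp add: x_def)
  have e: "\<alpha> \<bullet> \<beta> = x * d / 2" using d by (simp add: x_def)
  have "(\<alpha> \<bullet> \<beta>)\<^sup>2 \<le> d * d"
    using Cauchy_Schwarz_ineq[of \<alpha> \<beta>] assms by simp
  then have "(x * x) * (d * d) \<le> 4 * (d * d)"
    unfolding e by (simp add: power2_eq_square algebra_simps)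
  then have "x * x \<le> 4" using d mult_le_cancel_right_pos[of "d * d" "x * x" 4] by simp
  then have "x = 0 \<or> x = 1 \<or> x = -1 \<or> x = 2 \<or> x = -2" using Ints_square_le_4[OF x] by simp
  then show ?thesis
    using e eq_of_inner_eq[OF assms(3,4)] eq_minus_of_inner_eq[OF assms(3,4)] by auto
qed

lemma inner_short:
  "e \<in> short \<Longrightarrow> f \<in> short \<Longrightarrow> e \<bullet> f = 0 \<or> e \<bullet> f = c / 2 \<or> e \<bullet> f = - c / 2 \<or> e = f \<or> e = - f"
  using inner_same_length[of e f c] by (auto simp: short_def)

lemma inner_long:
  "e \<in> long \<Longrightarrow> f \<in> long \<Longrightarrow> e \<bullet> f = 0 \<or> e \<bullet> f = c \<or> e \<bullet> f = - c \<or> e = f \<or> e = - f"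
  using inner_same_length[of e f "2 * c"] by (auto simp: long_def)

lemma reflect_short: "e \<in> short \<Longrightarrow> \<beta> \<in> \<Delta> \<Longrightarrow> 2 * (\<beta> \<bullet> e) = k * c \<Longrightarrow> \<beta> - k *\<^sub>R e \<in> \<Delta>"
  by (rule reflect) (auto simp: short_def)

lemma reflect_long: "\<gamma> \<in> long \<Longrightarrow> \<beta> \<in> \<Delta> \<Longrightarrow> \<beta> \<bullet> \<gamma> = k * c \<Longrightarrow> \<beta> - k *\<^sub>R \<gamma> \<in> \<Delta>"
  by (rule reflect) (auto simp: long_def)

text \<open>In the standard coordinates, a frame is up to signs the standard basis in type B, one of three
  orthogonal bases in type \<open>F\<^sub>4\<close>, and a pair \<open>e\<^sub>i - e\<^sub>j, e\<^sub>i + e\<^sub>j\<close> in type C.\<close>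

definition frame :: "'a set \<Rightarrow> bool" where
  "frame E \<longleftrightarrow> E \<subseteq> short \<and> (\<forall>f\<in>E. v \<bullet> f > 0) \<and>
     (\<forall>f\<in>E. \<forall>g\<in>E. f \<noteq> g \<longrightarrow> f \<bullet> g = 0 \<and> f + g \<in> \<Delta> \<and> f - g \<in> \<Delta>) \<and>
     (\<forall>\<gamma>\<in>long. \<forall>f\<in>E. \<gamma> \<bullet> f \<noteq> 0 \<longrightarrow>
        (\<exists>g\<in>E. g \<noteq> f \<and> (\<gamma> = f + g \<or> \<gamma> = f - g \<or> \<gamma> = - f + g \<or> \<gamma> = - f - g)))"

lemma orthogonal_add_long:
  assumes "e \<in> short" "f \<in> short" "e \<bullet> f = 0" "e + f \<in> \<Delta>"
  shows "e + f \<in> long" "e - f \<in> \<Delta>" "e - f \<in> long"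
proof -
  show "e + f \<in> long" using assms by (auto simp: short_def long_def inner_add_left inner_add_right inner_commute)
  have "(e + f) - 2 *\<^sub>R f \<in> \<Delta>"
    by (rule reflect_short[OF assms(2,4)]) (use assms in \<open>auto simp: short_def inner_add_left\<close>)
  then show "e - f \<in> \<Delta>" by (simp add: scaleR_2)
  then show "e - f \<in> long" using assms by (auto simp: short_def long_def inner_diff_left inner_diff_right inner_commute)
qed

lemma long_minus_short:
  assumes "e \<in> short" "\<gamma> \<in> long" "\<gamma> \<bullet> e = c"
  shows "\<gamma> - e \<in> short" "(\<gamma> - e) \<bullet> e = 0"
proof -
  have "e - 1 *\<^sub>R \<gamma> \<in> \<Delta>" by (rule reflect_long) (use assms in \<open>auto simp: short_def inner_commute\<close>)
  then have "\<gamma> - e \<in> \<Delta>" using diff_swap by simp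
  then show "\<gamma> - e \<in> short" "(\<gamma> - e) \<bullet> e = 0"
    using assms by (auto simp: short_def long_def inner_diff_left inner_diff_right inner_commute)
qed

text \<open>The frame consists of \<open>e\<close> and the positive short roots linked to it. The
  reflections below show that these are linked to each other and that every long root meeting one of
  them is a signed sum of two.\<close>

lemma frame_exists:
  assumes e: "e \<in> short" "v \<bullet> e > 0"
  shows "\<exists>E. frame E \<and> e \<in> E"
proof -
  define N where "N = {f \<in> short. v \<bullet> f > 0 \<and> e \<bullet> f = 0 \<and> e + f \<in> \<Delta>}"
  have ND: "f \<in> short" "v \<bullet> f > 0" "e \<bullet> f = 0" "e + f \<in> \<Delta>" "e + f \<in> long" "e - f \<in> \<Delta>" "f \<bullet> e = 0" "f \<noteq> e"
    if "f \<in> N" for f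
    using that orthogonal_add_long[of e f] e c_pos by (auto simp: N_def inner_commute short_def)
  have NI: "\<exists>g\<in>N. f = g \<or> f = - g" if "f \<in> short" "e \<bullet> f = 0" "e + f \<in> \<Delta>" for f
  proof (cases "v \<bullet> f > 0")
    case True
    then show ?thesis using that by (auto simp: N_def)
  next
    case False
    then have "v \<bullet> (- f) > 0" using regular[of f] that by (auto simp: short_def)
    then have "- f \<in> N" using that orthogonal_add_long[OF e(1) that] by (auto simp: N_def)
    then show ?thesis by (intro bexI[of _ "- f"]) auto
  qed
  \<comment> \<open>The long roots \<open>e + f\<close> and \<open>e + g\<close> have inner product
    \<open>c + f \<bullet> g\<close>, which must be 0, \<open>c\<close> or \<open>-c\<close>. Since
    \<open>f \<bullet> g\<close> is 0 or half of \<open>c\<close> up to sign, it vanishes, and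
    reflecting \<open>e + f\<close> in \<open>e + g\<close> gives \<open>f - g\<close>.\<close>
  have NN: "f \<bullet> g = 0 \<and> f + g \<in> \<Delta> \<and> f - g \<in> \<Delta>" if f: "f \<in> N" and g: "g \<in> N" and "f \<noteq> g" for f g
  proof -
    have "f \<noteq> - g" using ND(2)[OF f] ND(2)[OF g] by auto
    have "(e + f) \<bullet> (e + g) = c + f \<bullet> g"
      using ND(3,7)[OF f] ND(3,7)[OF g] e by (simp add: inner_add_left inner_add_right short_def)
    moreover have "e + f \<noteq> - (e + g)" using e(2) ND(2)[OF f] ND(2)[OF g]
      by (metis add_pos_pos inner_add_right inner_minus_right less_asym neg_less_0_iff_less)
    ultimately have "f \<bullet> g = 0"
      using inner_long[OF ND(5)[OF f] ND(5)[OF g]] inner_short[OF ND(1)[OF f] ND(1)[OF g]] \<open>f \<noteq> g\<close> \<open>f \<noteq> - g\<close> c_pos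
      by auto
    then have "(e + f) - 1 *\<^sub>R (e + g) \<in> \<Delta>"
      using \<open>(e + f) \<bullet> (e + g) = c + f \<bullet> g\<close> by (intro reflect_long[OF ND(5)[OF g] ND(4)[OF f]]) simp
    then have "f - g \<in> \<Delta>" by simp
    moreover have "f + g \<in> \<Delta>"
      using orthogonal_add_long(2)[of f "- g"] ND(1)[OF f] ND(1)[OF g] \<open>f \<bullet> g = 0\<close> \<open>f - g \<in> \<Delta>\<close> by simp
    ultimately show ?thesis using \<open>f \<bullet> g = 0\<close> by simp
  qed
  have Le: "\<exists>g\<in>N. \<gamma> = e + g \<or> \<gamma> = e - g" if \<gamma>: "\<gamma> \<in> long" "\<gamma> \<bullet> e = c" for \<gamma>
  proof -
    have "\<exists>g\<in>N. \<gamma> - e = g \<or> \<gamma> - e = - g"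
      using long_minus_short[OF e(1) \<gamma>] longD(1)[OF \<gamma>(1)] by (intro NI) (auto simp: inner_commute)
    then show ?thesis by (metis add.commute diff_add_cancel uminus_add_conv_diff)
  qed
  \<comment> \<open>A long root orthogonal to \<open>e\<close> is brought back to \<open>e\<close>:
    reflecting \<open>e + f\<close> in \<open>\<gamma>\<close> gives
    \<open>e - (\<gamma> - f)\<close>, so the short root \<open>\<gamma> - f\<close> is linked to
    \<open>e\<close>.\<close>
  have Lf: "\<exists>g\<in>N. g \<noteq> f \<and> (\<gamma> = f + g \<or> \<gamma> = f - g)"
    if \<gamma>: "\<gamma> \<in> long" "\<gamma> \<bullet> e = 0" "\<gamma> \<bullet> f = c" and f: "f \<in> N" for \<gamma> f
  proof -
    define g where "g = \<gamma> - f"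
    have g: "g \<in> short" "g \<bullet> f = 0" using long_minus_short[OF ND(1)[OF f] \<gamma>(1,3)] by (auto simp: g_def)
    have ge: "e \<bullet> g = 0" using \<gamma>(2) ND(3)[OF f] by (simp add: g_def inner_diff_right inner_commute[of e \<gamma>])
    have "(e + f) - 1 *\<^sub>R \<gamma> \<in> \<Delta>"
      by (rule reflect_long[OF \<gamma>(1) ND(4)[OF f]]) (use \<gamma> in \<open>simp add: inner_add_right inner_commute[of _ \<gamma>]\<close>)
    then have "e + - g \<in> \<Delta>" by (simp add: g_def algebra_simps)
    then obtain h where h: "h \<in> N" "- g = h \<or> - g = - h" using NI[of "- g"] g ge by auto
    then have "h \<noteq> f" using g ND(1)[OF f] c_pos by (auto simp: short_def)
    moreover have "\<gamma> = f + h \<or> \<gamma> = f - h" using h(2) by (auto simp: g_def algebra_simps)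
    ultimately show ?thesis using h(1) by blast
  qed
  have "frame (insert e N)"
    unfolding frame_def
  proof (intro conjI ballI impI)
    show "insert e N \<subseteq> short" using e ND(1) by auto
    show "v \<bullet> f > 0" if "f \<in> insert e N" for f using that e ND(2) by auto
    fix f g assume fg: "f \<in> insert e N" "g \<in> insert e N" "f \<noteq> g"
    show "f \<bullet> g = 0" using fg ND(3,7) NN by auto
    show "f + g \<in> \<Delta>" using fg ND(4) NN by (metis add.commute insert_iff)
    show "f - g \<in> \<Delta>" using fg ND(6) NN by (auto intro: diff_swap)
  next
    fix \<gamma> f assume \<gamma>: "\<gamma> \<in> long" and f: "f \<in> insert e N" and nz: "\<gamma> \<bullet> f \<noteq> 0"
    have pm: "\<gamma> \<bullet> h = 0 \<or> \<gamma> \<bullet> h = c \<or> (- \<gamma>) \<bullet> h = c" if "h \<in> short" for h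
      using inner_short_long[OF that \<gamma>] by (auto simp: inner_commute)
    have ex: "\<exists>g\<in>N. \<gamma> = e + g \<or> \<gamma> = e - g \<or> \<gamma> = - e + g \<or> \<gamma> = - e - g" if ne: "\<gamma> \<bullet> e \<noteq> 0"
    proof -
      consider "\<gamma> \<bullet> e = c" | "(- \<gamma>) \<bullet> e = c" using pm[OF e(1)] ne by auto
      then show ?thesis
      proof cases
        case 1
        then show ?thesis using Le[OF \<gamma>] by blast
      next
        case 2
        then obtain g where "g \<in> N" "- \<gamma> = e + g \<or> - \<gamma> = e - g" using Le[of "- \<gamma>"] \<gamma> by auto
        then show ?thesis by (intro bexI[of _ g]) (auto simp: minus_equation_iff[of \<gamma>])
      qed
    qed
    show "\<exists>g\<in>insert e N. g \<noteq> f \<and> (\<gamma> = f + g \<or> \<gamma> = f - g \<or> \<gamma> = - f + g \<or> \<gamma> = - f - g)"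
    proof (cases "f = e")
      case True
      then show ?thesis using ex nz ND(8) by blast
    next
      case False
      then have fN: "f \<in> N" using f by blast
      show ?thesis
      proof (cases "\<gamma> \<bullet> e = 0")
        case True
        consider "\<gamma> \<bullet> f = c" | "(- \<gamma>) \<bullet> f = c" using pm[OF ND(1)[OF fN]] nz by auto
        then show ?thesis
        proof cases
          case 1
          then show ?thesis using Lf[OF \<gamma> True _ fN] by blast
        next
          case 2
          then obtain g where "g \<in> N" "g \<noteq> f" "- \<gamma> = f + g \<or> - \<gamma> = f - g"
            using Lf[of "- \<gamma>" f] \<gamma> True fN by auto
          then show ?thesis by (intro bexI[of _ g]) (auto simp: minus_equation_iff[of \<gamma>])
        qed
      next
        case ne: False
        then obtain g where g: "g \<in> N" "\<gamma> = e + g \<or> \<gamma> = e - g \<or> \<gamma> = - e + g \<or> \<gamma> = - e - g"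
          using ex by blast
        have "g = f"
        proof (rule ccontr)
          assume "g \<noteq> f"
          then have "g \<bullet> f = 0" using NN[OF g(1) fN] by blast
          then show False using nz g(2) ND(3)[OF fN] by (auto simp: inner_add_left inner_diff_left)
        qed
        then show ?thesis using g(2) ND(8)[OF fN] by (intro bexI[of _ e]) (auto simp: add.commute)
      qed
    qed
  qed
  then show ?thesis by blast
qed

lemma frameD:
  assumes "frame E"
  shows "\<And>f. f \<in> E \<Longrightarrow> f \<in> short" "\<And>f. f \<in> E \<Longrightarrow> v \<bullet> f > 0"
    "\<And>f g. f \<in> E \<Longrightarrow> g \<in> E \<Longrightarrow> f \<noteq> g \<Longrightarrow> f \<bullet> g = 0"
    "\<And>f g. f \<in> E \<Longrightarrow> g \<in> E \<Longrightarrow> f \<noteq> g \<Longrightarrow> f + g \<in> long"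
    "\<And>f g. f \<in> E \<Longrightarrow> g \<in> E \<Longrightarrow> f \<noteq> g \<Longrightarrow> f - g \<in> long"
    "finite E" "\<And>f. f \<in> E \<Longrightarrow> f \<bullet> f = c" "\<And>f. f \<in> E \<Longrightarrow> - f \<notin> E"
proof -
  show "f \<in> short" "v \<bullet> f > 0" if "f \<in> E" for f using assms that by (auto simp: frame_def)
  note sv = this
  show "f \<bullet> f = c" if "f \<in> E" for f using sv(1)[OF that] by (simp add: short_def)
  show "- f \<notin> E" if "f \<in> E" for f using sv(2)[OF that] sv(2)[of "- f"] by auto
  show "f \<bullet> g = 0" "f + g \<in> long" "f - g \<in> long" if "f \<in> E" "g \<in> E" "f \<noteq> g" for f g
  proof -
    have "f \<in> short" "g \<in> short" "f \<bullet> g = 0" "f + g \<in> \<Delta>" using assms that unfolding frame_def by blast+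
    then show "f \<bullet> g = 0" "f + g \<in> long" "f - g \<in> long" using orthogonal_add_long by auto
  qed
  show "finite E" using assms fin unfolding frame_def by (auto simp: short_def intro: finite_subset)
qed

lemma frame_long:
  assumes "frame E" "\<gamma> \<in> long" "f \<in> E" "\<gamma> \<bullet> f \<noteq> 0"
  obtains g where "g \<in> E" "g \<noteq> f" "\<gamma> = f + g \<or> \<gamma> = f - g \<or> \<gamma> = - f + g \<or> \<gamma> = - f - g"
  using assms unfolding frame_def by blast

end

section \<open>Recognising types B and C\<close>

context double_system begin

text \<open>Differences are roots, so \<open>v\<close> separates the elements of \<open>E\<close>.
  In this numbering \<open>e i - e j\<close> is positive for \<open>i < j\<close>, as in the
  standard positive systems.\<close>

lemma ordered_frame:
  assumes "finite E" "\<And>f g. f \<in> E \<Longrightarrow> g \<in> E \<Longrightarrow> f \<noteq> g \<Longrightarrow> f - g \<in> \<Delta>"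
  obtains e where "e ` {..<card E} = E" "\<And>i j. i < j \<Longrightarrow> j < card E \<Longrightarrow> v \<bullet> e j < v \<bullet> e i"
proof -
  have "inj_on (\<lambda>f. v \<bullet> f) E"
  proof (rule inj_onI, rule ccontr)
    fix f g assume "f \<in> E" "g \<in> E" "v \<bullet> f = v \<bullet> g" "f \<noteq> g"
    then show False using regular[OF assms(2)] by (auto simp: inner_diff_right)
  qed
  then show ?thesis using decreasing_enumeration[OF assms(1), of "\<lambda>f. v \<bullet> f"] that by blast
qed

text \<open>Type B: under \<open>orth\<close> every root that meets \<open>E\<close> is a signed
  element of \<open>E\<close> or a signed sum of two. A root meeting no element of \<open>E\<close>
  is orthogonal to all of these, so irreducibility excludes it.\<close>

lemma product_formula_single_frame:
  assumes E: "frame E" and fg: "f0 \<in> E" "g0 \<in> E" "f0 \<noteq> g0"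
    and orth: "\<And>g f. g \<in> short \<Longrightarrow> g \<notin> E \<Longrightarrow> - g \<notin> E \<Longrightarrow> f \<in> E \<Longrightarrow> g \<bullet> f = 0"
  shows product_formula
proof -
  note FD = frameD[OF E]
  have all: "(\<exists>f\<in>E. x = f \<or> x = - f) \<or>
      (\<exists>f\<in>E. \<exists>g\<in>E. f \<noteq> g \<and> (x = f + g \<or> x = f - g \<or> x = - f + g \<or> x = - f - g))"
    if x: "x \<in> \<Delta>" "f \<in> E" "x \<bullet> f \<noteq> 0" for x f
  proof (cases "x \<in> long")
    case True
    then show ?thesis using frame_long[OF E True x(2,3)] x(2) by metis
  next
    case False
    then have "x \<in> E \<or> - x \<in> E" using short_or_long[OF x(1)] orth x(2,3) by blast
    then show ?thesis by (metis minus_minus)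
  qed
  define D where "D = {x \<in> \<Delta>. \<exists>f\<in>E. x \<bullet> f \<noteq> 0}"
  have "D = \<Delta>"
  proof (rule irreducible_eq)
    have "f0 \<in> D" using fg FD(1,7)[OF fg(1)] c_pos by (auto simp: D_def short_def intro!: bexI[of _ f0])
    then show "D \<noteq> {}" by blast
    fix \<beta> \<delta> assume "\<beta> \<in> D" and \<delta>: "\<delta> \<in> \<Delta>" "\<delta> \<notin> D"
    then obtain f where f: "\<beta> \<in> \<Delta>" "f \<in> E" "\<beta> \<bullet> f \<noteq> 0" by (auto simp: D_def)
    have d: "h \<bullet> \<delta> = 0" if "h \<in> E" for h using \<delta> that by (auto simp: D_def inner_commute)
    from all[OF f] show "\<beta> \<bullet> \<delta> = 0"
      using d by (auto simp: inner_add_left inner_diff_left)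
  qed (auto simp: D_def)
  then have roots: "(\<exists>f\<in>E. x = f \<or> x = - f) \<or>
      (\<exists>f\<in>E. \<exists>g\<in>E. f \<noteq> g \<and> (x = f + g \<or> x = f - g \<or> x = - f + g \<or> x = - f - g))" if "x \<in> \<Delta>" for x
    using all that by (auto simp: D_def)
  obtain e where e: "e ` {..<card E} = E" and dec: "\<And>i j. i < j \<Longrightarrow> j < card E \<Longrightarrow> v \<bullet> e j < v \<bullet> e i"
    using ordered_frame[OF FD(6)] FD(5) longD(1) by metis
  define m where "m = card E - 1"
  have "card {f0, g0} \<le> card E" using fg FD(6) by (intro card_mono) auto
  then have m: "card E = Suc m" "m \<ge> 1" using fg(3) by (auto simp: m_def)
  have eE: "e i \<in> E" if "i \<le> m" for i using e m that by (auto simp: less_Suc_eq_le)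
  have eI: "\<exists>i\<le>m. f = e i" if "f \<in> E" for f using e m that by (auto simp: less_Suc_eq_le)
  have ne: "e i \<noteq> e j" if "i \<noteq> j" "i \<le> m" "j \<le> m" for i j
    using that dec[of i j] dec[of j i] m by (auto simp: less_Suc_eq_le neq_iff)
  interpret orthogonal_family e m c
    using c_pos FD(3,7) eE ne by unfold_locales auto
  have vpos: "v \<bullet> e i > 0" if "i \<le> m" for i using FD(2) eE[OF that] by blast
  have "pos_B \<subseteq> pos"
  proof
    fix \<beta> assume "\<beta> \<in> pos_B"
    then consider i where "i \<le> m" "\<beta> = e i" | i j where "i < j" "j \<le> m" "\<beta> = e i - e j"
      | i j where "i < j" "j \<le> m" "\<beta> = e i + e j"
      by (auto simp: pos_B_def)
    then show "\<beta> \<in> pos"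
    proof cases
      case 1
      then show ?thesis using FD(1)[OF eE[of i]] vpos by (auto simp: pos_def short_def)
    next
      case 2
      then have "e i \<noteq> e j" "e i \<in> E" "e j \<in> E" using ne eE by auto
      then have "\<beta> \<in> \<Delta>" using FD(5) longD(1) 2 by blast
      then show ?thesis using dec[of i j] 2 m by (auto simp: pos_def inner_diff_right)
    next
      case 3
      then have "e i \<noteq> e j" "e i \<in> E" "e j \<in> E" using ne eE by auto
      then have "\<beta> \<in> \<Delta>" using FD(4) longD(1) 3 by blast
      then show ?thesis using vpos[of i] vpos[of j] 3 by (auto simp: pos_def inner_add_right)
    qed
  qed
  moreover have "pos \<subseteq> pos_B"
  proof
    fix \<beta> assume "\<beta> \<in> pos"
    then have \<beta>: "\<beta> \<in> \<Delta>" "v \<bullet> \<beta> > 0" by (auto simp: pos_def)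
    from roots[OF \<beta>(1)] consider f where "f \<in> E" "\<beta> = f \<or> \<beta> = - f"
      | f g where "f \<in> E" "g \<in> E" "f \<noteq> g" "\<beta> = f + g \<or> \<beta> = f - g \<or> \<beta> = - f + g \<or> \<beta> = - f - g"
      by blast
    then show "\<beta> \<in> pos_B"
    proof cases
      case 1
      then show ?thesis using \<beta>(2) FD(2)[OF 1(1)] eI[OF 1(1)] by (auto simp: pos_B_def)
    next
      case 2
      obtain i j where ij: "i \<le> m" "j \<le> m" "f = e i" "g = e j" using eI 2(1,2) by blast
      then have "i \<noteq> j" using 2(3) by blast
      have "\<beta> \<noteq> - f - g" using \<beta>(2) vpos[of i] vpos[of j] ij by (auto simp: inner_diff_right)
      then consider "\<beta> = e i + e j" | "\<beta> = e i - e j" | "\<beta> = e j - e i"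
        using 2(4) ij by auto
      then show ?thesis
      proof cases
        case 1
        then show ?thesis using pos_B_I(3)[of i j] pos_B_I(3)[of j i] ij \<open>i \<noteq> j\<close>
          by (cases "i < j") (auto simp: add.commute)
      next
        case 2
        then have "i < j" using dec[of j i] \<beta>(2) \<open>i \<noteq> j\<close> ij m by (auto simp: inner_diff_right neq_iff)
        then show ?thesis using 2 pos_B_I(2) ij by simp
      next
        case 3
        then have "j < i" using dec[of i j] \<beta>(2) \<open>i \<noteq> j\<close> ij m by (auto simp: inner_diff_right neq_iff)
        then show ?thesis using 3 pos_B_I(2) ij by simp
      qed
    qed
  qed
  ultimately have pos: "pos = pos_B" by blast
  have "pos_B \<subseteq> \<Delta>" using pos by (auto simp: pos_def)
  then show ?thesis
    unfolding product_formula_def pos using antichain_product_B[OF _ m(2) lengths] by blast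
qed

text \<open>Type C, with \<open>E\<close> the halves of the positive long roots. A short root
  \<open>x\<close> meets some long root, which up to sign is a \<open>\<gamma>\<close> with inner
  product \<open>c\<close>; then \<open>\<gamma> - 2x\<close> is long too and \<open>x\<close> is
  half the difference of the two.\<close>

lemma product_formula_orthogonal_long:
  assumes orth: "\<And>\<gamma> \<delta>. \<gamma> \<in> long \<Longrightarrow> \<delta> \<in> long \<Longrightarrow> \<gamma> \<bullet> \<delta> = 0 \<or> \<gamma> = \<delta> \<or> \<gamma> = - \<delta>"
  shows product_formula
proof -
  define E where "E = {f. 2 *\<^sub>R f \<in> long \<and> v \<bullet> f > 0}"
  have ED: "2 *\<^sub>R f \<in> long" "v \<bullet> f > 0" "f \<bullet> f = c / 2" if "f \<in> E" for f
    using that longD(2)[of "2 *\<^sub>R f"] by (auto simp: E_def)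
  have EI: "\<exists>f\<in>E. \<gamma> = 2 *\<^sub>R f \<or> \<gamma> = - (2 *\<^sub>R f)" if "\<gamma> \<in> long" for \<gamma>
  proof (cases "v \<bullet> \<gamma> > 0")
    case True
    then show ?thesis using that by (intro bexI[of _ "(1 / 2) *\<^sub>R \<gamma>"]) (auto simp: E_def)
  next
    case False
    then have "v \<bullet> \<gamma> < 0" using regular[of \<gamma>] that by (auto simp: long_def)
    then show ?thesis using that by (intro bexI[of _ "- ((1 / 2) *\<^sub>R \<gamma>)"]) (auto simp: E_def)
  qed
  have Eorth: "f \<bullet> g = 0" if "f \<in> E" "g \<in> E" "f \<noteq> g" for f g
  proof -
    have "2 *\<^sub>R f \<noteq> - (2 *\<^sub>R g)"
    proof
      assume "2 *\<^sub>R f = - (2 *\<^sub>R g)"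
      then have "v \<bullet> (2 *\<^sub>R f) = v \<bullet> (- (2 *\<^sub>R g))" by simp
      then have "2 * (v \<bullet> f) = - (2 * (v \<bullet> g))" by simp
      then show False using ED(2)[OF that(1)] ED(2)[OF that(2)] by linarith
    qed
    then show ?thesis using orth[OF ED(1)[OF that(1)] ED(1)[OF that(2)]] that(3) by auto
  qed
  \<comment> \<open>The reflection in the long root \<open>2g\<close> changes the sign of
    \<open>g\<close>.\<close>
  have pm: "(f + g \<in> \<Delta>) = (f - g \<in> \<Delta>)" if fg: "f \<in> E" "g \<in> E" "f \<noteq> g" for f g
  proof
    note g = ED[OF fg(2)]
    have i: "f \<bullet> g = 0" by (rule Eorth[OF fg])
    {
      assume "f + g \<in> \<Delta>"
      then have "(f + g) - 1 *\<^sub>R (2 *\<^sub>R g) \<in> \<Delta>"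
        by (intro reflect_long[OF g(1)]) (use g i in \<open>simp_all add: inner_add_left\<close>)
      then show "f - g \<in> \<Delta>" by (simp add: scaleR_2)
    }
    {
      assume "f - g \<in> \<Delta>"
      then have "(f - g) - (- 1) *\<^sub>R (2 *\<^sub>R g) \<in> \<Delta>"
        by (intro reflect_long[OF g(1)]) (use g i in \<open>simp_all add: inner_diff_left\<close>)
      then show "f + g \<in> \<Delta>" by (simp add: scaleR_2)
    }
  qed
  have short_form: "\<exists>f\<in>E. \<exists>g\<in>E. f \<noteq> g \<and> (x = f + g \<or> x = f - g \<or> x = - f + g \<or> x = - f - g)"
    if x: "x \<in> short" for x
  proof -
    obtain \<gamma>0 where "\<gamma>0 \<in> \<Delta>" "\<gamma>0 \<bullet> \<gamma>0 = 2 * c" using ex_long by blast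
    then obtain \<gamma>1 where g1: "\<gamma>1 \<in> \<Delta>" "\<gamma>1 \<bullet> \<gamma>1 = 2 * c" "\<gamma>1 \<bullet> x \<noteq> 0"
      using ex_nonorthogonal_of_length[OF _ shortD(1)[OF x]] by metis
    obtain \<gamma> where \<gamma>: "\<gamma> \<in> long" "x \<bullet> \<gamma> = c"
    proof -
      have "\<gamma>1 \<in> long" using g1 by (simp add: long_def)
      then show ?thesis
        using inner_short_long[OF x, of \<gamma>1] g1(3) that[of \<gamma>1] that[of "- \<gamma>1"] by (auto simp: inner_commute)
    qed
    define \<delta> where "\<delta> = \<gamma> - 2 *\<^sub>R x"
    have "\<delta> \<in> \<Delta>" unfolding \<delta>_def
      by (rule reflect_short[OF x longD(1)[OF \<gamma>(1)]]) (use \<gamma>(2) in \<open>simp add: inner_commute\<close>)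
    moreover have "\<delta> \<bullet> \<delta> = 2 * c" "\<gamma> \<bullet> \<delta> = 0"
      using \<gamma> x by (auto simp: \<delta>_def short_def long_def inner_diff_left inner_diff_right inner_commute)
    ultimately have \<delta>: "\<delta> \<in> long" "\<gamma> \<bullet> \<delta> = 0" by (auto simp: long_def)
    obtain f where f: "f \<in> E" "\<gamma> = 2 *\<^sub>R f \<or> \<gamma> = - (2 *\<^sub>R f)" using EI[OF \<gamma>(1)] by blast
    obtain g where g: "g \<in> E" "\<delta> = 2 *\<^sub>R g \<or> \<delta> = - (2 *\<^sub>R g)" using EI[OF \<delta>(1)] by blast
    have "f \<noteq> g" using f g \<delta>(2) ED(3)[OF f(1)] c_pos by auto
    have "x = (1 / 2) *\<^sub>R \<gamma> - (1 / 2) *\<^sub>R \<delta>" by (simp add: \<delta>_def scaleR_diff_right)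
    then have "x = f + g \<or> x = f - g \<or> x = - f + g \<or> x = - f - g" using f(2) g(2) by auto
    then show ?thesis using f(1) g(1) \<open>f \<noteq> g\<close> by blast
  qed
  have sum_mem: "f + g \<in> \<Delta>"
    if fg: "f \<in> E" "g \<in> E" "f \<noteq> g" and x: "x \<in> \<Delta>" "x = f + g \<or> x = f - g \<or> x = - f + g \<or> x = - f - g" for f g x
  proof -
    have "- x \<in> \<Delta>" using x(1) by (rule neg)
    then have "f + g \<in> \<Delta> \<or> f - g \<in> \<Delta>" using x by (auto simp: add.commute)
    then show ?thesis using pm[OF fg] by blast
  qed
  obtain \<gamma>0 where "\<gamma>0 \<in> long" using ex_long by (auto simp: long_def)
  then obtain e0 where e0: "e0 \<in> E" using EI by blast
  \<comment> \<open>The class of \<open>e0\<close> when \<open>f\<close> and \<open>g\<close> are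
    joined if \<open>f + g\<close> is a root. This relation is transitive, since the reflection of
    \<open>e0 + f\<close> in \<open>f + g\<close> is \<open>e0 - g\<close>. Irreducibility turns
    \<open>X\<close> into all of \<open>E\<close>.\<close>
  define X where "X = {f \<in> E. f = e0 \<or> e0 + f \<in> \<Delta>}"
  have X_step: "g \<in> X" if "f \<in> X" "g \<in> E" "f \<noteq> g" "f + g \<in> \<Delta>" for f g
  proof (cases "f = e0 \<or> g = e0")
    case True
    then show ?thesis using that by (auto simp: X_def)
  next
    case False
    then have f: "f \<in> E" "e0 + f \<in> \<Delta>" "e0 \<noteq> f" "e0 \<noteq> g" using that by (auto simp: X_def)
    have i: "e0 \<bullet> f = 0" "e0 \<bullet> g = 0" "f \<bullet> g = 0" "f \<bullet> e0 = 0" "g \<bullet> e0 = 0" "g \<bullet> f = 0"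
      using Eorth e0 f that by (auto simp: inner_commute)
    have "f + g \<in> short"
      using that ED(3)[OF f(1)] ED(3)[OF that(2)] i by (auto simp: short_def inner_add_left inner_add_right)
    then have "(e0 + f) - 1 *\<^sub>R (f + g) \<in> \<Delta>"
      by (rule reflect_short[OF _ f(2)]) (use i ED(3)[OF f(1)] in \<open>simp add: inner_add_left inner_add_right\<close>)
    then have "e0 - g \<in> \<Delta>" by simp
    then show ?thesis using pm[OF e0 that(2) f(4)] that(2) by (auto simp: X_def)
  qed
  define D where "D = {\<beta> \<in> \<Delta>. \<exists>f\<in>X. \<beta> \<bullet> f \<noteq> 0}"
  have "D = \<Delta>"
  proof (rule irreducible_eq)
    have "2 *\<^sub>R e0 \<in> D" using e0 ED(1,3)[OF e0] c_pos
      by (auto simp: D_def X_def long_def intro!: bexI[of _ e0])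
    then show "D \<noteq> {}" by blast
    fix \<beta> \<delta> assume "\<beta> \<in> D" and \<delta>: "\<delta> \<in> \<Delta>" "\<delta> \<notin> D"
    then obtain f where f: "\<beta> \<in> \<Delta>" "f \<in> X" "\<beta> \<bullet> f \<noteq> 0" by (auto simp: D_def)
    have fE: "f \<in> E" using f(2) by (simp add: X_def)
    have d: "h \<bullet> \<delta> = 0" if "h \<in> X" for h using \<delta> that by (auto simp: D_def inner_commute)
    from short_or_long[OF f(1)] show "\<beta> \<bullet> \<delta> = 0"
    proof
      assume "\<beta> \<in> long"
      then obtain g where g: "g \<in> E" "\<beta> = 2 *\<^sub>R g \<or> \<beta> = - (2 *\<^sub>R g)" using EI by blast
      then have "g = f" using Eorth[OF g(1) fE] f(3) by (cases "g = f") auto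
      then show ?thesis using g(2) d[OF f(2)] by auto
    next
      assume "\<beta> \<in> short"
      then obtain g h where gh: "g \<in> E" "h \<in> E" "g \<noteq> h" "\<beta> = g + h \<or> \<beta> = g - h \<or> \<beta> = - g + h \<or> \<beta> = - g - h"
        using short_form by blast
      have gh': "g + h \<in> \<Delta>" by (rule sum_mem[OF gh(1-3) f(1) gh(4)])
      have "f = g \<or> f = h"
        using Eorth[OF gh(1) fE] Eorth[OF gh(2) fE] f(3) gh(4)
        by (cases "f = g"; cases "f = h") (auto simp: inner_add_left inner_diff_left)
      then have "g \<in> X \<and> h \<in> X"
        using X_step[OF _ gh(2,3) gh'] X_step[of h g] gh f(2) gh' by (auto simp: add.commute)
      then show ?thesis using d gh(4) by (auto simp: inner_add_left inner_diff_left)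
    qed
  qed (auto simp: D_def)
  have EX: "f \<in> X" if "f \<in> E" for f
  proof -
    have "2 *\<^sub>R f \<in> D" using ED(1)[OF that] \<open>D = \<Delta>\<close> longD(1) by blast
    then obtain g where "g \<in> X" "f \<bullet> g \<noteq> 0" by (auto simp: D_def)
    then show ?thesis using Eorth[OF that, of g] by (auto simp: X_def)
  qed
  have EE: "f + g \<in> \<Delta> \<and> f - g \<in> \<Delta>" if fg: "f \<in> E" "g \<in> E" "f \<noteq> g" for f g
  proof -
    have "f + g \<in> \<Delta>"
    proof (cases "f = e0 \<or> g = e0")
      case True
      then show ?thesis using EX[OF fg(1)] EX[OF fg(2)] fg(3) by (auto simp: X_def add.commute)
    next
      case False
      then have f: "e0 + f \<in> \<Delta>" "e0 + g \<in> \<Delta>" "e0 \<noteq> f" "e0 \<noteq> g"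
        using EX[OF fg(1)] EX[OF fg(2)] by (auto simp: X_def)
      have i: "e0 \<bullet> f = 0" "e0 \<bullet> g = 0" "f \<bullet> g = 0" "f \<bullet> e0 = 0" "g \<bullet> e0 = 0" "g \<bullet> f = 0"
        using Eorth e0 f fg by (auto simp: inner_commute)
      have "e0 + g \<in> short"
        using f(2) ED(3)[OF e0] ED(3)[OF fg(2)] i by (auto simp: short_def inner_add_left inner_add_right)
      then have "(e0 + f) - 1 *\<^sub>R (e0 + g) \<in> \<Delta>"
        by (rule reflect_short[OF _ f(1)]) (use i ED(3)[OF e0] in \<open>simp add: inner_add_left inner_add_right\<close>)
      then have "f - g \<in> \<Delta>" by simp
      then show ?thesis using pm[OF fg] by simp
    qed
    then show ?thesis using pm[OF fg] by simp
  qed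
  have finE: "finite E"
  proof (rule finite_subset)
    show "E \<subseteq> (\<lambda>\<gamma>. (1 / 2) *\<^sub>R \<gamma>) ` \<Delta>"
    proof
      fix f assume "f \<in> E"
      then show "f \<in> (\<lambda>\<gamma>. (1 / 2) *\<^sub>R \<gamma>) ` \<Delta>"
        using longD(1)[OF ED(1)] by (intro image_eqI[of _ _ "2 *\<^sub>R f"]) auto
    qed
  qed (use fin in simp)
  obtain e where e: "e ` {..<card E} = E" and dec: "\<And>i j. i < j \<Longrightarrow> j < card E \<Longrightarrow> v \<bullet> e j < v \<bullet> e i"
    using ordered_frame[OF finE] EE by metis
  define m where "m = card E - 1"
  obtain x where "x \<in> short" using ex_short by (auto simp: short_def)
  then obtain f0 g0 where fg: "f0 \<in> E" "g0 \<in> E" "f0 \<noteq> g0" using short_form by blast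
  have "card {f0, g0} \<le> card E" using fg finE by (intro card_mono) auto
  then have m: "card E = Suc m" "m \<ge> 1" using fg(3) by (auto simp: m_def)
  have eE: "e i \<in> E" if "i \<le> m" for i using e m that by (auto simp: less_Suc_eq_le)
  have eI: "\<exists>i\<le>m. f = e i" if "f \<in> E" for f using e m that by (auto simp: less_Suc_eq_le)
  have ne: "e i \<noteq> e j" if "i \<noteq> j" "i \<le> m" "j \<le> m" for i j
    using that dec[of i j] dec[of j i] m by (auto simp: less_Suc_eq_le neq_iff)
  interpret orthogonal_family e m "c / 2"
    using c_pos Eorth ED(3) eE ne by unfold_locales auto
  have vpos: "v \<bullet> e i > 0" if "i \<le> m" for i using ED(2) eE[OF that] by blast
  have "pos_C \<subseteq> pos"
  proof
    fix \<beta> assume "\<beta> \<in> pos_C"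
    then consider i where "i \<le> m" "\<beta> = 2 *\<^sub>R e i" | i j where "i < j" "j \<le> m" "\<beta> = e i - e j"
      | i j where "i < j" "j \<le> m" "\<beta> = e i + e j"
      by (auto simp: pos_C_def)
    then show "\<beta> \<in> pos"
    proof cases
      case 1
      then show ?thesis using ED(1)[OF eE[of i]] vpos by (auto simp: pos_def long_def)
    next
      case 2
      then have "e i \<noteq> e j" "e i \<in> E" "e j \<in> E" using ne eE by auto
      then have "\<beta> \<in> \<Delta>" using EE 2 by blast
      then show ?thesis using dec[of i j] 2 m by (auto simp: pos_def inner_diff_right)
    next
      case 3
      then have "e i \<noteq> e j" "e i \<in> E" "e j \<in> E" using ne eE by auto
      then have "\<beta> \<in> \<Delta>" using EE 3 by blast
      then show ?thesis using vpos[of i] vpos[of j] 3 by (auto simp: pos_def inner_add_right)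
    qed
  qed
  moreover have "pos \<subseteq> pos_C"
  proof
    fix \<beta> assume "\<beta> \<in> pos"
    then have \<beta>: "\<beta> \<in> \<Delta>" "v \<bullet> \<beta> > 0" by (auto simp: pos_def)
    from short_or_long[OF \<beta>(1)] EI[of \<beta>] short_form[of \<beta>]
    consider f where "f \<in> E" "\<beta> = 2 *\<^sub>R f \<or> \<beta> = - (2 *\<^sub>R f)"
      | f g where "f \<in> E" "g \<in> E" "f \<noteq> g" "\<beta> = f + g \<or> \<beta> = f - g \<or> \<beta> = - f + g \<or> \<beta> = - f - g"
      by blast
    then show "\<beta> \<in> pos_C"
    proof cases
      case 1
      then show ?thesis using \<beta>(2) ED(2)[OF 1(1)] eI[OF 1(1)] by (auto simp: pos_C_def)
    next
      case 2
      obtain i j where ij: "i \<le> m" "j \<le> m" "f = e i" "g = e j" using eI 2(1,2) by blast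
      then have "i \<noteq> j" using 2(3) by blast
      have "\<beta> \<noteq> - f - g" using \<beta>(2) vpos[of i] vpos[of j] ij by (auto simp: inner_diff_right)
      then consider "\<beta> = e i + e j" | "\<beta> = e i - e j" | "\<beta> = e j - e i"
        using 2(4) ij by auto
      then show ?thesis
      proof cases
        case 1
        then show ?thesis using pos_C_I(3)[of i j] pos_C_I(3)[of j i] ij \<open>i \<noteq> j\<close>
          by (cases "i < j") (auto simp: add.commute)
      next
        case 2
        then have "i < j" using dec[of j i] \<beta>(2) \<open>i \<noteq> j\<close> ij m by (auto simp: inner_diff_right neq_iff)
        then show ?thesis using 2 pos_C_I(2) ij by simp
      next
        case 3
        then have "j < i" using dec[of i j] \<beta>(2) \<open>i \<noteq> j\<close> ij m by (auto simp: inner_diff_right neq_iff)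
        then show ?thesis using 3 pos_C_I(2) ij by simp
      qed
    qed
  qed
  ultimately have pos: "pos = pos_C" by blast
  have "pos_C \<subseteq> \<Delta>" using pos by (auto simp: pos_def)
  moreover have "\<beta> \<bullet> \<beta> = 2 * (c / 2) \<or> \<beta> \<bullet> \<beta> = 4 * (c / 2)" if "\<beta> \<in> \<Delta>" for \<beta>
    using lengths[OF that] by auto
  ultimately show ?thesis
    unfolding product_formula_def pos using antichain_product_C[OF _ m(2)] by blast
qed

end

section \<open>Recognising type F4\<close>

context double_system begin

text \<open>For another \<open>f\<close> in the frame \<open>f + f0\<close> is long, so its inner
  product with \<open>g\<close> is 0, \<open>c\<close> or \<open>-c\<close>. As \<open>f0\<close>
  contributes half of \<open>c\<close> up to sign, \<open>f\<close> cannot contribute 0.\<close>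

lemma frame_half:
  assumes E: "frame E" and g: "g \<in> short" "g \<notin> E" "- g \<notin> E"
    and f0: "f0 \<in> E" "g \<bullet> f0 \<noteq> 0" and f: "f \<in> E"
  shows "g \<bullet> f = c / 2 \<or> g \<bullet> f = - c / 2"
proof -
  note FD = frameD[OF E]
  have val: "g \<bullet> h = 0 \<or> g \<bullet> h = c / 2 \<or> g \<bullet> h = - c / 2" if "h \<in> E" for h
    using inner_short[OF g(1) FD(1)[OF that]] g that by auto
  show ?thesis
  proof (cases "f = f0")
    case True
    then show ?thesis using val[OF f] f0 by auto
  next
    case False
    then have "g \<bullet> (f + f0) = 0 \<or> g \<bullet> (f + f0) = c \<or> g \<bullet> (f + f0) = - c"
      using inner_short_long[OF g(1) FD(4)[OF f f0(1)]] by blast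
    then show ?thesis using val[OF f] val[OF f0(1)] f0(2) c_pos by (auto simp: inner_add_right)
  qed
qed

text \<open>Every frame element accounts for \<open>c / 4\<close> of the squared length
  \<open>c\<close> of \<open>g\<close>. So there are at most four, and with four nothing of
  \<open>g\<close> is left outside their span.\<close>

lemma half_residue:
  assumes E: "frame E" and g: "g \<in> short" "g \<notin> E" "- g \<notin> E" and f0: "f0 \<in> E" "g \<bullet> f0 \<noteq> 0"
  shows "card E \<le> 4" "card E = 4 \<Longrightarrow> g = (\<Sum>f\<in>E. (g \<bullet> f / c) *\<^sub>R f)"
proof -
  note FD = frameD[OF E]
  define y where "y = g - (\<Sum>f\<in>E. (g \<bullet> f / c) *\<^sub>R f)"
  have sq: "(g \<bullet> f)\<^sup>2 = c * c / 4" if "f \<in> E" for f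
    using frame_half[OF E g f0 that] by (auto simp: power2_eq_square)
  have "y \<bullet> y = g \<bullet> g - (\<Sum>f\<in>E. (g \<bullet> f)\<^sup>2) / c"
    unfolding y_def using FD(6) c_pos FD(7) FD(3) by (rule orthogonal_residue_norm)
  also have "(\<Sum>f\<in>E. (g \<bullet> f)\<^sup>2) = (\<Sum>f\<in>E. c * c / 4)" by (rule sum.cong[OF refl sq])
  also have "\<dots> = real (card E) * (c * c / 4)" by simp
  also have "g \<bullet> g - real (card E) * (c * c / 4) / c = c * (1 - real (card E) / 4)"
    using c_pos shortD(2)[OF g(1)] by (simp add: field_simps)
  finally have y: "y \<bullet> y = c * (1 - real (card E) / 4)" .
  have "0 \<le> c * (1 - real (card E) / 4)" unfolding y[symmetric] by simp
  then have "0 \<le> 1 - real (card E) / 4" using c_pos by (simp add: zero_le_mult_iff)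
  then show "card E \<le> 4" by simp
  show "g = (\<Sum>f\<in>E. (g \<bullet> f / c) *\<^sub>R f)" if "card E = 4"
    using y that by (simp add: y_def)
qed

text \<open>Since \<open>g\<close> projects to \<open>f/2\<close> or \<open>-f/2\<close> on each \<open>f\<close> of the frame, reflecting \<open>g\<close> in a sum of two suitably
  signed frame elements gives an element of the frame of \<open>g\<close>; three elements of \<open>E\<close> thus yield four
  elements of the frame of \<open>g\<close>.\<close>

lemma frame_transfer:
  assumes E: "frame E" "card E \<ge> 3" and g: "g \<in> short" "v \<bullet> g > 0" "g \<notin> E"
    and f0: "f0 \<in> E" "g \<bullet> f0 \<noteq> 0" and E': "frame E'" "g \<in> E'"
  shows "card E' = 4" "\<And>f. f \<in> E \<Longrightarrow> f \<notin> E' \<and> f \<bullet> g \<noteq> 0"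
proof -
  note FD = frameD[OF E(1)] and FD' = frameD[OF E'(1)]
  have gE: "- g \<notin> E" using FD(2)[of "- g"] g(2) by auto
  note half = frame_half[OF E(1) g(1,3) gE f0]
  show nonorth: "f \<notin> E' \<and> f \<bullet> g \<noteq> 0" if "f \<in> E" for f
  proof -
    have "f \<bullet> g \<noteq> 0" using half[OF that] c_pos by (auto simp: inner_commute)
    moreover have "f \<noteq> g" using that g(3) by blast
    ultimately show ?thesis using FD'(3)[OF _ E'(2)] by blast
  qed
  obtain T where "T \<subseteq> E" "card T = 3" using obtain_subset_with_card_n[OF E(2)] by blast
  then obtain f1 f2 f3 where f: "f1 \<in> E" "f2 \<in> E" "f3 \<in> E" "f1 \<noteq> f2" "f2 \<noteq> f3" "f1 \<noteq> f3"
    by (auto simp: card_3_iff)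
  have sgn: "\<exists>F. (F = f \<or> F = - f) \<and> g \<bullet> F = c / 2" if "f \<in> E" for f
    using half[OF that] by (metis inner_minus_right minus_divide_left minus_minus)
  obtain F1 F2 F3 where F: "F1 = f1 \<or> F1 = - f1" "F2 = f2 \<or> F2 = - f2" "F3 = f3 \<or> F3 = - f3"
    and gF: "g \<bullet> F1 = c / 2" "g \<bullet> F2 = c / 2" "g \<bullet> F3 = c / 2"
    using sgn[OF f(1)] sgn[OF f(2)] sgn[OF f(3)] by blast
  have orth: "F1 \<bullet> F2 = 0" "F1 \<bullet> F3 = 0" "F2 \<bullet> F3 = 0" "F2 \<bullet> F1 = 0" "F3 \<bullet> F1 = 0" "F3 \<bullet> F2 = 0"
    using F FD(3) f by auto
  have nrm: "F1 \<bullet> F1 = c" "F2 \<bullet> F2 = c" "F3 \<bullet> F3 = c" using F FD(7) f by auto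
  have long_sum: "F + G \<in> long" if "f \<in> E" "h \<in> E" "f \<noteq> h" "F = f \<or> F = - f" "G = h \<or> G = - h" for f h F G
  proof -
    have "f + h \<in> long" "f - h \<in> long" "h - f \<in> long" using FD(4,5) that by auto
    moreover have "- f + h = h - f" "- f + - h = - (f + h)" "f + - h = f - h" by auto
    ultimately show ?thesis using that(4,5) neg_long by metis
  qed
  have gg: "g \<bullet> g = c" using shortD(2)[OF g(1)] .
  have step: "\<exists>h\<in>E'. h \<noteq> g \<and> (h = g - F - G \<or> h = - (g - F - G))"
    if FG: "F + G \<in> long" "g \<bullet> F = c / 2" "g \<bullet> G = c / 2" for F G
  proof -
    have "g \<bullet> (F + G) = c" using FG by (simp add: inner_add_right)
    then have i: "(F + G) \<bullet> g = c" by (simp only: inner_commute)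
    then obtain h where h: "h \<in> E'" "h \<noteq> g" "F + G = g + h \<or> F + G = g - h \<or> F + G = - g + h \<or> F + G = - g - h"
      using frame_long[OF E'(1) FG(1) E'(2)] c_pos by (metis less_irrefl)
    have hg: "h \<bullet> g = 0" by (rule FD'(3)[OF h(1) E'(2) h(2)])
    \<comment> \<open>Of the four sign patterns the inner product with \<open>g\<close> leaves those
      with \<open>+ g\<close>.\<close>
    have "(- g + h) \<bullet> g \<noteq> c" "(- g - h) \<bullet> g \<noteq> c"
      using hg gg c_pos by (simp_all add: inner_add_left inner_diff_left)
    then have "F + G = g + h \<or> F + G = g - h" using h(3) i by metis
    then have "h = - (g - F - G) \<or> h = g - F - G" by (auto simp: algebra_simps)
    then show ?thesis using h by blast
  qed
  obtain h1 where h1: "h1 \<in> E'" "h1 \<noteq> g" "h1 = g - F2 - F3 \<or> h1 = - (g - F2 - F3)"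
    using step[OF long_sum[OF f(2,3,5) F(2,3)] gF(2,3)] by blast
  obtain h2 where h2: "h2 \<in> E'" "h2 \<noteq> g" "h2 = g - F1 - F3 \<or> h2 = - (g - F1 - F3)"
    using step[OF long_sum[OF f(1,3,6) F(1,3)] gF(1,3)] by blast
  obtain h3 where h3: "h3 \<in> E'" "h3 \<noteq> g" "h3 = g - F1 - F2 \<or> h3 = - (g - F1 - F2)"
    using step[OF long_sum[OF f(1,2,4) F(1,2)] gF(1,2)] by blast
  have gF': "F1 \<bullet> g = c / 2" "F2 \<bullet> g = c / 2" "F3 \<bullet> g = c / 2" using gF by (simp_all add: inner_commute)
  \<comment> \<open>Any two of these vectors share exactly one \<open>F\<close>, and
    \<open>c - 4 * (c / 2) + c = 0\<close>. Orthogonality then makes \<open>h1\<close>,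
    \<open>h2\<close>, \<open>h3\<close> distinct.\<close>
  have "(g - F2 - F3) \<bullet> (g - F1 - F3) = 0" "(g - F2 - F3) \<bullet> (g - F1 - F2) = 0" "(g - F1 - F3) \<bullet> (g - F1 - F2) = 0"
    by (simp_all add: inner_diff_left inner_diff_right gF gF' orth nrm gg)
  moreover have signs: "p \<bullet> r = 0" if "p = q \<or> p = - q" "r = s \<or> r = - s" "q \<bullet> s = 0" for p q r s :: 'a
    using that by auto
  ultimately have o: "h1 \<bullet> h2 = 0" "h1 \<bullet> h3 = 0" "h2 \<bullet> h3 = 0"
    using signs[OF h1(3) h2(3)] signs[OF h1(3) h3(3)] signs[OF h2(3) h3(3)] by simp_all
  have "h \<bullet> h \<noteq> 0" if "h \<in> E'" for h using FD'(7)[OF that] c_pos by simp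
  then have d: "h1 \<noteq> h2" "h1 \<noteq> h3" "h2 \<noteq> h3" using o h1(1) h2(1) by metis+
  have "card {g, h1, h2, h3} \<le> card E'"
    using h1(1) h2(1) h3(1) E'(2) FD'(6) by (intro card_mono) auto
  moreover have "card {g, h1, h2, h3} = 4" using d h1(2) h2(2) h3(2) by auto
  \<comment> \<open>The roles are exchanged: \<open>f1\<close> is outside \<open>E'\<close> and not
    orthogonal to its element \<open>g\<close>.\<close>
  moreover have "card E' \<le> 4"
  proof (rule half_residue(1)[OF E'(1) _ _ _ E'(2)])
    show "f1 \<in> short" "f1 \<notin> E'" "f1 \<bullet> g \<noteq> 0" using FD(1) nonorth f(1) by auto
    show "- f1 \<notin> E'" using FD'(2)[of "- f1"] FD(2)[OF f(1)] by auto
  qed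
  ultimately show "card E' = 4" by simp
qed

text \<open>The projection \<open>\<pi>\<close> fixes every root that meets \<open>E\<close>: long
  ones are signed sums of two frame elements, short ones are in \<open>E\<close> up to sign or have
  zero residue. A root not fixed is orthogonal to \<open>E\<close>, hence to all fixed roots, and
  irreducibility excludes it.\<close>

lemma frame_spans:
  assumes E: "frame E" "card E = 4" and k: "k \<in> short" "k \<notin> E" "- k \<notin> E" and f0: "f0 \<in> E" "k \<bullet> f0 \<noteq> 0"
    and x: "x \<in> \<Delta>"
  shows "x = (\<Sum>f\<in>E. (x \<bullet> f / c) *\<^sub>R f)"
proof -
  note FD = frameD[OF E(1)]
  define \<pi> where "\<pi> x = (\<Sum>f\<in>E. (x \<bullet> f / c) *\<^sub>R f)" for x
  have \<pi>_add: "\<pi> (x + y) = \<pi> x + \<pi> y" for x y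
    by (simp add: \<pi>_def inner_add_left add_divide_distrib scaleR_add_left sum.distrib)
  have \<pi>_minus: "\<pi> (- x) = - \<pi> x" for x by (simp add: \<pi>_def sum_negf)
  have \<pi>_diff: "\<pi> (x - y) = \<pi> x - \<pi> y" for x y using \<pi>_add[of x "- y"] \<pi>_minus by simp
  have \<pi>_E: "\<pi> f = f" if "f \<in> E" for f
  proof -
    have "\<pi> f = (\<Sum>g\<in>E. if g = f then f else 0)"
      unfolding \<pi>_def by (rule sum.cong) (use FD(3,7) that c_pos in auto)
    then show ?thesis using FD(6) that by simp
  qed
  define D where "D = {x \<in> \<Delta>. \<pi> x = x}"
  have "D = \<Delta>"
  proof (rule irreducible_eq)
    have "f0 \<in> D" using f0 FD(1) \<pi>_E by (auto simp: D_def short_def)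
    then show "D \<noteq> {}" by blast
    fix \<beta> \<delta> assume \<beta>: "\<beta> \<in> D" and \<delta>: "\<delta> \<in> \<Delta>" "\<delta> \<notin> D"
    have "\<delta> \<bullet> f = 0" if f: "f \<in> E" for f
    proof (rule ccontr)
      assume nz: "\<delta> \<bullet> f \<noteq> 0"
      from short_or_long[OF \<delta>(1)] have "\<pi> \<delta> = \<delta>"
      proof
        assume "\<delta> \<in> long"
        then obtain g where "g \<in> E" "\<delta> = f + g \<or> \<delta> = f - g \<or> \<delta> = - f + g \<or> \<delta> = - f - g"
          using frame_long[OF E(1) _ f nz] by metis
        then show ?thesis using \<pi>_E f \<pi>_add \<pi>_diff \<pi>_minus by metis
      next
        assume s: "\<delta> \<in> short"
        show ?thesis
        proof (cases "\<delta> \<in> E \<or> - \<delta> \<in> E")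
          case True
          then show ?thesis using \<pi>_E \<pi>_minus by (metis minus_minus)
        next
          case False
          then show ?thesis using half_residue(2)[OF E(1) s _ _ f nz E(2)] by (simp add: \<pi>_def)
        qed
      qed
      then show False using \<delta> by (simp add: D_def)
    qed
    then have "f \<bullet> \<delta> = 0" if "f \<in> E" for f
      using that inner_commute[of f \<delta>] by metis
    then have "\<pi> \<beta> \<bullet> \<delta> = 0" by (simp add: \<pi>_def inner_sum_left)
    then show "\<beta> \<bullet> \<delta> = 0" using \<beta> by (simp add: D_def)
  qed (auto simp: D_def)
  then have "x \<in> D" using x by simp
  then show ?thesis by (simp add: D_def \<pi>_def)
qed

text \<open>Type F4. The aim is a frame of four elements containing the short root \<open>t\<close>
  with the largest value of \<open>v\<close>: comparing \<open>t\<close> with the half sum of that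
  frame yields the inequality between \<open>v \<bullet> e 0\<close> and the other three values that
  fixes the positive system.\<close>

lemma product_formula_half:
  assumes E: "frame E" "card E \<ge> 3" and g: "g \<in> short" "g \<notin> E" "- g \<notin> E" and f0: "f0 \<in> E" "g \<bullet> f0 \<noteq> 0"
  shows product_formula
proof -
  obtain t where t: "t \<in> short" and tmax: "\<And>f. f \<in> short \<Longrightarrow> v \<bullet> f \<le> v \<bullet> t"
  proof -
    have "finite short" "short \<noteq> {}" using fin ex_short by (auto simp: short_def)
    then show ?thesis using ex_maximizer[of short "\<lambda>f. v \<bullet> f"] that by blast
  qed
  have tv: "v \<bullet> t > 0"
    using tmax[of "- t"] t regular[OF shortD(1)[OF t]] by (auto simp: order_le_less)
  \<comment> \<open>\<open>E1\<close> is the frame of \<open>g\<close> or \<open>-g\<close>,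
    whichever is positive, and \<open>f1\<close> is the element \<open>f0\<close> of
    \<open>E\<close>.\<close>
  obtain E1 f1 where E1: "frame E1" "card E1 = 4" and f1: "f1 \<in> short" "v \<bullet> f1 > 0" "f1 \<notin> E1" "\<exists>h\<in>E1. f1 \<bullet> h \<noteq> 0"
  proof -
    obtain g' where g': "g' \<in> short" "v \<bullet> g' > 0" "g' \<notin> E" "g' \<bullet> f0 \<noteq> 0"
    proof (cases "v \<bullet> g > 0")
      case True
      then show ?thesis using that[of g] g f0 by blast
    next
      case False
      then have "v \<bullet> (- g) > 0" using regular[OF shortD(1)[OF g(1)]] by simp
      then show ?thesis using that[of "- g"] g f0 by simp
    qed
    obtain E1 where E1: "frame E1" "g' \<in> E1" using frame_exists g' by blast
    note ft = frame_transfer[OF E g'(1-3) f0(1) g'(4) E1]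
    show ?thesis using that[OF E1(1) ft(1)] ft(2)[OF f0(1)] frameD(1,2)[OF E(1) f0(1)] E1(2) by blast
  qed
  have f1': "- f1 \<notin> E1" using frameD(2)[OF E1(1), of "- f1"] f1(2) by auto
  obtain h0 where h0: "h0 \<in> E1" "f1 \<bullet> h0 \<noteq> 0" using f1(4) by blast
  obtain Et where Et: "frame Et" "t \<in> Et" using frame_exists[OF t tv] by blast
  obtain k where cardt: "card Et = 4" and k: "k \<in> short" "v \<bullet> k > 0" "k \<notin> Et" "k \<bullet> t \<noteq> 0"
  proof (cases "t \<in> E1")
    case False
    have "t = (\<Sum>f\<in>E1. (t \<bullet> f / c) *\<^sub>R f)"
      by (rule frame_spans[OF E1 f1(1,3) f1' h0 shortD(1)[OF t]])
    moreover have "t \<noteq> 0" using t zero_notin by (auto simp: short_def)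
    ultimately obtain h where h: "h \<in> E1" "t \<bullet> h \<noteq> 0"
      by (metis (no_types, lifting) div_0 scale_eq_0_iff sum.neutral)
    have "card E1 \<ge> 3" using E1(2) by simp
    note ft = frame_transfer[OF E1(1) this t tv False h Et]
    show ?thesis using that[OF ft(1)] ft(2)[OF h(1)] frameD(1,2)[OF E1(1) h(1)] by blast
  next
    case True
    \<comment> \<open>Transfer leads only to the frame of a root outside the given frame, so for
      \<open>t\<close> in \<open>E1\<close> a detour is made: the frame of \<open>f1\<close> does
      not contain \<open>t\<close>, and from it the frame of \<open>t\<close> is reached.\<close>
    obtain E2 where E2: "frame E2" "f1 \<in> E2" using frame_exists f1 by blast
    have "card E1 \<ge> 3" using E1(2) by simp
    note ft2 = frame_transfer[OF E1(1) this f1(1-3) h0 E2]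
    have "card E2 \<ge> 3" using ft2(1) by simp
    moreover have "t \<notin> E2" "t \<bullet> f1 \<noteq> 0" using ft2(2)[OF True] by auto
    ultimately have ft: "card Et = 4" "f1 \<notin> Et \<and> f1 \<bullet> t \<noteq> 0"
      using frame_transfer[OF E2(1) _ t tv _ E2(2) _ Et] E2(2) by auto
    then show ?thesis using that f1 by blast
  qed
  note FD = frameD[OF Et(1)]
  have k': "- k \<notin> Et" using FD(2)[of "- k"] k(2) by auto
  note spans = frame_spans[OF Et(1) cardt k(1,3) k' Et(2) k(4)]
  define R where "R = Et - {t}"
  have cardR: "card R = 3" using cardt Et(2) FD(6) by (simp add: R_def)
  obtain e' where e': "e' ` {..<card R} = R" and dec: "\<And>i j. i < j \<Longrightarrow> j < card R \<Longrightarrow> v \<bullet> e' j < v \<bullet> e' i"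
    using ordered_frame[of R] FD(5,6) longD(1) by (metis Diff_iff R_def finite_Diff)
  define e where "e i = (case i of 0 \<Rightarrow> t | Suc j \<Rightarrow> e' j)" for i
  have e_im: "e ` {..<4} = Et"
  proof -
    have "{..<4} = insert 0 (Suc ` {..<3})" by (simp add: lessThan_Suc_eq_insert_0[symmetric])
    then have "e ` {..<4} = insert t (e' ` {..<3})" by (simp add: image_image e_def)
    then show ?thesis using e' cardR Et(2) by (auto simp: R_def)
  qed
  have inj: "inj_on e {..<4}"
    using e_im cardt by (intro eq_card_imp_inj_on) simp_all
  have eE: "e i \<in> Et" if "i < 4" for i using e_im that by blast
  interpret orthogonal_family e 3 c
  proof
    show "e i \<bullet> e j = (if i = j then c else 0)" if "i \<le> 3" "j \<le> 3" for i j
    proof (cases "i = j")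
      case True
      then show ?thesis using FD(7)[OF eE[of i]] that by simp
    next
      case False
      then have "e i \<noteq> e j" using inj_onD[OF inj, of i j] that by auto
      then show ?thesis using False FD(3)[OF eE[of i] eE[of j]] that by simp
    qed
  qed (rule c_pos)
  \<comment> \<open>The Cartan integers with respect to the frame elements are the doubled
    coordinates.\<close>
  have coord: "\<exists>z. x = (\<Sum>i<4. (of_int (z i) / 2) *\<^sub>R e i) \<and> (\<forall>i<4. 2 * (x \<bullet> e i) = of_int (z i) * c) \<and>
      x \<bullet> x = c / 4 * of_int (\<Sum>i<4. z i * z i)" if x: "x \<in> \<Delta>" for x
  proof -
    have "\<exists>z. 2 * (x \<bullet> e i) = of_int z * c" if "i < 4" for i
    proof -
      have "2 * (x \<bullet> e i) / c \<in> \<int>"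
        using cartan_Ints[OF shortD(1)[OF FD(1)[OF eE[OF that]]] x] FD(7)[OF eE[OF that]] by simp
      then obtain z where "2 * (x \<bullet> e i) / c = of_int z" by (auto elim: Ints_cases)
      then have "2 * (x \<bullet> e i) = of_int z * c" using c_pos by (simp add: field_simps)
      then show ?thesis ..
    qed
    then obtain z where z: "\<And>i. i < 4 \<Longrightarrow> 2 * (x \<bullet> e i) = of_int (z i) * c" by metis
    have xe: "x \<bullet> e i = of_int (z i) * c / 2" if "i < 4" for i using z[OF that] by simp
    have "x = (\<Sum>i<4. (x \<bullet> e i / c) *\<^sub>R e i)"
      using spans[OF x] by (simp add: e_im[symmetric] sum.reindex[OF inj])
    also have "\<dots> = (\<Sum>i<4. (of_int (z i) / 2) *\<^sub>R e i)"
      by (rule sum.cong) (use xe c_pos in auto)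
    finally have xz: "x = (\<Sum>i<4. (of_int (z i) / 2) *\<^sub>R e i)" .
    have "x \<bullet> x = (\<Sum>i<4. of_int (z i) / 2 * (x \<bullet> e i))"
      by (subst (2) xz) (simp add: inner_sum_right)
    also have "\<dots> = (\<Sum>i<4. c / 4 * of_int (z i * z i))"
      by (rule sum.cong) (use xe in \<open>auto simp: field_simps\<close>)
    also have "\<dots> = c / 4 * of_int (\<Sum>i<4. z i * z i)" by (simp add: sum_distrib_left)
    finally show ?thesis using xz z by blast
  qed
  define H where "H z = (\<Sum>i<4. (of_int (z i) / 2) *\<^sub>R e i)" for z :: "nat \<Rightarrow> int"
  have hv: "half_vector e x = H (\<lambda>i. x ! i)" for x by (simp add: half_vector_def H_def)
  have sum4: "(\<Sum>i<4. f i) = f 0 + f 1 + f 2 + f 3" for f :: "nat \<Rightarrow> 'b::comm_monoid_add"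
    by (simp add: lessThan_nat_numeral lessThan_Suc ac_simps)
  have sub: "\<Delta> \<subseteq> half_vector e ` set F4_coords"
  proof
    fix x assume x: "x \<in> \<Delta>"
    then obtain z where z: "x = H z" "\<And>i. i < 4 \<Longrightarrow> 2 * (x \<bullet> e i) = of_int (z i) * c"
      "x \<bullet> x = c / 4 * of_int (\<Sum>i<4. z i * z i)"
      using coord[OF x] by (auto simp: H_def)
    have x': "x = half_vector e [z 0, z 1, z 2, z 3]"
      unfolding half_vector_def z(1) H_def sum4 by simp
    from short_or_long[OF x] have "(\<Sum>i<4. z i * z i) = 4 \<or>
        ((\<forall>i<4. even (z i)) \<and> (\<Sum>i<4. z i * z i) = 8)"
    proof
      assume "x \<in> short"
      then have "c / 4 * of_int (\<Sum>i<4. z i * z i) = c" using z(3) by (simp add: short_def)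
      then have "real_of_int (\<Sum>i<4. z i * z i) = 4" using c_pos by (simp add: field_simps del: of_int_sum)
      then show ?thesis by linarith
    next
      assume l: "x \<in> long"
      then have "c / 4 * of_int (\<Sum>i<4. z i * z i) = 2 * c" using z(3) by (simp add: long_def)
      then have "real_of_int (\<Sum>i<4. z i * z i) = 8" using c_pos by (simp add: field_simps del: of_int_sum)
      then have "(\<Sum>i<4. z i * z i) = 8" by linarith
      moreover have "even (z i)" if "i < 4" for i
      proof -
        have "real_of_int (z i) * c = 0 \<or> of_int (z i) * c = 2 * c \<or> of_int (z i) * c = - 2 * c"
          using inner_short_long[OF FD(1)[OF eE[OF that]] l] z(2)[OF that] by (auto simp: inner_commute)
        then have "real_of_int (z i) = 0 \<or> real_of_int (z i) = 2 \<or> real_of_int (z i) = - 2"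
          using c_pos by (metis mult_cancel_right mult_eq_0_iff less_irrefl)
        then have "z i = 0 \<or> z i = 2 \<or> z i = - 2" by linarith
        then show ?thesis by auto
      qed
      ultimately show ?thesis by blast
    qed
    then have "[z 0, z 1, z 2, z 3] \<in> set F4_coords"
      unfolding sum4 by (intro F4_coords_complete) auto
    then show "x \<in> half_vector e ` set F4_coords" using x' by blast
  qed
  have es: "e i \<in> short" if "i < 4" for i using FD(1)[OF eE[OF that]] .
  have signed: "of_int s *\<^sub>R e i \<in> \<Delta>" if "i < 4" "s = 1 \<or> s = - 1" for i and s :: int
    using shortD(1)[OF es[OF that(1)]] that(2) neg by auto
  have signed2: "of_int s *\<^sub>R e i + of_int u *\<^sub>R e j \<in> \<Delta>"
    if "i < 4" "j < 4" "i \<noteq> j" "s = 1 \<or> s = - 1" "u = 1 \<or> u = - 1" for i j and s u :: int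
  proof -
    have "e i \<noteq> e j" using inj_onD[OF inj, of i j] that by auto
    then have "e i + e j \<in> \<Delta>" "e i - e j \<in> \<Delta>" using FD(4,5)[OF eE[OF that(1)] eE[OF that(2)]] longD(1) by auto
    then have "e i + e j \<in> \<Delta>" "e i - e j \<in> \<Delta>" "e j - e i \<in> \<Delta>" "- e i - e j \<in> \<Delta>"
      using neg[of "e i + e j"] diff_swap by auto
    then show ?thesis using that(4,5) by auto
  qed
  \<comment> \<open>The reflection in \<open>e i\<close> changes the sign of the coordinate
    \<open>i\<close>.\<close>
  have flip: "H (z(i := - z i)) \<in> \<Delta>" if "H z \<in> \<Delta>" "i < 4" for z i
  proof -
    have "H z \<bullet> e i = (\<Sum>j<4. if j = i then of_int (z i) / 2 * c else 0)"
      unfolding H_def inner_sum_left by (rule sum.cong) (use ortho that(2) in auto)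
    then have "H z \<bullet> e i = of_int (z i) / 2 * c" using that(2) by simp
    then have "H z - of_int (z i) *\<^sub>R e i \<in> \<Delta>"
      by (intro reflect_short[OF es[OF that(2)] that(1)]) simp
    moreover have "H z - H (z(i := - z i)) = (\<Sum>j<4. if j = i then of_int (z i) *\<^sub>R e i else 0)"
      unfolding H_def sum_subtractf[symmetric]
      by (rule sum.cong) (auto simp: scaleR_add_left[symmetric])
    then have "H (z(i := - z i)) = H z - of_int (z i) *\<^sub>R e i"
      using that(2) by (simp add: algebra_simps)
    ultimately show ?thesis by simp
  qed
  obtain zk where zk: "k = H zk" "\<And>i. i < 4 \<Longrightarrow> 2 * (k \<bullet> e i) = of_int (zk i) * c"
    using coord[OF shortD(1)[OF k(1)]] by (auto simp: H_def)
  have zk1: "zk i = 1 \<or> zk i = - 1" if "i < 4" for i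
  proof -
    have "of_int (zk i) * c = 1 * c \<or> of_int (zk i) * c = (- 1) * c"
      using frame_half[OF Et(1) k(1,3) k' Et(2) k(4) eE[OF that]] zk(2)[OF that] by auto
    then have "real_of_int (zk i) = 1 \<or> real_of_int (zk i) = - 1"
      using c_pos by (metis mult_cancel_right less_irrefl)
    then show ?thesis by linarith
  qed
  \<comment> \<open>All sixteen signed half sums arise from the single root \<open>k\<close> by
    adjusting one sign after the other.\<close>
  have halves: "H z \<in> \<Delta>" if z: "\<And>i. i < 4 \<Longrightarrow> z i = 1 \<or> z i = - 1" for z
  proof -
    have "H (\<lambda>i. if i < n then z i else zk i) \<in> \<Delta>" if "n \<le> 4" for n
      using that
    proof (induction n)
      case 0
      then show ?case using zk(1) shortD(1)[OF k(1)] by (simp add: zk(1)[symmetric])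
    next
      case (Suc n)
      let ?z = "\<lambda>i. if i < n then z i else zk i"
      have IH: "H ?z \<in> \<Delta>" using Suc by simp
      have n: "n < 4" using Suc.prems by simp
      show ?case
      proof (cases "z n = zk n")
        case True
        then have "(\<lambda>i. if i < Suc n then z i else zk i) = ?z" by (auto simp: fun_eq_iff less_Suc_eq)
        then show ?thesis using IH by simp
      next
        case False
        then have "(\<lambda>i. if i < Suc n then z i else zk i) = ?z(n := - ?z n)"
          using z[OF n] zk1[OF n] by (auto simp: fun_eq_iff less_Suc_eq)
        then show ?thesis using flip[OF IH n] by simp
      qed
    qed
    from this[of 4] have "H (\<lambda>i. if i < 4 then z i else zk i) \<in> \<Delta>" by simp
    moreover have "H (\<lambda>i. if i < 4 then z i else zk i) = H z"
      unfolding H_def by (rule sum.cong) auto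
    ultimately show ?thesis by simp
  qed
  have sup: "half_vector e x \<in> \<Delta>" if x: "x \<in> set F4_coords" for x
    using F4_coords_cases[OF x]
  proof (elim disjE conjE bexE)
    assume "length x = 4" "\<forall>a\<in>set x. a = 1 \<or> a = - 1"
    then show ?thesis unfolding hv by (intro halves) auto
  next
    fix i s assume i: "i \<in> {0..<4}" and s: "s \<in> {1, - 1}" and xx: "x = map (\<lambda>j. if j = i then 2 * s else 0) [0..<4]"
    have "half_vector e x = (\<Sum>j<4. if j = i then of_int s *\<^sub>R e i else 0)"
      unfolding half_vector_def by (rule sum.cong) (auto simp: xx)
    then show ?thesis using i s signed[of i s] by simp
  next
    fix i j s u assume ij: "i \<in> {0..<4}" "j \<in> {0..<4}" "i \<noteq> j" and su: "s \<in> {1, - 1}" "u \<in> {1, - 1}"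
      and xx: "x = map (\<lambda>l. if l = i then 2 * s else if l = j then 2 * u else 0) [0..<4]"
    have "half_vector e x = (\<Sum>l<4. (if l = i then of_int s *\<^sub>R e i else 0) + (if l = j then of_int u *\<^sub>R e j else 0))"
      unfolding half_vector_def by (rule sum.cong) (use ij(3) in \<open>auto simp: xx\<close>)
    then have "half_vector e x = of_int s *\<^sub>R e i + of_int u *\<^sub>R e j"
      using ij by (simp add: sum.distrib)
    then show ?thesis using ij su signed2[of i j s u] by simp
  qed
  have \<Delta>: "\<Delta> = half_vector e ` set F4_coords" using sub sup by blast
  have e0: "e 0 = t" and e1: "e 1 = e' 0" and e2: "e 2 = e' 1" and e3: "e 3 = e' 2"
    by (simp_all add: e_def eval_nat_numeral)
  have v12: "v \<bullet> e 2 < v \<bullet> e 1" "v \<bullet> e 3 < v \<bullet> e 2" using dec[of 0 1] dec[of 1 2] cardR e1 e2 e3 by simp_all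
  have v3: "v \<bullet> e 3 > 0" using FD(2)[OF eE[of 3]] by simp
  \<comment> \<open>Maximality of \<open>t = e 0\<close> against the half sum of the frame gives the
    weak inequality. Equality would make \<open>v\<close> vanish on the root with signs
    \<open>+ - - -\<close>.\<close>
  have v0: "v \<bullet> e 1 + v \<bullet> e 2 + v \<bullet> e 3 < v \<bullet> e 0"
  proof -
    have h1: "H (\<lambda>_. 1) \<in> \<Delta>" by (rule halves) simp
    have h2: "H (\<lambda>i. if i = 0 then 1 else - 1) \<in> \<Delta>" by (rule halves) simp
    have "H (\<lambda>_. 1) \<bullet> H (\<lambda>_. 1) = c"
      unfolding H_def sum4 by (simp add: inner_add_left inner_add_right ortho)
    then have "v \<bullet> H (\<lambda>_. 1) \<le> v \<bullet> t" using h1 by (intro tmax) (simp add: short_def)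
    then have "v \<bullet> e 1 + v \<bullet> e 2 + v \<bullet> e 3 \<le> v \<bullet> e 0"
      unfolding H_def sum4 by (simp add: inner_add_right e0)
    moreover have "v \<bullet> H (\<lambda>i. if i = 0 then 1 else - 1) \<noteq> 0" by (rule regular[OF h2])
    then have "v \<bullet> e 1 + v \<bullet> e 2 + v \<bullet> e 3 \<noteq> v \<bullet> e 0"
      unfolding H_def sum4 by (simp add: inner_add_right inner_diff_right)
    ultimately show ?thesis by simp
  qed
  show ?thesis
    unfolding product_formula_def
    by (rule antichain_product_F4[OF orthogonal_family_axioms \<Delta> pos_def v12 v3 v0 lengths])
qed

text \<open>If the long roots are not pairwise orthogonal up to sign, some frame has at least three
  elements. The remaining alternative, whether a short root outside that frame meets it, separates
  F4 from B.\<close>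

theorem product_formula_double: product_formula
proof (cases "\<forall>\<gamma>\<in>long. \<forall>\<delta>\<in>long. \<gamma> \<bullet> \<delta> = 0 \<or> \<gamma> = \<delta> \<or> \<gamma> = - \<delta>")
  case True
  then show ?thesis by (intro product_formula_orthogonal_long) blast
next
  case False
  then obtain \<gamma> \<delta> where gd: "\<gamma> \<in> long" "\<delta> \<in> long" "\<gamma> \<bullet> \<delta> \<noteq> 0" "\<gamma> \<noteq> \<delta>" "\<gamma> \<noteq> - \<delta>" by blast
  obtain \<alpha> where "\<alpha> \<in> \<Delta>" "\<alpha> \<bullet> \<alpha> = c" using ex_short by blast
  then obtain e0 where e0: "e0 \<in> \<Delta>" "e0 \<bullet> e0 = c" "e0 \<bullet> \<gamma> \<noteq> 0"
    using ex_nonorthogonal_of_length[OF _ longD(1)[OF gd(1)]] by metis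
  obtain e where e: "e \<in> short" "v \<bullet> e > 0" "\<gamma> \<bullet> e \<noteq> 0"
  proof (cases "v \<bullet> e0 > 0")
    case True
    then show ?thesis using that[of e0] e0 by (simp add: short_def inner_commute)
  next
    case False
    then have "v \<bullet> (- e0) > 0" using regular[OF e0(1)] by simp
    then show ?thesis using that[of "- e0"] e0 neg[of e0] by (simp add: short_def inner_commute)
  qed
  obtain E where E: "frame E" "e \<in> E" using frame_exists[OF e(1,2)] by blast
  note FD = frameD[OF E(1)]
  obtain f where f: "f \<in> E" "f \<noteq> e" "\<gamma> = e + f \<or> \<gamma> = e - f \<or> \<gamma> = - e + f \<or> \<gamma> = - e - f"
    using frame_long[OF E(1) gd(1) E(2) e(3)] by blast
  \<comment> \<open>In a frame of two elements \<open>\<delta>\<close> would be a signed sum of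
    \<open>e\<close> and \<open>f\<close> like \<open>\<gamma>\<close>, hence orthogonal to
    \<open>\<gamma>\<close> or equal to it up to sign.\<close>
  have "E \<noteq> {e, f}"
  proof
    assume Eef: "E = {e, f}"
    have i: "e \<bullet> f = 0" "f \<bullet> e = 0" "e \<bullet> e = c" "f \<bullet> f = c" using FD(3,7) E(2) f by auto
    have "\<delta> \<bullet> e \<noteq> 0 \<or> \<delta> \<bullet> f \<noteq> 0"
      using gd(3) f(3) by (auto simp: inner_add_right inner_diff_right inner_commute[of _ \<delta>])
    then have "\<delta> = e + f \<or> \<delta> = e - f \<or> \<delta> = - e + f \<or> \<delta> = - e - f"
    proof
      assume "\<delta> \<bullet> e \<noteq> 0"
      then obtain g where "g \<in> E" "g \<noteq> e" "\<delta> = e + g \<or> \<delta> = e - g \<or> \<delta> = - e + g \<or> \<delta> = - e - g"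
        using frame_long[OF E(1) gd(2) E(2)] by blast
      then show ?thesis using Eef by auto
    next
      assume "\<delta> \<bullet> f \<noteq> 0"
      then obtain g where "g \<in> E" "g \<noteq> f" "\<delta> = f + g \<or> \<delta> = f - g \<or> \<delta> = - f + g \<or> \<delta> = - f - g"
        using frame_long[OF E(1) gd(2) f(1)] by blast
      then show ?thesis using Eef by auto
    qed
    then show False using f(3) gd(3-5) i
      by (elim disjE) (auto simp: inner_add_left inner_diff_left inner_add_right inner_diff_right)
  qed
  then obtain g where g: "g \<in> E" "g \<noteq> e" "g \<noteq> f" using E(2) f(1) by blast
  have "card {e, f, g} \<le> card E" using E(2) f(1) g(1) FD(6) by (intro card_mono) auto
  then have card: "card E \<ge> 3" using f(2) g by simp
  show ?thesis
  proof (cases "\<exists>h f. h \<in> short \<and> h \<notin> E \<and> - h \<notin> E \<and> f \<in> E \<and> h \<bullet> f \<noteq> 0")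
    case True
    then show ?thesis using product_formula_half[OF E(1) card] by blast
  next
    case False
    then show ?thesis using product_formula_single_frame[OF E(1,2) f(1)] f(2) by blast
  qed
qed

end

theorem theorem7p1:
  fixes \<Delta> P :: "'a::euclidean_space set"
  assumes "root_system \<Delta>" and "crystallographic \<Delta>" and "reduced_roots \<Delta>"
    and "irreducible_roots \<Delta>" and "two_lengths \<Delta>"
    and "positive_system \<Delta> P"
  shows "card (antichains (simple_roots P) P) =
         card (short_antichains \<Delta> P) *
         card (antichains (long_simple_roots \<Delta> P)
                 (subsystem_pos \<Delta> P (long_simple_roots \<Delta> P)))"
proof -
  obtain v where v: "\<forall>\<alpha>\<in>\<Delta>. v \<bullet> \<alpha> \<noteq> 0" "P = {\<alpha> \<in> \<Delta>. v \<bullet> \<alpha> > 0}"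
    using assms(6) by (auto simp: positive_system_def)
  interpret irreducible_system \<Delta> v
    using assms v by unfold_locales auto
  have P: "P = pos" using v by (simp add: pos_def)
  obtain c r where cr: "c > 0" "r = 2 \<or> r = 3" "\<And>\<beta>. \<beta> \<in> \<Delta> \<Longrightarrow> \<beta> \<bullet> \<beta> = c \<or> \<beta> \<bullet> \<beta> = r * c"
    "\<exists>\<beta>\<in>\<Delta>. \<beta> \<bullet> \<beta> = c" "\<exists>\<beta>\<in>\<Delta>. \<beta> \<bullet> \<beta> = r * c"
    by (rule two_length_classes[OF assms(5)], rule that)
  from cr(2) have product_formula
  proof
    assume "r = 2"
    then interpret double_system \<Delta> v c
      using cr by unfold_locales auto
    show ?thesis by (rule product_formula_double)
  next
    assume "r = 3"
    then show ?thesis using cr by (intro product_formula_triple) auto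
  qed
  then show ?thesis by (simp only: product_formula_def P)
qed

end
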